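(* Let $D$ be a positive integer and let $(G_1,G_2,\dots)$ be a sequence of finite graphs with all degrees bounded by $D$ that converges to a graphing $\mathbf{G}$ in the local-global sense. Let $f$ be a real-valued parameter of graphings (finite graphs being regarded as graphings with the uniform probability measure on their vertex set) that is continuous with respect to local convergence. For a graphing $\mathbf{H}=(J,\mu,E)$ define the setfunction $\varphi_{\mathbf{H},f}(F)=f(\mathbf{H}^F)$ on Borel subsets $F\subseteq E$, where $\mathbf{H}^F=(J,\mu,F)$. Then $\varphi_{G_n,f}\rightarrowtail\varphi_{\mathbf{G},f}$.
   Context: A graphing $\mathbf{G}=(J,\mu,E)$ consists of a standard Borel probability space $(J,\mu)$ and a Borel edge set $E\subseteq\binom{J}{2}$ with bounded degrees, such that $\int_A \deg(B,x)\,d\mu(x)=\int_B\deg(A,x)\,d\mu(x)$ for all measurable $A,B\subseteq J$, where $\deg(S,x)$ is the number of edges from $x$ to $S$. Local statistics: for $r\ge1$ and a rooted connected graph $\alpha$ of radius $r$, $P_r(\mathbf{H},\alpha)$ is the probability that the radius-$r$ ball around a random vertex (chosen by the vertex measure) is root-isomorphic to $\alpha$. $\mathbf{H}_n$ converges locally to $\mathbf{H}$ if $P_r(\mathbf{H}_n,\alpha)\to P_r(\mathbf{H},\alpha)$ for all $r,\alpha$; $f$ is continuous with respect to local convergence if $\mathbf{H}_n\to\mathbf{H}$ locally implies $f(\mathbf{H}_n)\to f(\mathbf{H})$. Local-global convergence: for $k,r\ge1$ and a (Borel, for graphings) coloring $c:V\to[k]$, $P_r[\mathbf{H},c]$ is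 the distribution of the isomorphism class of the colored radius-$r$ ball around a random vertex, and $Q_{k,r}(\mathbf{H})=\{P_r[\mathbf{H},c]:c\}$; $G_n\to\mathbf{G}$ local-globally if $Q_{k,r}(G_n)\to Q_{k,r}(\mathbf{G})$ in Hausdorff distance for all $k,r$. Quotient convergence: for a setfunction $\varphi$ on a set-algebra $(X,\mathcal{B})$, a $k$-quotient is $\varphi\circ F^{-1}$ for measurable $F:X\to[k]$, a vector in $\mathbb{R}^{2^k}$ indexed by subsets of $[k]$; $Q_k(\varphi)$ is the set of $k$-quotients; $\varphi_n\rightarrowtail\varphi$ means $Q_k(\varphi_n)\to Q_k(\varphi)$ in Hausdorff distance for every $k$. For finite graphs the set-algebra is all subsets of the edge set; for graphings it is the Borel subsets of the edge set. *)

theory Defs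
  imports "HOL-Probability.Probability"
begin

text \<open>A graphing is represented as a pair (M, E): M is the probability measure on the
  vertex space J = space M, and E is a set of 2-element subsets of J.\<close>

type_synonym 'a graphing = "'a measure \<times> 'a set set"

definition standard_borel :: "'a measure \<Rightarrow> bool" where
  "standard_borel M \<longleftrightarrow>
     (\<exists>T. completely_metrizable_space T \<and> separable_space T \<and>
          topspace T = space M \<and> sets M = sigma_sets (topspace T) {U. openin T U})"

definition edges_in :: "'a set \<Rightarrow> 'a set set \<Rightarrow> bool" where
  "edges_in J E \<longleftrightarrow> (\<forall>e\<in>E. \<exists>x y. x \<noteq> y \<and> x \<in> J \<and> y \<in> J \<and> e = {x, y})"

definition edge_borel :: "'a measure \<Rightarrow> 'a set set \<Rightarrow> bool" where
  "edge_borel M E \<longleftrightarrow> {(x, y). x \<in> space M \<and> y \<in> space M \<and> {x, y} \<in> E} \<in> sets (M \<Otimes>\<^sub>M M)"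

definition deg :: "'a set set \<Rightarrow> 'a set \<Rightarrow> 'a \<Rightarrow> nat" where
  "deg E S x = card {y \<in> S. {x, y} \<in> E}"

definition bounded_degree :: "'a set \<Rightarrow> 'a set set \<Rightarrow> nat \<Rightarrow> bool" where
  "bounded_degree J E D \<longleftrightarrow>
     (\<forall>x\<in>J. finite {y. {x, y} \<in> E} \<and> card {y. {x, y} \<in> E} \<le> D)"

definition graphing :: "'a graphing \<Rightarrow> bool" where
  "graphing H \<longleftrightarrow> (let M = fst H; E = snd H in
     prob_space M \<and> standard_borel M \<and> edges_in (space M) E \<and> edge_borel M E \<and>
     (\<exists>D. bounded_degree (space M) E D) \<and>
     (\<forall>A\<in>sets M. \<forall>B\<in>sets M.
        (\<integral>\<^sup>+ x\<in>A. ennreal (real (deg E B x)) \<partial>M) = (\<integral>\<^sup>+ x\<in>B. ennreal (real (deg E A x)) \<partial>M)))"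

definition fin_graph :: "nat \<Rightarrow> 'a set \<Rightarrow> 'a set set \<Rightarrow> bool" where
  "fin_graph D V E \<longleftrightarrow> finite V \<and> V \<noteq> {} \<and> edges_in V E \<and> bounded_degree V E D"

definition as_graphing :: "'a set \<Rightarrow> 'a set set \<Rightarrow> 'a graphing" where
  "as_graphing V E = (uniform_count_measure V, E)"

definition adjp :: "'a set set \<Rightarrow> 'a \<Rightarrow> 'a \<Rightarrow> bool" where
  "adjp E x y \<longleftrightarrow> {x, y} \<in> E"

definition ball :: "'a set set \<Rightarrow> nat \<Rightarrow> 'a \<Rightarrow> 'a set" where
  "ball E r x = {y. \<exists>n\<le>r. (adjp E ^^ n) x y}"

text \<open>A finite rooted graph alpha = (N, root, A): vertex set {..<N}, root vertex,
  edge set A of 2-subsets of {..<N}. It has radius (at most) r if every vertex is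
  within distance r of the root (hence it is connected).\<close>
type_synonym rgraph = "nat \<times> nat \<times> nat set set"

definition rooted_graph :: "nat \<Rightarrow> rgraph \<Rightarrow> bool" where
  "rooted_graph r \<alpha> = (case \<alpha> of (N, rt, A) \<Rightarrow>
     rt < N \<and> edges_in {..<N} A \<and> (\<forall>v<N. v \<in> ball A r rt))"

definition ball_iso_col ::
  "'a set set \<Rightarrow> nat \<Rightarrow> ('a \<Rightarrow> nat) \<Rightarrow> 'a \<Rightarrow> rgraph \<Rightarrow> (nat \<Rightarrow> nat) \<Rightarrow> bool" where
  "ball_iso_col E r c x \<alpha> col = (case \<alpha> of (N, rt, A) \<Rightarrow>
     (\<exists>h. bij_betw h (ball E r x) {..<N} \<and> h x = rt \<and>
          (\<forall>y\<in>ball E r x. \<forall>z\<in>ball E r x. {y, z} \<in> E \<longleftrightarrow> {h y, h z} \<in> A) \<and>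
          (\<forall>y\<in>ball E r x. c y = col (h y))))"

definition ball_iso :: "'a set set \<Rightarrow> nat \<Rightarrow> 'a \<Rightarrow> rgraph \<Rightarrow> bool" where
  "ball_iso E r x \<alpha> = (case \<alpha> of (N, rt, A) \<Rightarrow>
     (\<exists>h. bij_betw h (ball E r x) {..<N} \<and> h x = rt \<and>
          (\<forall>y\<in>ball E r x. \<forall>z\<in>ball E r x. {y, z} \<in> E \<longleftrightarrow> {h y, h z} \<in> A)))"

definition P_loc :: "'a graphing \<Rightarrow> nat \<Rightarrow> rgraph \<Rightarrow> real" where
  "P_loc H r \<alpha> = measure (fst H) {x \<in> space (fst H). ball_iso (snd H) r x \<alpha>}"

definition local_conv :: "(nat \<Rightarrow> 'a graphing) \<Rightarrow> 'a graphing \<Rightarrow> bool" where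
  "local_conv Hs H \<longleftrightarrow>
     (\<forall>r\<ge>1. \<forall>\<alpha>. rooted_graph r \<alpha> \<longrightarrow> (\<lambda>n. P_loc (Hs n) r \<alpha>) \<longlonglongrightarrow> P_loc H r \<alpha>)"

definition loc_continuous :: "('a graphing \<Rightarrow> real) \<Rightarrow> bool" where
  "loc_continuous f \<longleftrightarrow>
     (\<forall>Hs H. (\<forall>n. graphing (Hs n)) \<and> graphing H \<and> local_conv Hs H
        \<longrightarrow> (\<lambda>n. f (Hs n)) \<longlonglongrightarrow> f H)"

definition hausd :: "('b \<Rightarrow> 'b \<Rightarrow> ereal) \<Rightarrow> 'b set \<Rightarrow> 'b set \<Rightarrow> ereal" where
  "hausd d A B = max (SUP a\<in>A. INF b\<in>B. d a b) (SUP b\<in>B. INF a\<in>A. d a b)"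

definition borel_coloring :: "'a measure \<Rightarrow> nat \<Rightarrow> ('a \<Rightarrow> nat) \<Rightarrow> bool" where
  "borel_coloring M k c \<longleftrightarrow>
     (\<forall>x\<in>space M. c x < k) \<and> (\<forall>i<k. {x \<in> space M. c x = i} \<in> sets M)"

definition P_col :: "'a graphing \<Rightarrow> nat \<Rightarrow> ('a \<Rightarrow> nat) \<Rightarrow> rgraph \<times> (nat \<Rightarrow> nat) \<Rightarrow> real" where
  "P_col H r c \<beta> = measure (fst H)
     {x \<in> space (fst H). ball_iso_col (snd H) r c x (fst \<beta>) (snd \<beta>)}"

definition Q_kr :: "nat \<Rightarrow> nat \<Rightarrow> 'a graphing \<Rightarrow> (rgraph \<times> (nat \<Rightarrow> nat) \<Rightarrow> real) set" where
  "Q_kr k r H = {P_col H r c | c. borel_coloring (fst H) k c}"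

definition dist_distr :: "nat \<Rightarrow> (rgraph \<times> (nat \<Rightarrow> nat) \<Rightarrow> real)
    \<Rightarrow> (rgraph \<times> (nat \<Rightarrow> nat) \<Rightarrow> real) \<Rightarrow> ereal" where
  "dist_distr r p q = (SUP \<beta>\<in>{\<beta>. rooted_graph r (fst \<beta>)}. ereal \<bar>p \<beta> - q \<beta>\<bar>)"

definition local_global_conv :: "(nat \<Rightarrow> 'a graphing) \<Rightarrow> 'a graphing \<Rightarrow> bool" where
  "local_global_conv Gs G \<longleftrightarrow>
     (\<forall>k\<ge>1. \<forall>r\<ge>1. (\<lambda>n. hausd (dist_distr r) (Q_kr k r (Gs n)) (Q_kr k r G)) \<longlonglongrightarrow> 0)"

text \<open>k-quotients of a setfunction phi on the set-algebra (X, B): for measurable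
  F : X \<rightarrow> [k] (here [k] = {..<k}), the vector S \<mapsto> phi (F^-1 S), indexed by subsets
  S of [k] (set to 0 outside these indices).\<close>
definition quotients :: "nat \<Rightarrow> 'b set \<Rightarrow> 'b set set \<Rightarrow> ('b set \<Rightarrow> real) \<Rightarrow> (nat set \<Rightarrow> real) set" where
  "quotients k X B \<phi> =
     {(\<lambda>S. if S \<subseteq> {..<k} then \<phi> {e \<in> X. F e \<in> S} else 0) | F.
        (\<forall>e\<in>X. F e < k) \<and> (\<forall>i<k. {e \<in> X. F e = i} \<in> B)}"

definition dist_vec :: "nat \<Rightarrow> (nat set \<Rightarrow> real) \<Rightarrow> (nat set \<Rightarrow> real) \<Rightarrow> ereal" where
  "dist_vec k p q = (SUP S\<in>Pow {..<k}. ereal \<bar>p S - q S\<bar>)"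

definition quot_conv ::
  "(nat \<Rightarrow> 'b set) \<Rightarrow> (nat \<Rightarrow> 'b set set) \<Rightarrow> (nat \<Rightarrow> 'b set \<Rightarrow> real)
   \<Rightarrow> 'b set \<Rightarrow> 'b set set \<Rightarrow> ('b set \<Rightarrow> real) \<Rightarrow> bool" where
  "quot_conv Xs Bs \<phi>s X B \<phi> \<longleftrightarrow>
     (\<forall>k\<ge>1. (\<lambda>n. hausd (dist_vec k) (quotients k (Xs n) (Bs n) (\<phi>s n)) (quotients k X B \<phi>)) \<longlonglongrightarrow> 0)"

definition phi_set :: "'a graphing \<Rightarrow> ('a graphing \<Rightarrow> real) \<Rightarrow> 'a set set \<Rightarrow> real" where
  "phi_set H f F = f (fst H, F)"

definition borel_edge_subsets :: "'a graphing \<Rightarrow> 'a set set set" where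
  "borel_edge_subsets H = {F. F \<subseteq> snd H \<and> edge_borel (fst H) F}"

end

theory Submission
  imports Defs "HOL-Library.Diagonal_Subsequence"
begin

text \<open>An edge colouring of a bounded degree graph can be stored in a vertex colouring: give the
  neighbours of each vertex distinct labels and let every vertex remember the colour of the edge
  towards each label. The edge colour is then a symmetric function of the two vertex colours, so
  the local statistics of the decoded edge sets are finite sums of coloured ball statistics, and
  local-global closeness transfers edge colourings in both directions. On a graphing the labels
  are initial segments of a separating sequence of Borel sets, which fail only on a small set.

  Continuity of \<open>f\<close> becomes uniform by compactness: a sequence of finite graphs of bounded degree
  is coded by its proper edge colourings (families of involutions) and its separating vertex
  labels as a sequence of shift-invariant distributions on binary sequences; a weak limit, with
  the shifts as involutions, is a graphing and a local limit. It fits into the given vertex type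
  because an atomless limit graphing lives on a space of size continuum, while an atom forces the
  finite graphs to have bounded size.

  Measurability of ball statistics rests on the theorem that Borel sets with finite sections of
  bounded size have Borel projections, derived from Lusin's separation theorem.\<close>

section \<open>Analytic sets\<close>

text \<open>All local statistics are values of \<open>measure\<close>, which is zero on
  non-measurable sets; additivity over isomorphism types therefore needs every ball event to be
  Borel, and this is what the descriptive set theory is for. The other obstacle is that
  \<open>loc_continuous\<close> speaks about graphings on one fixed vertex type: a compactness
  argument may only use limits that live on that type, which is why the size of the type and the
  atoms of the limit matter. Compactness is applied to sequences of finite graphs only. A subgraph
  of the limit graphing enters through finite subgraphs that converge to it locally, so its value of
  \<open>f\<close> is compared with that of a finite graph through a further finite graph. Every
  transfer is made for one edge colouring and all colour sets S at once, since the distance of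
  quotients is a supremum over S. No radius is lost in decoding, because the ball of a subgraph lies
  in the ball of the graph; encoding on the limit needs one extra step, to see the neighbours of
  boundary vertices.\<close>

definition initseg :: "(nat \<Rightarrow> 'b) \<Rightarrow> nat \<Rightarrow> 'b list" where
  "initseg \<sigma> n = rev (map \<sigma> [0..<n])"

lemma initseg_0 [simp]: "initseg \<sigma> 0 = []"
  and initseg_Suc [simp]: "initseg \<sigma> (Suc n) = \<sigma> n # initseg \<sigma> n"
  and length_initseg [simp]: "length (initseg \<sigma> n) = n"
  by (auto simp: initseg_def)

text \<open>In a Polish space the sets with such a scheme are exactly the continuous images of Polish
  spaces; working with schemes avoids any auxiliary space.\<close>

definition souslin_scheme :: "'a topology \<Rightarrow> 'a set \<Rightarrow> (nat list \<Rightarrow> 'a set) \<Rightarrow> bool" where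
  "souslin_scheme T A U \<longleftrightarrow> U [] = A \<and> (\<forall>s. U s = (\<Union>n. U (n # s))) \<and>
     (\<forall>\<sigma>. (\<forall>n. U (initseg \<sigma> n) \<noteq> {}) \<longrightarrow>
        (\<exists>p\<in>A. \<forall>W. openin T W \<and> p \<in> W \<longrightarrow> (\<exists>n. U (initseg \<sigma> n) \<subseteq> W)))"

definition analytic_in :: "'a topology \<Rightarrow> 'a set \<Rightarrow> bool" where
  "analytic_in T A \<longleftrightarrow> A \<subseteq> topspace T \<and> (\<exists>U. souslin_scheme T A U)"

lemma souslin_schemeD:
  assumes "souslin_scheme T A U"
  shows "U [] = A" "U s = (\<Union>n. U (n # s))"
    "(\<And>n. U (initseg \<sigma> n) \<noteq> {}) \<Longrightarrow>
        \<exists>p\<in>A. \<forall>W. openin T W \<and> p \<in> W \<longrightarrow> (\<exists>n. U (initseg \<sigma> n) \<subseteq> W)"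
  using assms unfolding souslin_scheme_def by blast+

lemma souslin_scheme_antimono:
  assumes "souslin_scheme T A U" "m \<le> n"
  shows "U (initseg \<sigma> n) \<subseteq> U (initseg \<sigma> m)"
  using assms(2)
proof (induction n rule: dec_induct)
  case (step n)
  then show ?case using souslin_schemeD(2)[OF assms(1), of "initseg \<sigma> n"] by auto
qed simp

text \<open>Segments keep the newest value at the head, so the children of a node s are the lists n
  # s; the first value of a sequence then sits at the far end.\<close>

lemma initseg_snoc: "initseg \<sigma> (Suc n) = initseg (\<lambda>i. \<sigma> (Suc i)) n @ [\<sigma> 0]"
  by (induction n) auto

text \<open>The first value of a branch selects the set, the remaining values run through its
  scheme. Because lists are reversed, the selecting value is the last entry.\<close>

lemma analytic_in_UN_nat:
  assumes "\<And>i::nat. analytic_in T (A i)"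
  shows "analytic_in T (\<Union>i. A i)"
proof -
  obtain U where U: "\<And>i. souslin_scheme T (A i) (U i)"
    using assms unfolding analytic_in_def by metis
  define V where "V s = (if s = [] then (\<Union>i. A i) else U (last s) (butlast s))" for s
  have "souslin_scheme T (\<Union>i. A i) V"
    unfolding souslin_scheme_def
  proof (intro conjI allI impI)
    fix s show "V s = (\<Union>n. V (n # s))"
      using souslin_schemeD(1)[OF U] souslin_schemeD(2)[OF U, of "last s" "butlast s"]
      by (cases "s = []") (auto simp: V_def)
  next
    fix \<sigma> assume ne: "\<forall>n. V (initseg \<sigma> n) \<noteq> {}"
    have eq: "V (initseg \<sigma> (Suc n)) = U (\<sigma> 0) (initseg (\<lambda>i. \<sigma> (Suc i)) n)" for n
      unfolding V_def initseg_snoc by simp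
    have "\<exists>p\<in>A (\<sigma> 0). \<forall>W. openin T W \<and> p \<in> W \<longrightarrow> (\<exists>n. U (\<sigma> 0) (initseg (\<lambda>i. \<sigma> (Suc i)) n) \<subseteq> W)"
      by (rule souslin_schemeD(3)[OF U]) (use ne eq in metis)
    then obtain p where p: "p \<in> A (\<sigma> 0)"
      "\<And>W. openin T W \<Longrightarrow> p \<in> W \<Longrightarrow> \<exists>n. U (\<sigma> 0) (initseg (\<lambda>i. \<sigma> (Suc i)) n) \<subseteq> W" by auto
    show "\<exists>p\<in>\<Union>i. A i. \<forall>W. openin T W \<and> p \<in> W \<longrightarrow> (\<exists>n. V (initseg \<sigma> n) \<subseteq> W)"
    proof (intro bexI[of _ p] allI impI)
      fix W assume "openin T W \<and> p \<in> W"
      then obtain n where "U (\<sigma> 0) (initseg (\<lambda>i. \<sigma> (Suc i)) n) \<subseteq> W" using p(2) by auto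
      then have "V (initseg \<sigma> (Suc n)) \<subseteq> W" using eq by metis
      then show "\<exists>n. V (initseg \<sigma> n) \<subseteq> W" ..
    qed (use p in auto)
  qed (simp add: V_def)
  then show ?thesis using assms unfolding analytic_in_def by blast
qed

text \<open>For intersections, stage \<open>n\<close> of the combined scheme advances only the scheme with index
  \<open>fst (prod_decode n)\<close>.\<close>

fun thread :: "nat \<Rightarrow> nat list \<Rightarrow> nat list" where
  "thread i [] = []"
| "thread i (n # s) = (if fst (prod_decode (length s)) = i then n # thread i s else thread i s)"

text \<open>The stages assigned to one index are met in increasing order, so that the values read at
  them form initial segments of one sequence.\<close>

lemma prod_encode_less_iff: "prod_encode (i, t) < prod_encode (i, t') \<longleftrightarrow> t < t'"
proof -
  have "mono triangle" by (rule monoI) (unfold triangle_def, intro div_le_mono mult_le_mono, auto)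
  then have *: "prod_encode (i, t) \<le> prod_encode (i, t')" if "t \<le> t'" for t t'
    using that by (auto simp: prod_encode_def monoD)
  show ?thesis
    using *[of t t'] *[of t' t] by (cases t t' rule: linorder_cases) (auto simp: order.order_iff_strict)
qed

lemma thread_initseg:
  "thread i (initseg \<sigma> n) = initseg (\<lambda>t. \<sigma> (prod_encode (i, t))) (card {t. prod_encode (i, t) < n})"
proof (induction n)
  case (Suc n)
  show ?case
  proof (cases "fst (prod_decode n) = i")
    case True
    then obtain t where t: "n = prod_encode (i, t)"
      by (metis prod.collapse prod_decode_inverse)
    have "{t'. prod_encode (i, t') < n} = {..<t}" "{t'. prod_encode (i, t') < Suc n} = {..<Suc t}"
      using prod_encode_less_iff[of i] by (auto simp: t less_Suc_eq)
    then show ?thesis using Suc True t by simp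
  next
    case False
    then have "prod_encode (i, t') \<noteq> n" for t'
      by (metis fst_conv prod_encode_inverse)
    then have "{t'. prod_encode (i, t') < n} = {t'. prod_encode (i, t') < Suc n}"
      by (auto simp: less_Suc_eq)
    then show ?thesis using Suc False by simp
  qed
qed simp

text \<open>A branch of the combined scheme contains a branch for each index i and so yields a limit
  point in each A i. The nonempty pieces shrink into every neighbourhood of each of these points,
  and the Hausdorff property forces them to coincide.\<close>

lemma analytic_in_INT_nat:
  assumes T: "Hausdorff_space T" and A: "\<And>i::nat. analytic_in T (A i)"
  shows "analytic_in T (\<Inter>i. A i)"
proof -
  obtain U where U: "\<And>i. souslin_scheme T (A i) (U i)"
    using A unfolding analytic_in_def by metis
  define V where "V s = (\<Inter>i. U i (thread i s))" for s
  have split: "(\<forall>i. P i) \<longleftrightarrow> (\<forall>i. i \<noteq> j \<longrightarrow> P i) \<and> P j" for P and j :: nat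
    by metis
  have vstep: "V s = (\<Union>n. V (n # s))" for s
  proof -
    let ?j = "fst (prod_decode (length s))"
    have "z \<in> V s \<longleftrightarrow> (\<exists>n. z \<in> V (n # s))" for z
    proof -
      have "z \<in> V s \<longleftrightarrow> (\<forall>i. i \<noteq> ?j \<longrightarrow> z \<in> U i (thread i s)) \<and> z \<in> U ?j (thread ?j s)"
        using split[of "\<lambda>i. z \<in> U i (thread i s)" ?j] by (simp add: V_def)
      also have "\<dots> \<longleftrightarrow> (\<forall>i. i \<noteq> ?j \<longrightarrow> z \<in> U i (thread i s)) \<and> (\<exists>n. z \<in> U ?j (n # thread ?j s))"
        using souslin_schemeD(2)[OF U[of ?j], of "thread ?j s"] by auto
      also have "\<dots> \<longleftrightarrow> (\<exists>n. z \<in> V (n # s))"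
      proof -
        have "z \<in> V (n # s) \<longleftrightarrow> (\<forall>i. i \<noteq> ?j \<longrightarrow> z \<in> U i (thread i s)) \<and> z \<in> U ?j (n # thread ?j s)" for n
          using split[of "\<lambda>i. z \<in> U i (thread i (n # s))" ?j] by (simp add: V_def cong: imp_cong)
        then show ?thesis by blast
      qed
      finally show ?thesis .
    qed
    then show ?thesis by blast
  qed
  have mono: "V (initseg \<sigma> n) \<subseteq> V (initseg \<sigma> m)" if "m \<le> n" for \<sigma> m n
    using that
  proof (induction n rule: dec_induct)
    case (step n)
    then show ?case using vstep[of "initseg \<sigma> n"] by auto
  qed simp
  have "souslin_scheme T (\<Inter>i. A i) V"
    unfolding souslin_scheme_def
  proof (intro conjI allI impI vstep)
    show "V [] = (\<Inter>i. A i)" using souslin_schemeD(1)[OF U] by (simp add: V_def)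
    fix \<sigma> assume ne: "\<forall>n. V (initseg \<sigma> n) \<noteq> {}"
    define \<tau> where "\<tau> i t = \<sigma> (prod_encode (i, t))" for i t
    have thr: "thread i (initseg \<sigma> (prod_encode (i, t))) = initseg (\<tau> i) t" for i t
    proof -
      have "{t'. prod_encode (i, t') < prod_encode (i, t)} = {..<t}"
        using prod_encode_less_iff by auto
      then show ?thesis by (simp add: thread_initseg \<tau>_def[abs_def])
    qed
    have sub: "V (initseg \<sigma> (prod_encode (i, t))) \<subseteq> U i (initseg (\<tau> i) t)" for i t
      using INT_lower[of i UNIV "\<lambda>j. U j (thread j (initseg \<sigma> (prod_encode (i, t))))"]
      by (simp add: V_def thr)
    have "\<exists>p\<in>A i. \<forall>W. openin T W \<and> p \<in> W \<longrightarrow> (\<exists>n. V (initseg \<sigma> n) \<subseteq> W)" for i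
    proof -
      have "\<exists>p\<in>A i. \<forall>W. openin T W \<and> p \<in> W \<longrightarrow> (\<exists>n. U i (initseg (\<tau> i) n) \<subseteq> W)"
        by (rule souslin_schemeD(3)[OF U]) (use ne sub in blast)
      then show ?thesis using sub by (meson order_trans)
    qed
    then obtain p where p: "\<And>i. p i \<in> A i"
      "\<And>i W. openin T W \<Longrightarrow> p i \<in> W \<Longrightarrow> \<exists>n. V (initseg \<sigma> n) \<subseteq> W" by metis
    have "p i = p 0" for i
    proof (rule ccontr)
      assume "p i \<noteq> p 0"
      moreover have "p i \<in> topspace T" "p 0 \<in> topspace T" using A p(1) unfolding analytic_in_def by auto
      ultimately obtain W W' where W: "openin T W" "openin T W'" "p i \<in> W" "p 0 \<in> W'" "disjnt W W'"
        using T unfolding Hausdorff_space_def by metis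
      obtain n n' where "V (initseg \<sigma> n) \<subseteq> W" "V (initseg \<sigma> n') \<subseteq> W'" using p(2) W by metis
      then have "V (initseg \<sigma> (max n n')) \<subseteq> W \<inter> W'"
        using mono[of n "max n n'" \<sigma>] mono[of n' "max n n'" \<sigma>] by auto
      then show False using ne W(5) unfolding disjnt_def by auto
    qed
    then have "p 0 \<in> (\<Inter>i. A i)" using p(1) by (metis INT_I)
    then show "\<exists>p\<in>\<Inter>i. A i. \<forall>W. openin T W \<and> p \<in> W \<longrightarrow> (\<exists>n. V (initseg \<sigma> n) \<subseteq> W)"
      using p(2) by blast
  qed
  moreover have "(\<Inter>i. A i) \<subseteq> topspace T" using A unfolding analytic_in_def by blast
  ultimately show ?thesis unfolding analytic_in_def by blast
qed

lemma analytic_in_Int: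
  assumes "Hausdorff_space T" "analytic_in T A" "analytic_in T B"
  shows "analytic_in T (A \<inter> B)"
proof -
  have "A \<inter> B = (\<Inter>i::nat. if i = 0 then A else B)" by (auto split: if_splits)
  then show ?thesis using analytic_in_INT_nat[OF assms(1), of "\<lambda>i. if i = 0 then A else B"] assms by simp
qed

lemma analytic_in_empty [simp]: "analytic_in T {}"
  unfolding analytic_in_def souslin_scheme_def by (intro conjI exI[of _ "\<lambda>_. {}"]) auto

lemma analytic_in_UN:
  assumes "countable I" "\<And>i. i \<in> I \<Longrightarrow> analytic_in T (A i)"
  shows "analytic_in T (\<Union>i\<in>I. A i)"
proof (cases "I = {}")
  case False
  then have "(\<Union>i\<in>I. A i) = (\<Union>n. A (from_nat_into I n))"
    using range_from_nat_into[OF False assms(1)] by (metis image_image)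
  then show ?thesis using analytic_in_UN_nat[of T "\<lambda>n. A (from_nat_into I n)"] assms(2) from_nat_into[OF False] by simp
qed simp

section \<open>Polish spaces and analyticity of their Borel sets\<close>

definition polish_topology :: "'a topology \<Rightarrow> bool" where
  "polish_topology T \<longleftrightarrow> completely_metrizable_space T \<and> separable_space T"

lemma polish_topology_metric:
  assumes "polish_topology T" "topspace T \<noteq> {}"
  obtains d and q :: "nat \<Rightarrow> 'a" where "Metric_space (topspace T) d" "Metric_space.mcomplete (topspace T) d"
    "Metric_space.mtopology (topspace T) d = T" "range q \<subseteq> topspace T"
    "\<And>x e. x \<in> topspace T \<Longrightarrow> e > 0 \<Longrightarrow> \<exists>n. d (q n) x < e"
proof -
  obtain M d where Md: "Metric_space M d" "Metric_space.mcomplete M d" "T = Metric_space.mtopology M d"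
    using assms unfolding polish_topology_def completely_metrizable_space_def by auto
  interpret Metric_space M d by fact
  have top: "topspace T = M" using Md by simp
  obtain C where C: "countable C" "C \<subseteq> M" "T closure_of C = M"
    using assms unfolding polish_topology_def separable_space_def top by auto
  have "C \<noteq> {}" using C assms top by auto
  have q: "range (from_nat_into C) = C" using C \<open>C \<noteq> {}\<close> by (simp add: range_from_nat_into)
  have "\<exists>n. d (from_nat_into C n) x < e" if "x \<in> topspace T" "e > 0" for x e
  proof -
    have "x \<in> mtopology closure_of C" using that C Md(3) top by simp
    then obtain y where "y \<in> C" "y \<in> mball x e" using \<open>e > 0\<close> unfolding metric_closure_of in_mball by blast
    then show ?thesis using q by (metis commute imageE in_mball)
  qed
  with Md q C top that[of d "from_nat_into C"] show thesis by auto
qed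

lemma polish_imp_Hausdorff: "polish_topology T \<Longrightarrow> Hausdorff_space T"
  unfolding polish_topology_def
  using completely_metrizable_imp_metrizable_space metrizable_imp_Hausdorff_space by blast

lemma polish_prod_topology:
  assumes "polish_topology T" "polish_topology T'"
  shows "polish_topology (prod_topology T T')"
proof -
  obtain C C' where "countable C" "C \<subseteq> topspace T" "T closure_of C = topspace T"
    "countable C'" "C' \<subseteq> topspace T'" "T' closure_of C' = topspace T'"
    using assms unfolding polish_topology_def separable_space_def by auto
  then have "separable_space (prod_topology T T')"
    unfolding separable_space_def by (intro exI[of _ "C \<times> C'"]) (auto simp: closure_of_Times)
  then show ?thesis using assms unfolding polish_topology_def completely_metrizable_space_prod_topology by auto
qed

text \<open>Each level intersects with balls around a dense sequence, with radii halving from level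
  to level. Nonempty pieces along a branch have diameters tending to zero; completeness gives the
  limit and closedness keeps it in A.\<close>

lemma analytic_in_closedin:
  assumes T: "polish_topology T" and A: "closedin T A"
  shows "analytic_in T A"
proof (cases "topspace T = {}")
  case True
  then have "A = {}" using closedin_subset[OF A] by simp
  then show ?thesis by simp
next
  case False
  obtain d q where dq: "Metric_space (topspace T) d" "Metric_space.mcomplete (topspace T) d"
    "Metric_space.mtopology (topspace T) d = T" "range q \<subseteq> topspace T"
    "\<And>x e. x \<in> topspace T \<Longrightarrow> e > 0 \<Longrightarrow> \<exists>n. d (q (n::nat)) x < e"
    by (rule polish_topology_metric[OF T False]) blast
  interpret Metric_space "topspace T" d by fact
  define U where "U = rec_list A (\<lambda>n s X. X \<inter> mball (q n) (inverse (2 ^ length s)))"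
  have U [simp]: "U [] = A" "U (n # s) = U s \<inter> mball (q n) (inverse (2 ^ length s))" for n s
    by (auto simp: U_def)
  have sub: "U s \<subseteq> A" for s by (induction s) auto
  have AT: "A \<subseteq> topspace T" using closedin_subset[OF A] .
  have "souslin_scheme T A U"
    unfolding souslin_scheme_def
  proof (intro conjI allI impI)
    fix s show "U s = (\<Union>n. U (n # s))"
    proof -
      have "\<exists>n. x \<in> mball (q n) (inverse (2 ^ length s))" if "x \<in> U s" for x
        using dq(5)[of x "inverse (2 ^ length s)"] that sub AT dq(4) by (auto simp: subset_eq)
      then show ?thesis by auto
    qed
  next
    fix \<sigma> assume "\<forall>n. U (initseg \<sigma> n) \<noteq> {}"
    then have "\<forall>n. \<exists>y. y \<in> U (initseg \<sigma> n)" by blast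
    then obtain y where y: "\<And>n. y n \<in> U (initseg \<sigma> n)" by metis
    have yA: "y n \<in> A" for n using y sub by blast
    have mono: "U (initseg \<sigma> n) \<subseteq> U (initseg \<sigma> m)" if "m \<le> n" for m n
      using that by (induction n rule: dec_induct) auto
    have ball: "U (initseg \<sigma> n) \<subseteq> mball (q (\<sigma> m)) (inverse (2 ^ m))" if "m < n" for m n
      using mono[of "Suc m" n] that by auto
    have small: "\<exists>m::nat. c * inverse (2 ^ m) < e" if ec: "e > 0" "c > 0" for e c :: real
    proof -
      obtain m where "(1 / 2) ^ m < e / c" using real_arch_pow_inv[of "e/c" "1/2"] ec by auto
      then show ?thesis using ec by (auto simp: field_simps)
    qed
    have near: "d u v < 2 * inverse (2 ^ m)" if "u \<in> U (initseg \<sigma> n)" "v \<in> U (initseg \<sigma> n')" "m < n" "m < n'" for u v m n n'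
    proof -
      have "u \<in> mball (q (\<sigma> m)) (inverse (2 ^ m))" "v \<in> mball (q (\<sigma> m)) (inverse (2 ^ m))"
        using ball that by blast+
      then show ?thesis using triangle[of u "q (\<sigma> m)" v] commute[of u "q (\<sigma> m)"] by auto
    qed
    have "MCauchy y"
      unfolding MCauchy_def
    proof (intro conjI allI impI)
      show "range y \<subseteq> topspace T" using yA AT by auto
      fix e :: real assume "e > 0"
      then obtain m where "2 * inverse (2 ^ m) < e" using small[of e 2] by auto
      then show "\<exists>N. \<forall>n n'. N \<le> n \<longrightarrow> N \<le> n' \<longrightarrow> d (y n) (y n') < e"
        using near[OF y y] by (intro exI[of _ "Suc m"]) (force simp: Suc_le_eq)
    qed
    then obtain p where p: "limitin T y p sequentially" using dq(2,3) unfolding mcomplete_def by auto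
    have "p \<in> A"
      using limitin_closedin[OF p A] yA by simp
    show "\<exists>p\<in>A. \<forall>W. openin T W \<and> p \<in> W \<longrightarrow> (\<exists>n. U (initseg \<sigma> n) \<subseteq> W)"
    proof (intro bexI[OF _ \<open>p \<in> A\<close>] allI impI)
      fix W assume W: "openin T W \<and> p \<in> W"
      then obtain e where e: "e > 0" "mball p e \<subseteq> W" using dq(3) openin_mtopology by metis
      \<comment> \<open>A point of the piece is within two units 2^-m of a late y n, which is within
        one unit of p.\<close>
      obtain m where m: "4 * inverse (2 ^ m) < e" using small[of e 4] e by auto
      have "limitin mtopology y p sequentially" using p dq(3) by simp
      then have "\<exists>N. \<forall>n\<ge>N. d (y n) p < inverse (2 ^ m)"
        unfolding limit_metric_sequentially
        by (metis inverse_positive_iff_positive zero_less_numeral zero_less_power)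
      then obtain N where N: "\<And>n. n \<ge> N \<Longrightarrow> d (y n) p < inverse (2 ^ m)" by auto
      have "U (initseg \<sigma> (Suc m)) \<subseteq> mball p e"
      proof
        fix u assume u: "u \<in> U (initseg \<sigma> (Suc m))"
        let ?n = "max N (Suc m)"
        have "d u (y ?n) < 2 * inverse (2 ^ m)" by (rule near[OF u y]) auto
        moreover have "d (y ?n) p < inverse (2 ^ m)" using N by simp
        moreover have inT: "u \<in> topspace T" "y ?n \<in> topspace T" "p \<in> topspace T"
          using u sub AT yA \<open>p \<in> A\<close> by blast+
        ultimately have "d p u < 3 * inverse (2 ^ m)"
          using triangle[of u "y ?n" p] commute[of u p] by linarith
        also have "\<dots> \<le> 4 * inverse (2 ^ m)" by simp
        finally show "u \<in> mball p e" using m inT by simp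
      qed
      then show "\<exists>n. U (initseg \<sigma> n) \<subseteq> W" using e by blast
    qed
  qed simp
  then show ?thesis using AT unfolding analytic_in_def by blast
qed

lemma analytic_in_openin:
  assumes T: "polish_topology T" and A: "openin T A"
  shows "analytic_in T A"
proof -
  have "fsigma_in T A"
    using T A open_imp_fsigma_in completely_metrizable_imp_metrizable_space unfolding polish_topology_def by blast
  then obtain C where C: "\<And>n::nat. closedin T (C n)" "A = (\<Union>n. C n)"
    unfolding fsigma_in_ascending by metis
  then show ?thesis using analytic_in_UN_nat[of T C] analytic_in_closedin[OF T] by simp
qed

abbreviation borel_sets :: "'a topology \<Rightarrow> 'a set set" where
  "borel_sets T \<equiv> sigma_sets (topspace T) {U. openin T U}"

lemma sigma_algebra_borel_sets: "sigma_algebra (topspace T) (borel_sets T)"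
  by (rule sigma_algebra_sigma_sets) (auto simp: openin_subset[THEN subsetD])

text \<open>Analytic sets are not closed under complements, so the induction over Borel sets carries
  the set and its complement together; the complement of a union is then an intersection of analytic
  sets.\<close>

lemma analytic_in_borel:
  assumes T: "polish_topology T" and A: "A \<in> borel_sets T"
  shows "analytic_in T A"
proof -
  have "analytic_in T A \<and> analytic_in T (topspace T - A)"
    using A
  proof induction
    case (Basic a)
    then have "openin T a" "closedin T (topspace T - a)" by (auto intro: closedin_diff)
    then show ?case using analytic_in_openin[OF T] analytic_in_closedin[OF T] by blast
  next
    case Empty
    then show ?case using analytic_in_closedin[OF T] by auto
  next
    case (Compl a)
    then have "topspace T - (topspace T - a) = a" unfolding analytic_in_def by auto
    then show ?case using Compl by auto
  next
    case (Union a)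
    have "topspace T - (\<Union>i. a i) = (\<Inter>i. topspace T - a i)" by auto
    then show ?case using Union analytic_in_UN_nat[of T a] analytic_in_INT_nat[OF polish_imp_Hausdorff[OF T], of "\<lambda>i. topspace T - a i"]
      by auto
  qed
  then show ?thesis ..
qed

text \<open>A scheme of the product is projected piece by piece; a neighbourhood W of the first
  coordinate is tested by the cylinder over W.\<close>

lemma analytic_in_fst_image:
  assumes "analytic_in (prod_topology T T') S"
  shows "analytic_in T (fst ` S)"
proof -
  obtain U where U: "souslin_scheme (prod_topology T T') S U" and S: "S \<subseteq> topspace T \<times> topspace T'"
    using assms unfolding analytic_in_def by auto
  have "souslin_scheme T (fst ` S) (\<lambda>s. fst ` U s)"
    unfolding souslin_scheme_def
  proof (intro conjI allI impI)
    show "fst ` U [] = fst ` S" using souslin_schemeD(1)[OF U] by simp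
    fix s show "fst ` U s = (\<Union>n. fst ` U (n # s))"
      using souslin_schemeD(2)[OF U, of s] by (metis image_UN)
  next
    fix \<sigma> assume "\<forall>n. fst ` U (initseg \<sigma> n) \<noteq> {}"
    then obtain p where p: "p \<in> S" "\<And>W. openin (prod_topology T T') W \<Longrightarrow> p \<in> W \<Longrightarrow> \<exists>n. U (initseg \<sigma> n) \<subseteq> W"
      using souslin_schemeD(3)[OF U, of \<sigma>] by auto
    show "\<exists>p\<in>fst ` S. \<forall>W. openin T W \<and> p \<in> W \<longrightarrow> (\<exists>n. fst ` U (initseg \<sigma> n) \<subseteq> W)"
    proof (intro bexI[of _ "fst p"] allI impI)
      fix W assume "openin T W \<and> fst p \<in> W"
      then have "\<exists>n. U (initseg \<sigma> n) \<subseteq> W \<times> topspace T'"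
        using p S by (intro p(2)) (auto simp: openin_prod_Times_iff mem_Times_iff)
      then show "\<exists>n. fst ` U (initseg \<sigma> n) \<subseteq> W" by force
    qed (use p in auto)
  qed
  then show ?thesis using S unfolding analytic_in_def by force
qed

text \<open>Lusin separation. If two pieces cannot be separated, then some pair of their children
  cannot either, since separators of all pairs of children combine to one for the parents by a
  countable union of countable intersections. Two branches of inseparable pieces would converge to
  distinct points, whose disjoint open neighbourhoods separate late pieces.\<close>

lemma analytic_in_separation:
  assumes T: "Hausdorff_space T" and A: "analytic_in T A" and B: "analytic_in T B" and disj: "A \<inter> B = {}"
  obtains C where "C \<in> borel_sets T" "A \<subseteq> C" "C \<inter> B = {}"
proof -
  interpret sigma_algebra "topspace T" "borel_sets T" by (rule sigma_algebra_borel_sets)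
  define sep where "sep X Y \<longleftrightarrow> (\<exists>C\<in>borel_sets T. X \<subseteq> C \<and> C \<inter> Y = {})" for X Y
  obtain U V where U: "souslin_scheme T A U" and V: "souslin_scheme T B V"
    using A B unfolding analytic_in_def by auto
  have sep_UN: "sep (\<Union>n::nat. X n) (\<Union>m::nat. Y m)" if XY: "\<And>n m. sep (X n) (Y m)" for X Y
  proof -
    obtain C where C: "\<And>n m. C n m \<in> borel_sets T" "\<And>n m. X n \<subseteq> C n m" "\<And>n m. C n m \<inter> Y m = {}"
      using XY unfolding sep_def by metis
    have "(\<Union>n. \<Inter>m. C n m) \<in> borel_sets T"
      using C(1) by (intro countable_UN countable_INT) auto
    moreover have "(\<Union>n. X n) \<subseteq> (\<Union>n. \<Inter>m. C n m)" using C(2) by blast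
    moreover have "(\<Union>n. \<Inter>m. C n m) \<inter> (\<Union>m. Y m) = {}" using C(3) by blast
    ultimately show ?thesis unfolding sep_def by blast
  qed
  have "sep A B"
  proof (rule ccontr)
    assume nsep: "\<not> sep A B"
    have "\<exists>z. \<forall>n. (\<not> sep (U (fst (z n))) (V (snd (z n))) \<and> length (fst (z n)) = n \<and> length (snd (z n)) = n) \<and>
        (\<exists>a b. z (Suc n) = (a # fst (z n), b # snd (z n)))"
    proof (rule dependent_nat_choice)
      show "\<exists>z. \<not> sep (U (fst z)) (V (snd z)) \<and> length (fst z) = 0 \<and> length (snd z) = 0"
        using nsep souslin_schemeD(1)[OF U] souslin_schemeD(1)[OF V] by (intro exI[of _ "([], [])"]) simp
      fix z :: "nat list \<times> nat list" and n
      assume z: "\<not> sep (U (fst z)) (V (snd z)) \<and> length (fst z) = n \<and> length (snd z) = n"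
      then obtain a b where "\<not> sep (U (a # fst z)) (V (b # snd z))"
        using sep_UN[of "\<lambda>a. U (a # fst z)" "\<lambda>b. V (b # snd z)"]
          souslin_schemeD(2)[OF U, of "fst z"] souslin_schemeD(2)[OF V, of "snd z"] by auto
      then show "\<exists>y. (\<not> sep (U (fst y)) (V (snd y)) \<and> length (fst y) = Suc n \<and> length (snd y) = Suc n) \<and>
          (\<exists>a b. y = (a # fst z, b # snd z))"
        using z by (intro exI[of _ "(a # fst z, b # snd z)"]) auto
    qed
    then obtain z where z: "\<And>n. \<not> sep (U (fst (z n))) (V (snd (z n)))"
        "\<And>n. length (fst (z n)) = n \<and> length (snd (z n)) = n"
        "\<And>n. \<exists>a b. z (Suc n) = (a # fst (z n), b # snd (z n))" by blast
    from z(3) obtain \<sigma> \<tau> where \<sigma>\<tau>: "\<And>n. z (Suc n) = (\<sigma> n # fst (z n), \<tau> n # snd (z n))" by metis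
    have eq: "fst (z n) = initseg \<sigma> n \<and> snd (z n) = initseg \<tau> n" for n
      by (induction n) (use z(2)[of 0] \<sigma>\<tau> in auto)
    have nsep': "\<not> sep (U (initseg \<sigma> n)) (V (initseg \<tau> n))" for n using z(1) eq by metis
    have UA: "U s \<subseteq> A" for s
    proof (induction s)
      case (Cons n s) then show ?case using souslin_schemeD(2)[OF U, of s] by auto
    qed (use souslin_schemeD(1)[OF U] in auto)
    have "{} \<in> borel_sets T" "topspace T \<in> borel_sets T" by auto
    then have "sep {} Y" "sep (U s) {}" for Y s
      using UA A unfolding sep_def analytic_in_def by blast+
    then have "U (initseg \<sigma> n) \<noteq> {}" "V (initseg \<tau> n) \<noteq> {}" for n using nsep'[of n] by metis+
    then obtain p q where p: "p \<in> A" "\<And>W. openin T W \<Longrightarrow> p \<in> W \<Longrightarrow> \<exists>n. U (initseg \<sigma> n) \<subseteq> W"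
      and q: "q \<in> B" "\<And>W. openin T W \<Longrightarrow> q \<in> W \<Longrightarrow> \<exists>n. V (initseg \<tau> n) \<subseteq> W"
      using souslin_schemeD(3)[OF U, of \<sigma>] souslin_schemeD(3)[OF V, of \<tau>] by metis
    have "p \<noteq> q" "p \<in> topspace T" "q \<in> topspace T" using p q disj A B unfolding analytic_in_def by auto
    then obtain W W' where W: "openin T W" "openin T W'" "p \<in> W" "q \<in> W'" "disjnt W W'"
      using T unfolding Hausdorff_space_def by metis
    obtain n n' where "U (initseg \<sigma> n) \<subseteq> W" "V (initseg \<tau> n') \<subseteq> W'" using p(2) q(2) W by metis
    then have "U (initseg \<sigma> (max n n')) \<subseteq> W" "V (initseg \<tau> (max n n')) \<subseteq> W'"
      using souslin_scheme_antimono[OF U, of n "max n n'" \<sigma>] souslin_scheme_antimono[OF V, of n' "max n n'" \<tau>] by auto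
    moreover have "W \<in> borel_sets T" using W by (intro sigma_sets.Basic) simp
    ultimately have "sep (U (initseg \<sigma> (max n n'))) (V (initseg \<tau> (max n n')))"
      using W(5) unfolding sep_def disjnt_def by blast
    then show False using nsep' by blast
  qed
  then show ?thesis using that unfolding sep_def by blast
qed

section \<open>Projections of Borel sets with small sections\<close>

lemma standard_borelE:
  assumes "standard_borel M"
  obtains T where "polish_topology T" "topspace T = space M" "sets M = borel_sets T"
  using assms unfolding standard_borel_def polish_topology_def by blast

lemma sets_pair_subset_borel_sets:
  assumes "topspace T = space M" "sets M = borel_sets T" "S \<in> sets (M \<Otimes>\<^sub>M M)"
  shows "S \<in> borel_sets (prod_topology T T)"
proof -
  interpret sigma_algebra "space M \<times> space M" "borel_sets (prod_topology T T)"
    using sigma_algebra_borel_sets[of "prod_topology T T"] assms(1) by simp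
  have 1: "a \<times> space M \<in> borel_sets (prod_topology T T)" if "a \<in> borel_sets T" for a
    using that
  proof induction
    case (Basic a)
    then have "openin (prod_topology T T) (a \<times> topspace T)" by (simp add: openin_prod_Times_iff)
    then show ?case using assms(1) by (simp add: sigma_sets.Basic)
  next
    case (Compl a)
    have "(topspace T - a) \<times> space M = space M \<times> space M - a \<times> space M" using assms(1) by auto
    then show ?case using sigma_sets.Compl[OF Compl.IH] assms(1) by simp
  next
    case (Union a)
    have "(\<Union> (range a)) \<times> space M = (\<Union>i. a i \<times> space M)" by auto
    then show ?case using sigma_sets.Union[OF Union.IH] by simp
  qed auto
  have 2: "space M \<times> a \<in> borel_sets (prod_topology T T)" if "a \<in> borel_sets T" for a
    using that
  proof induction
    case (Basic a)
    then have "openin (prod_topology T T) (topspace T \<times> a)" by (simp add: openin_prod_Times_iff)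
    then show ?case using assms(1) by (simp add: sigma_sets.Basic)
  next
    case (Compl a)
    have "space M \<times> (topspace T - a) = space M \<times> space M - space M \<times> a" using assms(1) by auto
    then show ?case using sigma_sets.Compl[OF Compl.IH] assms(1) by simp
  next
    case (Union a)
    have "space M \<times> (\<Union> (range a)) = (\<Union>i. space M \<times> a i)" by auto
    then show ?case using sigma_sets.Union[OF Union.IH] by simp
  qed auto
  have "a \<times> b \<in> borel_sets (prod_topology T T)" if "a \<in> sets M" "b \<in> sets M" for a b
  proof -
    have "a \<times> b = (a \<times> space M) \<inter> (space M \<times> b)" using that[THEN sets.sets_into_space] by auto
    then show ?thesis using Int[OF 1[of a] 2[of b]] that unfolding assms(2) by simp
  qed
  then have "{a \<times> b |a b. a \<in> sets M \<and> b \<in> sets M} \<subseteq> borel_sets (prod_topology T T)" by auto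
  from sigma_sets_subset[OF this] show ?thesis using assms(3) unfolding sets_pair_measure by auto
qed

lemma analytic_in_projection:
  assumes "polish_topology T" "topspace T = space M" "sets M = borel_sets T" "S \<in> sets (M \<Otimes>\<^sub>M M)"
  shows "analytic_in T (fst ` S)"
  using analytic_in_fst_image analytic_in_borel[OF polish_prod_topology[OF assms(1,1)]]
    sets_pair_subset_borel_sets[OF assms(2-4)] by blast

text \<open>Balls around a dense sequence with radii 1/(k+1). Such a family turns equality of points
  into countably many membership tests, which is how equality of measurable maps becomes a
  measurable condition later.\<close>

lemma standard_borel_separating:
  assumes "standard_borel M"
  obtains B :: "nat \<Rightarrow> 'a set" where "\<And>i. B i \<in> sets M"
    "\<And>x y. x \<in> space M \<Longrightarrow> y \<in> space M \<Longrightarrow> x \<noteq> y \<Longrightarrow> \<exists>i. x \<in> B i \<longleftrightarrow> y \<notin> B i"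
proof -
  obtain T where T: "polish_topology T" "topspace T = space M" "sets M = borel_sets T"
    by (rule standard_borelE[OF assms])
  show thesis
  proof (cases "space M = {}")
    case True
    then show ?thesis using that[of "\<lambda>_. {}"] by simp
  next
    case False
    then have ne: "topspace T \<noteq> {}" using T by simp
    obtain d q where dq: "Metric_space (space M) d" "Metric_space.mtopology (space M) d = T" "range q \<subseteq> space M"
      "\<And>x e. x \<in> space M \<Longrightarrow> e > 0 \<Longrightarrow> \<exists>n. d (q (n::nat)) x < e"
      by (rule polish_topology_metric[OF T(1) ne, unfolded T(2)]) blast
    interpret Metric_space "space M" d by fact
    define B where "B n = (case prod_decode n of (i, k) \<Rightarrow> mball (q i) (inverse (real (Suc k))))" for n
    have "B n \<in> sets M" for n
      using openin_mball unfolding T(3) B_def dq(2) by (auto split: prod.splits)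
    moreover have "\<exists>n. x \<in> B n \<longleftrightarrow> y \<notin> B n" if xy: "x \<in> space M" "y \<in> space M" "x \<noteq> y" for x y
    proof -
      have "d x y > 0" using xy by auto
      then obtain k where k: "inverse (real (Suc k)) < d x y / 2"
        by (meson half_gt_zero reals_Archimedean)
      obtain i where i: "d (q i) x < inverse (real (Suc k))"
        using dq(4)[of x "inverse (real (Suc k))"] xy by auto
      have q: "q i \<in> space M" using dq(3) by auto
      have "d x y \<le> d (q i) x + d (q i) y" using triangle''[of x "q i" y] xy q by simp
      then have "x \<in> B (prod_encode (i, k)) \<and> y \<notin> B (prod_encode (i, k))"
        using i k xy q by (simp add: B_def)
      then show ?thesis by blast
    qed
    ultimately show ?thesis using that by blast
  qed
qed

text \<open>S is the graph of a partial function. The points mapped into a ball and those mapped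
  outside it are disjoint analytic sets, so a Borel set C separates them. These sets define a Borel
  function graph G that extends S and has a Borel domain. Inside this domain the complement of the
  projection of S is again a projection, and a second separation makes both Borel.\<close>

lemma sets_fst_image_single_valued:
  assumes M: "standard_borel M" and S: "S \<in> sets (M \<Otimes>\<^sub>M M)"
    and single: "\<And>x y y'. (x, y) \<in> S \<Longrightarrow> (x, y') \<in> S \<Longrightarrow> y = y'"
  shows "fst ` S \<in> sets M"
proof (cases "space M = {}")
  case True
  then have "S = {}" using sets.sets_into_space[OF S] by (auto simp: space_pair_measure)
  then show ?thesis by simp
next
  case False
  obtain T where T: "polish_topology T" "topspace T = space M" "sets M = borel_sets T"
    by (rule standard_borelE[OF M])
  have ne: "topspace T \<noteq> {}" using T False by simp
  obtain d q where dq: "Metric_space (space M) d" "Metric_space.mcomplete (space M) d"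
      "Metric_space.mtopology (space M) d = T" "range q \<subseteq> space M"
      "\<And>x e. x \<in> space M \<Longrightarrow> e > 0 \<Longrightarrow> \<exists>n. d (q (n::nat)) x < e"
    by (rule polish_topology_metric[OF T(1) ne, unfolded T(2)]) blast
  interpret Metric_space "space M" d by fact
  have qT: "q i \<in> space M" for i using dq(4) by auto
  have SJ: "S \<subseteq> space M \<times> space M" using sets.sets_into_space[OF S] by (simp add: space_pair_measure)
  define rd where "rd k = inverse (real (Suc k))" for k
  have rd0: "rd k > 0" for k by (simp add: rd_def)
  have rd_small: "\<exists>k. rd k < e" if "e > 0" for e
    using reals_Archimedean[OF that] by (auto simp: rd_def)
  have rd_mono: "rd k \<le> rd k'" if "k' \<le> k" for k k' using that by (simp add: rd_def field_simps)
  have ball: "mball (q i) (rd k) \<in> sets M" for i k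
    using openin_mball unfolding T(3) dq(3) by auto
  have cball: "mcball (q i) (rd k) \<in> sets M" for i k
  proof -
    have "openin T (space M - mcball (q i) (rd k))" using closedin_mcball dq(3) by (metis closedin_def topspace_mtopology)
    then have "space M - mcball (q i) (rd k) \<in> sets M" unfolding T(3) by auto
    moreover have "mcball (q i) (rd k) \<subseteq> space M"
      by (rule mcball_subset_mspace)
    ultimately show ?thesis by (metis Diff_Diff_Int inf.absorb_iff2 sets.compl_sets)
  qed
  have rect: "S \<inter> space M \<times> B \<in> sets (M \<Otimes>\<^sub>M M)" if "B \<in> sets M" for B using S that by auto
  have ex: "\<exists>C. C \<in> sets M \<and> fst ` (S \<inter> space M \<times> mball (q i) (rd k)) \<subseteq> C \<and>
      C \<inter> fst ` (S \<inter> space M \<times> (space M - mball (q i) (rd k))) = {}" for i k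
  proof -
    have "fst ` (S \<inter> space M \<times> mball (q i) (rd k)) \<inter> fst ` (S \<inter> space M \<times> (space M - mball (q i) (rd k))) = {}"
      using single by fastforce
    then obtain C where "C \<in> borel_sets T" "fst ` (S \<inter> space M \<times> mball (q i) (rd k)) \<subseteq> C"
      "C \<inter> fst ` (S \<inter> space M \<times> (space M - mball (q i) (rd k))) = {}"
      by (rule analytic_in_separation[OF polish_imp_Hausdorff[OF T(1)] analytic_in_projection[OF T rect[OF ball]]
        analytic_in_projection[OF T rect[OF sets.compl_sets[OF ball]]]])
    then show ?thesis unfolding T(3) by (intro exI conjI)
  qed
  from choice[OF allI[OF choice[OF allI[OF ex]]]] obtain C where
    "\<forall>i k. C i k \<in> sets M \<and> fst ` (S \<inter> space M \<times> mball (q i) (rd k)) \<subseteq> C i k \<and>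
      C i k \<inter> fst ` (S \<inter> space M \<times> (space M - mball (q i) (rd k))) = {}" ..
  then have C: "\<And>i k. C i k \<in> sets M" "\<And>i k. fst ` (S \<inter> space M \<times> mball (q i) (rd k)) \<subseteq> C i k"
    "\<And>i k. C i k \<inter> fst ` (S \<inter> space M \<times> (space M - mball (q i) (rd k))) = {}" by simp_all
  have inC: "x \<in> C i k \<longleftrightarrow> d (q i) y < rd k" if "(x, y) \<in> S" for x y i k
  proof -
    have "x \<in> space M" "y \<in> space M" using SJ that by auto
    moreover have "x \<in> C i k" if "d (q i) y < rd k"
    proof -
      have "(x, y) \<in> S \<inter> space M \<times> mball (q i) (rd k)"
        using that \<open>(x, y) \<in> S\<close> \<open>x \<in> space M\<close> \<open>y \<in> space M\<close> qT by auto
      then show ?thesis using C(2)[of i k] by force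
    qed
    moreover have "x \<notin> C i k" if "\<not> d (q i) y < rd k"
    proof -
      have "(x, y) \<in> S \<inter> space M \<times> (space M - mball (q i) (rd k))"
        using that \<open>(x, y) \<in> S\<close> \<open>x \<in> space M\<close> \<open>y \<in> space M\<close> qT by auto
      then show ?thesis using C(3)[of i k] by force
    qed
    ultimately show ?thesis by blast
  qed
  \<comment> \<open>On D0 there is a ball of every radius and the balls are pairwise compatible, so
    the centres of ever smaller balls form a Cauchy sequence. The set no longer mentions S.\<close>
  define D0 where "D0 = {x \<in> space M. (\<forall>k. \<exists>i. x \<in> C i k) \<and>
     (\<forall>i k i' k'. x \<in> C i k \<longrightarrow> x \<in> C i' k' \<longrightarrow> d (q i) (q i') \<le> rd k + rd k')}"
  \<comment> \<open>Closed balls: the limit of the centres satisfies only the weak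
    inequality.\<close>
  define G where "G = {(x, y). x \<in> D0 \<and> y \<in> space M \<and> (\<forall>i k. x \<in> C i k \<longrightarrow> y \<in> mcball (q i) (rd k))}"
  have D0: "D0 \<in> sets M"
  proof -
    have [measurable]: "Measurable.pred M (\<lambda>x. x \<in> C i k)" for i k
      using C(1) by (simp add: pred_sets2)
    show ?thesis unfolding D0_def by measurable
  qed
  have G: "G \<in> sets (M \<Otimes>\<^sub>M M)"
  proof -
    have [measurable]: "C i k \<in> sets M" "mcball (q i) (rd k) \<in> sets M" "D0 \<in> sets M" for i k using C(1) cball D0 by auto
    have "G = {p \<in> space (M \<Otimes>\<^sub>M M). fst p \<in> D0 \<and> (\<forall>i k. fst p \<in> C i k \<longrightarrow> snd p \<in> mcball (q i) (rd k))}"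
      unfolding G_def D0_def by (auto simp: space_pair_measure)
    also have "\<dots> \<in> sets (M \<Otimes>\<^sub>M M)" by measurable
    finally show ?thesis .
  qed
  have SG: "S \<subseteq> G"
  proof clarify
    fix x y assume xy: "(x, y) \<in> S"
    then have J: "x \<in> space M" "y \<in> space M" using SJ by auto
    have "\<exists>i. x \<in> C i k" for k using inC[OF xy] dq(5)[of y "rd k"] J rd0 by auto
    moreover have "d (q i) (q i') \<le> rd k + rd k'" if "x \<in> C i k" "x \<in> C i' k'" for i k i' k'
      using that inC[OF xy] triangle'[of "q i" y "q i'"] J qT by (smt (verit))
    ultimately have "x \<in> D0" using J by (auto simp: D0_def)
    then show "(x, y) \<in> G" using inC[OF xy] J qT by (auto simp: G_def less_imp_le)
  qed
  have G_unique: "y = y'" if xG: "(x, y) \<in> G" "(x, y') \<in> G" for x y y'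
  proof (rule ccontr)
    assume "y \<noteq> y'"
    then have "d y y' > 0" using that by (auto simp: G_def)
    then obtain k where k: "rd k < d y y' / 2" using rd_small by (meson half_gt_zero)
    obtain i where "x \<in> C i k" using xG unfolding G_def D0_def by blast
    then have "d (q i) y \<le> rd k" "d (q i) y' \<le> rd k" using that by (auto simp: G_def)
    then show False using k triangle''[of y "q i" y'] that qT by (auto simp: G_def)
  qed
  have G_ex: "\<exists>y. (x, y) \<in> G" if x: "x \<in> D0" for x
  proof -
    have "\<forall>k. \<exists>i. x \<in> C i k" using x unfolding D0_def by blast
    then obtain i where i: "\<And>k. x \<in> C (i k) k" by metis
    have dd: "d (q i1) (q i2) \<le> rd k1 + rd k2" if "x \<in> C i1 k1" "x \<in> C i2 k2" for i1 i2 k1 k2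
      using x that unfolding D0_def by blast
    have "MCauchy (\<lambda>k. q (i k))"
      unfolding MCauchy_def
    proof (intro conjI allI impI)
      fix e :: real assume "e > 0"
      then obtain N where N: "rd N < e / 2" using rd_small by (meson half_gt_zero)
      have "d (q (i n)) (q (i n')) < e" if "N \<le> n" "N \<le> n'" for n n'
        using dd[OF i i, of n n'] rd_mono[OF that(1)] rd_mono[OF that(2)] N by linarith
      then show "\<exists>N. \<forall>n n'. N \<le> n \<longrightarrow> N \<le> n' \<longrightarrow> d (q (i n)) (q (i n')) < e" by blast
    qed (use qT in auto)
    then obtain y where y: "limitin mtopology (\<lambda>k. q (i k)) y sequentially"
      using dq(2) unfolding mcomplete_def by blast
    then have yT: "y \<in> space M" by (simp add: limit_metric_sequentially)
    have "d (q i1) y \<le> rd k1" if C1: "x \<in> C i1 k1" for i1 k1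
    proof (rule field_le_epsilon)
      fix e :: real assume "e > 0"
      then obtain N1 where N1: "rd N1 < e / 2" using rd_small by (meson half_gt_zero)
      obtain N2 where N2: "\<And>n. n \<ge> N2 \<Longrightarrow> d (q (i n)) y < e / 2"
        using y \<open>e > 0\<close> unfolding limit_metric_sequentially by (meson half_gt_zero)
      let ?n = "max N1 N2"
      have "d (q i1) y \<le> d (q i1) (q (i ?n)) + d (q (i ?n)) y" using triangle qT yT by simp
      also have "\<dots> \<le> rd k1 + rd ?n + e / 2" using dd[OF C1 i, of ?n] N2[of ?n] by simp
      also have "\<dots> \<le> rd k1 + e" using rd_mono[of N1 ?n] N1 by simp
      finally show "d (q i1) y \<le> rd k1 + e" .
    qed
    then have "(x, y) \<in> G" using x yT qT by (auto simp: G_def)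
    then show ?thesis ..
  qed
  \<comment> \<open>Over each point of D0 the section of G is a single point, so the projection of
    the difference is the difference of the projections.\<close>
  have "D0 - fst ` S = fst ` (G - S)"
  proof
    show "D0 - fst ` S \<subseteq> fst ` (G - S)" using G_ex by force
    show "fst ` (G - S) \<subseteq> D0 - fst ` S"
    proof clarify
      fix x y assume xy: "(x, y) \<in> G" "(x, y) \<notin> S"
      have "x \<notin> fst ` S"
      proof
        assume "x \<in> fst ` S"
        then obtain z where "(x, z) \<in> S" by force
        then show False using G_unique[OF xy(1), of z] SG xy(2) by auto
      qed
      then show "fst (x, y) \<in> D0 - fst ` S" using xy(1) by (simp add: G_def)
    qed
  qed
  then have "analytic_in T (D0 - fst ` S)"
    using analytic_in_projection[OF T sets.Diff[OF G S]] by simp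
  moreover have "fst ` S \<inter> (D0 - fst ` S) = {}" by blast
  ultimately obtain X where X: "X \<in> borel_sets T" "fst ` S \<subseteq> X" "X \<inter> (D0 - fst ` S) = {}"
    by (rule analytic_in_separation[OF polish_imp_Hausdorff[OF T(1)] analytic_in_projection[OF T S]])
  have "fst ` S = X \<inter> D0" using X SG by (auto simp: G_def)
  moreover have "X \<in> sets M" using X(1) T(3) by simp
  ultimately show ?thesis using D0 by simp
qed

text \<open>A finite section with at least m > 1 points is cut by some set of the separating family
  into two nonempty parts, with at least a and m - a points for some 0 < a < m. Hence the set is a
  countable union of intersections from smaller cases; for m = 1 it is a projection.\<close>

lemma analytic_in_card_ge:
  assumes T: "polish_topology T" "topspace T = space M" "sets M = borel_sets T"
    and S: "S \<in> sets (M \<Otimes>\<^sub>M M)" and fin: "\<And>x. finite (S `` {x})" and m: "m > 0"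
  shows "analytic_in T {x \<in> space M. m \<le> card (S `` {x})}"
proof -
  have M: "standard_borel M" using T unfolding standard_borel_def polish_topology_def by auto
  obtain B :: "nat \<Rightarrow> 'a set" where B: "\<And>i. B i \<in> sets M"
    "\<And>x y. x \<in> space M \<Longrightarrow> y \<in> space M \<Longrightarrow> x \<noteq> y \<Longrightarrow> \<exists>i. x \<in> B i \<longleftrightarrow> y \<notin> B i"
    by (rule standard_borel_separating[OF M]) blast
  note H = polish_imp_Hausdorff[OF T(1)]
  show ?thesis
    using S fin m
  proof (induction m arbitrary: S rule: less_induct)
    case (less m)
    have SJ: "S \<subseteq> space M \<times> space M" using sets.sets_into_space[OF less.prems(1)] by (simp add: space_pair_measure)
    show ?case
    proof (cases "m = 1")
      case True
      have "{x \<in> space M. m \<le> card (S `` {x})} = fst ` S"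
        using less.prems(2) SJ by (force simp: True Suc_le_eq card_gt_0_iff)
      then show ?thesis using analytic_in_projection[OF T less.prems(1)] by simp
    next
      case False
      define S1 where "S1 i = S \<inter> space M \<times> B i" for i
      define S2 where "S2 i = S \<inter> space M \<times> (space M - B i)" for i
      have S12: "S1 i \<in> sets (M \<Otimes>\<^sub>M M)" "S2 i \<in> sets (M \<Otimes>\<^sub>M M)" for i
        using less.prems(1) B(1) by (auto simp: S1_def S2_def)
      have fin12: "finite (S1 i `` {x})" "finite (S2 i `` {x})" for i x
        by (rule finite_subset[OF _ less.prems(2)[of x]]; auto simp: S1_def S2_def)+
      have card: "card (S `` {x}) = card (S1 i `` {x}) + card (S2 i `` {x})" for i x
      proof -
        have "S `` {x} = S1 i `` {x} \<union> S2 i `` {x}" "S1 i `` {x} \<inter> S2 i `` {x} = {}"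
          using SJ by (auto simp: S1_def S2_def)
        then show ?thesis using card_Un_disjoint[OF fin12] by simp
      qed
      have "{x \<in> space M. m \<le> card (S `` {x})} =
        (\<Union>i. \<Union>a\<in>{0<..<m}. {x \<in> space M. a \<le> card (S1 i `` {x})} \<inter> {x \<in> space M. m - a \<le> card (S2 i `` {x})})"
        (is "?L = ?R")
      proof
        show "?R \<subseteq> ?L"
        proof clarify
          fix x i a assume "a \<in> {0<..<m}" "a \<le> card (S1 i `` {x})" "m - a \<le> card (S2 i `` {x})"
          then show "m \<le> card (S `` {x})" using card[of x i] by simp
        qed
        show "?L \<subseteq> ?R"
        proof clarify
          fix x assume x: "x \<in> space M" "m \<le> card (S `` {x})"
          then have "1 < card (S `` {x})" using False less.prems(3) by simp
          then obtain y z where "y \<in> S `` {x}" "z \<in> S `` {x}" "y \<noteq> z"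
            by (metis card_le_Suc0_iff_eq less.prems(2) linorder_not_less One_nat_def)
          then have yz: "(x, y) \<in> S" "(x, z) \<in> S" "y \<noteq> z" "y \<in> space M" "z \<in> space M" using SJ by auto
          then obtain i where "y \<in> B i \<longleftrightarrow> z \<notin> B i" using B(2) by blast
          then have "S1 i `` {x} \<noteq> {}" "S2 i `` {x} \<noteq> {}" using yz x by (auto simp: S1_def S2_def)
          then have "0 < card (S1 i `` {x})" "0 < card (S2 i `` {x})" using fin12 card_gt_0_iff by metis+
          \<comment> \<open>The size of the first part is capped at m - 1, because it may be m or
            more while the index a must stay below m.\<close>
          then have "min (card (S1 i `` {x})) (m - 1) \<in> {0<..<m}" "m - min (card (S1 i `` {x})) (m - 1) \<le> card (S2 i `` {x})"
            using card[of x i] x(2) False less.prems(3) by auto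
          then show "x \<in> ?R"
            using x(1) by (intro UN_I[of i UNIV] UN_I[of "min (card (S1 i `` {x})) (m - 1)"]) auto
        qed
      qed
      moreover have "analytic_in T ({x \<in> space M. a \<le> card (S1 i `` {x})} \<inter> {x \<in> space M. m - a \<le> card (S2 i `` {x})})"
        if "a \<in> {0<..<m}" for i a
        using that by (intro analytic_in_Int[OF H] less.IH S12 fin12) auto
      then have "analytic_in T ?R" by (intro analytic_in_UN) auto
      ultimately show ?thesis by simp
    qed
  qed
qed

text \<open>Induction on D. Where a separating set splits a section, the part inside it is strictly
  smaller and its projection is handled by induction; over the rest of the base the sections have at
  most one point and the single-valued case applies.\<close>

lemma sets_fst_image_card_le:
  assumes M: "standard_borel M" and S: "S \<in> sets (M \<Otimes>\<^sub>M M)"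
    and fin: "\<And>x. finite (S `` {x})" and card: "\<And>x. card (S `` {x}) \<le> D"
  shows "fst ` S \<in> sets M"
  using S fin card
proof (induction D arbitrary: S)
  case 0
  then have "S `` {x} = {}" for x by (metis card_0_eq le_zero_eq)
  then have "S = {}" by auto
  then show ?case by simp
next
  case (Suc D)
  obtain T where T: "polish_topology T" "topspace T = space M" "sets M = borel_sets T"
    by (rule standard_borelE[OF M])
  note H = polish_imp_Hausdorff[OF T(1)]
  obtain B :: "nat \<Rightarrow> 'a set" where B: "\<And>i. B i \<in> sets M"
    "\<And>x y. x \<in> space M \<Longrightarrow> y \<in> space M \<Longrightarrow> x \<noteq> y \<Longrightarrow> \<exists>i. x \<in> B i \<longleftrightarrow> y \<notin> B i"
    by (rule standard_borel_separating[OF M]) blast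
  have SJ: "S \<subseteq> space M \<times> space M" using sets.sets_into_space[OF Suc.prems(1)] by (simp add: space_pair_measure)
  define S1 where "S1 i = S \<inter> space M \<times> B i" for i
  define S2 where "S2 i = S \<inter> space M \<times> (space M - B i)" for i
  have S12: "S1 i \<in> sets (M \<Otimes>\<^sub>M M)" "S2 i \<in> sets (M \<Otimes>\<^sub>M M)" for i
    using Suc.prems(1) B(1) by (auto simp: S1_def S2_def)
  have fin12: "finite (S1 i `` {x})" "finite (S2 i `` {x})" for i x
    by (rule finite_subset[OF _ Suc.prems(2)[of x]]; auto simp: S1_def S2_def)+
  have card: "card (S `` {x}) = card (S1 i `` {x}) + card (S2 i `` {x})" for i x
  proof -
    have "S `` {x} = S1 i `` {x} \<union> S2 i `` {x}" "S1 i `` {x} \<inter> S2 i `` {x} = {}"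
      using SJ by (auto simp: S1_def S2_def)
    then show ?thesis using card_Un_disjoint[OF fin12] by simp
  qed
  \<comment> \<open>Points whose section meets both \<open>B i\<close> and its complement can be covered by a Borel set on
    which the part of the section inside \<open>B i\<close> has at most \<open>D\<close> points.\<close>
  have ex: "\<exists>C. C \<in> sets M \<and> fst ` S1 i \<inter> fst ` S2 i \<subseteq> C \<and> C \<inter> {x \<in> space M. Suc D \<le> card (S1 i `` {x})} = {}" for i
  proof -
    have "fst ` S1 i \<inter> fst ` S2 i \<inter> {x \<in> space M. Suc D \<le> card (S1 i `` {x})} = {}"
    proof (rule ccontr)
      assume "\<not> ?thesis"
      then obtain x where "x \<in> fst ` S2 i" and c: "Suc D \<le> card (S1 i `` {x})" by blast
      then have "S2 i `` {x} \<noteq> {}" by force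
      then have "card (S2 i `` {x}) > 0" using fin12 card_gt_0_iff by metis
      then show False using c card[of x i] Suc.prems(3)[of x] by simp
    qed
    then obtain C where "C \<in> borel_sets T" "fst ` S1 i \<inter> fst ` S2 i \<subseteq> C" "C \<inter> {x \<in> space M. Suc D \<le> card (S1 i `` {x})} = {}"
      by (rule analytic_in_separation[OF H
        analytic_in_Int[OF H analytic_in_projection[OF T S12(1)] analytic_in_projection[OF T S12(2)]]
        analytic_in_card_ge[OF T S12(1) fin12(1) zero_less_Suc]])
    then show ?thesis unfolding T(3) by (intro exI conjI)
  qed
  from choice[OF allI[OF ex]] obtain C where
    "\<forall>i. C i \<in> sets M \<and> fst ` S1 i \<inter> fst ` S2 i \<subseteq> C i \<and>
      C i \<inter> {x \<in> space M. Suc D \<le> card (S1 i `` {x})} = {}" ..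
  then have C: "\<And>i. C i \<in> sets M" "\<And>i. fst ` S1 i \<inter> fst ` S2 i \<subseteq> C i"
    "\<And>i. C i \<inter> {x \<in> space M. Suc D \<le> card (S1 i `` {x})} = {}" by simp_all
  define R where "R i = S1 i \<inter> C i \<times> space M" for i
  have "fst ` R i \<in> sets M" for i
  proof (rule Suc.IH)
    show "R i \<in> sets (M \<Otimes>\<^sub>M M)" using S12 C(1) by (auto simp: R_def)
    fix x
    have sub: "R i `` {x} \<subseteq> S1 i `` {x}" by (auto simp: R_def)
    then show "finite (R i `` {x})" using fin12 finite_subset by blast
    show "card (R i `` {x}) \<le> D"
    proof (cases "x \<in> C i")
      case True
      then have "card (S1 i `` {x}) \<le> D" using C(3)[of i] sets.sets_into_space[OF C(1)[of i]] by (auto simp: not_less_eq_eq)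
      then show ?thesis using card_mono[OF fin12(1) sub] by simp
    next
      case False
      then have "R i `` {x} = {}" by (auto simp: R_def)
      then show ?thesis by simp
    qed
  qed
  then have W: "(\<Union>i. fst ` R i) \<in> sets M" (is "?W \<in> _") by auto
  \<comment> \<open>Two points of a section are separated by some B i; then x lies in C i and hence
    in the removed set, so the remaining sections are single points.\<close>
  let ?S = "S - ?W \<times> space M"
  have "fst ` ?S \<in> sets M"
  proof (rule sets_fst_image_single_valued[OF M])
    show "?S \<in> sets (M \<Otimes>\<^sub>M M)" using Suc.prems(1) W by auto
    fix x y y' assume xy: "(x, y) \<in> ?S" "(x, y') \<in> ?S"
    show "y = y'"
    proof (rule ccontr)
      assume "y \<noteq> y'"
      have xyS: "(x, y) \<in> S" "(x, y') \<in> S" using xy by auto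
      then have J: "x \<in> space M" "y \<in> space M" "y' \<in> space M" using SJ by auto
      then obtain i where i: "y \<in> B i \<longleftrightarrow> y' \<notin> B i" using B(2)[OF J(2,3) \<open>y \<noteq> y'\<close>] by blast
      have "(\<exists>z. (x, z) \<in> S1 i) \<and> (\<exists>z. (x, z) \<in> S2 i)"
        using xyS J i by (cases "y \<in> B i") (auto simp: S1_def S2_def)
      then obtain z where z: "(x, z) \<in> S1 i" and "x \<in> fst ` S2 i" by force
      then have "x \<in> C i" using C(2)[of i] by force
      moreover have "z \<in> space M" using z SJ by (auto simp: S1_def)
      ultimately have "(x, z) \<in> R i" using z by (auto simp: R_def)
      then have "x \<in> ?W" by (metis UN_I UNIV_I fst_conv imageI)
      moreover have "y \<in> space M" using xy(1) SJ by auto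
      ultimately show False using xy(1) by simp
    qed
  qed
  moreover have "fst ` S = ?W \<union> fst ` ?S"
  proof
    show "fst ` S \<subseteq> ?W \<union> fst ` ?S" by force
    show "?W \<union> fst ` ?S \<subseteq> fst ` S" by (auto simp: R_def S1_def image_iff)
  qed
  ultimately show ?case using W by auto
qed

section \<open>Balls\<close>

lemma edges_inD:
  assumes "edges_in J E" "{x, y} \<in> E"
  shows "x \<in> J" "y \<in> J" "x \<noteq> y"
proof -
  obtain a b where "a \<noteq> b" "a \<in> J" "b \<in> J" "{x, y} = {a, b}"
    using assms unfolding edges_in_def by blast
  then show "x \<in> J" "y \<in> J" "x \<noteq> y" by (auto simp: doubleton_eq_iff)
qed

lemma edges_in_subset: "edges_in J E \<Longrightarrow> F \<subseteq> E \<Longrightarrow> edges_in J F"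
  unfolding edges_in_def by blast

lemma bounded_degree_subset:
  assumes "bounded_degree J E D" "F \<subseteq> E" shows "bounded_degree J F D"
  unfolding bounded_degree_def
proof (intro ballI conjI)
  fix x assume "x \<in> J"
  then have "finite {y. {x, y} \<in> E}" "card {y. {x, y} \<in> E} \<le> D" using assms unfolding bounded_degree_def by auto
  moreover have "{y. {x, y} \<in> F} \<subseteq> {y. {x, y} \<in> E}" using assms by auto
  ultimately show "finite {y. {x, y} \<in> F}" "card {y. {x, y} \<in> F} \<le> D"
    by (meson finite_subset, meson card_mono le_trans)
qed

lemma bounded_degree_mono: "bounded_degree J E D \<Longrightarrow> D \<le> D' \<Longrightarrow> bounded_degree J E D'"
  unfolding bounded_degree_def by force

lemma ball_0 [simp]: "ball E 0 x = {x}"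
  unfolding ball_def by auto

lemma ball_Suc: "ball E (Suc r) x = (\<Union>y\<in>ball E r x. insert y {z. {y, z} \<in> E})"
proof
  show "ball E (Suc r) x \<subseteq> (\<Union>y\<in>ball E r x. insert y {z. {y, z} \<in> E})"
  proof
    fix z assume "z \<in> ball E (Suc r) x"
    then obtain n where n: "n \<le> Suc r" "(adjp E ^^ n) x z" unfolding ball_def by auto
    show "z \<in> (\<Union>y\<in>ball E r x. insert y {z. {y, z} \<in> E})"
    proof (cases "n \<le> r")
      case True
      then have "z \<in> ball E r x" using n unfolding ball_def by auto
      then show ?thesis by auto
    next
      case False
      then have "n = Suc r" using n by simp
      then obtain y where "(adjp E ^^ r) x y" "adjp E y z" using n(2) by auto
      then show ?thesis unfolding ball_def adjp_def by auto
    qed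
  qed
  have "z \<in> ball E (Suc r) x" if yz: "y \<in> ball E r x" "{y, z} \<in> E" for y z
  proof -
    obtain n where "n \<le> r" "(adjp E ^^ n) x y" using yz unfolding ball_def by auto
    then have "(adjp E ^^ Suc n) x z" "Suc n \<le> Suc r" using yz by (auto simp: adjp_def)
    then show ?thesis unfolding ball_def by blast
  qed
  moreover have "ball E r x \<subseteq> ball E (Suc r) x" unfolding ball_def by (auto intro: le_SucI)
  ultimately show "(\<Union>y\<in>ball E r x. insert y {z. {y, z} \<in> E}) \<subseteq> ball E (Suc r) x" by auto
qed

lemma ball_mono: "q \<le> r \<Longrightarrow> ball E q x \<subseteq> ball E r x"
  unfolding ball_def by (auto intro: order_trans)

lemma centre_in_ball [simp]: "x \<in> ball E r x"
  using ball_mono[of 0 r E x] by auto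

lemma ball_subset:
  assumes "edges_in J E" "x \<in> J" shows "ball E r x \<subseteq> J"
  by (induction r) (use assms edges_inD(2)[OF assms(1)] in \<open>auto simp: ball_Suc\<close>)

text \<open>Each step multiplies the size by at most D + 1: a vertex and its neighbours.\<close>

lemma finite_card_ball:
  assumes "edges_in J E" "bounded_degree J E D" "x \<in> J"
  shows "finite (ball E r x)" "card (ball E r x) \<le> Suc D ^ r"
proof -
  have "finite (ball E r x) \<and> card (ball E r x) \<le> Suc D ^ r"
  proof (induction r)
    case (Suc r)
    have nb: "finite {z. {y, z} \<in> E}" "card (insert y {z. {y, z} \<in> E}) \<le> Suc D" if "y \<in> ball E r x" for y
    proof -
      have "y \<in> J" using that ball_subset[OF assms(1,3)] by blast
      then show "finite {z. {y, z} \<in> E}" "card (insert y {z. {y, z} \<in> E}) \<le> Suc D"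
        using assms(2) unfolding bounded_degree_def
        by (auto simp: card_insert_if le_SucI)
    qed
    have "card (ball E (Suc r) x) \<le> (\<Sum>y\<in>ball E r x. card (insert y {z. {y, z} \<in> E}))"
      unfolding ball_Suc by (rule card_UN_le) (use Suc in auto)
    also have "\<dots> \<le> card (ball E r x) * Suc D"
      using sum_bounded_above[of "ball E r x" "\<lambda>y. card (insert y {z. {y, z} \<in> E})" "Suc D"] nb(2) by simp
    also have "\<dots> \<le> Suc D ^ r * Suc D" using Suc by (intro mult_le_mono1) simp
    also have "\<dots> = Suc D ^ Suc r" by (simp only: power_Suc2)
    finally show ?case using Suc nb(1) by (simp add: ball_Suc)
  qed simp
  then show "finite (ball E r x)" "card (ball E r x) \<le> Suc D ^ r" by auto
qed

section \<open>Measurability of ball statistics\<close>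

lemma sets_Collect_eq_standard_borel:
  assumes M: "standard_borel M" and [measurable]: "u \<in> measurable N M" "v \<in> measurable N M"
  shows "{x \<in> space N. u x = v x} \<in> sets N"
proof -
  obtain B :: "nat \<Rightarrow> 'a set" where B: "\<And>i. B i \<in> sets M"
    "\<And>x y. x \<in> space M \<Longrightarrow> y \<in> space M \<Longrightarrow> x \<noteq> y \<Longrightarrow> \<exists>i. x \<in> B i \<longleftrightarrow> y \<notin> B i"
    by (rule standard_borel_separating[OF M]) blast
  note B(1)[measurable]
  have "u x \<in> space M" "v x \<in> space M" if "x \<in> space N" for x
    using measurable_space[OF assms(2) that] measurable_space[OF assms(3) that] by auto
  then have "{x \<in> space N. u x = v x} = {x \<in> space N. \<forall>i. u x \<in> B i \<longleftrightarrow> v x \<in> B i}"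
    using B(2) by (metis (mono_tags, opaque_lifting))
  also have "\<dots> \<in> sets N" by measurable
  finally show ?thesis .
qed

lemma borel_coloring_measurable:
  assumes "borel_coloring M k c"
  shows "c \<in> measurable M (count_space UNIV)"
proof (subst measurable_count_space_eq2_countable, intro conjI ballI)
  fix i
  have "c -` {i} \<inter> space M = {x \<in> space M. c x = i}" by auto
  moreover have "{x \<in> space M. c x = i} \<in> sets M"
  proof (cases "i < k")
    case False
    then have e: "{x \<in> space M. c x = i} = {}" using assms unfolding borel_coloring_def by auto
    show ?thesis unfolding e by simp
  qed (use assms in \<open>auto simp: borel_coloring_def\<close>)
  ultimately show "c -` {i} \<inter> space M \<in> sets M" by simp
qed auto

text \<open>Only the Borel structure is recorded, without the balance condition, so the results
  apply to a Borel subgraph before it is known to be a graphing.\<close>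

locale borel_graph =
  fixes M :: "'a measure" and E :: "'a set set" and D :: nat
  assumes standard: "standard_borel M" and edges: "edges_in (space M) E"
    and borel: "edge_borel M E" and degree: "bounded_degree (space M) E D"
begin

definition arcs :: "('a \<times> 'a) set" where "arcs = {(x, y). {x, y} \<in> E}"

lemma arcs_sets [measurable]: "arcs \<in> sets (M \<Otimes>\<^sub>M M)"
proof -
  have "arcs = {(x, y). x \<in> space M \<and> y \<in> space M \<and> {x, y} \<in> E}"
    unfolding arcs_def using edges_inD[OF edges] by auto
  then show ?thesis using borel unfolding edge_borel_def by simp
qed

lemma finite_nbrs: "finite {y. {x, y} \<in> E}" and card_nbrs: "card {y. {x, y} \<in> E} \<le> D"
proof -
  have "finite {y. {x, y} \<in> E} \<and> card {y. {x, y} \<in> E} \<le> D"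
  proof (cases "x \<in> space M")
    case False
    then have "{y. {x, y} \<in> E} = {}" using edges_inD[OF edges] by auto
    then show ?thesis by simp
  qed (use degree in \<open>auto simp: bounded_degree_def\<close>)
  then show "finite {y. {x, y} \<in> E}" "card {y. {x, y} \<in> E} \<le> D" by auto
qed

lemma sets_fst_arcs:
  assumes "A \<in> sets (M \<Otimes>\<^sub>M M)" "A \<subseteq> arcs"
  shows "fst ` A \<in> sets M"
proof (rule sets_fst_image_card_le[OF standard assms(1)])
  fix x
  have sub: "A `` {x} \<subseteq> {y. {x, y} \<in> E}" using assms(2) by (auto simp: arcs_def)
  show "finite (A `` {x})" using sub finite_nbrs finite_subset by blast
  show "card (A `` {x}) \<le> D" using card_mono[OF finite_nbrs sub] card_nbrs[of x] by simp
qed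

text \<open>A Borel uniformization of adjacency. The atoms of the first n separating sets cut the
  finite set of neighbours into singletons once n is large, so each neighbour is the only one in
  some atom. The map to the only neighbour in a given atom is Borel on a Borel domain and is
  extended by the identity. Function 0 is the identity, so that x itself is listed.\<close>

lemma nbr_enumeration:
  obtains f :: "nat \<Rightarrow> 'a \<Rightarrow> 'a" where "\<And>i. f i \<in> measurable M M"
    "\<And>x. x \<in> space M \<Longrightarrow> range (\<lambda>i. f i x) = insert x {y. {x, y} \<in> E}"
proof -
  obtain B :: "nat \<Rightarrow> 'a set" where B [measurable]: "\<And>i. B i \<in> sets M"
    and Bsep: "\<And>x y. x \<in> space M \<Longrightarrow> y \<in> space M \<Longrightarrow> x \<noteq> y \<Longrightarrow> \<exists>i. x \<in> B i \<longleftrightarrow> y \<notin> B i"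
    by (rule standard_borel_separating[OF standard]) blast
  define atom where "atom l = {y \<in> space M. \<forall>i<length l. y \<in> B i \<longleftrightarrow> l ! i}" for l
  have atom [measurable]: "atom l \<in> sets M" for l unfolding atom_def by measurable
  define S where "S l = arcs \<inter> space M \<times> atom l" for l
  have S: "S l \<in> sets (M \<Otimes>\<^sub>M M)" "S l \<subseteq> arcs" for l unfolding S_def by auto
  have SJ: "(x, y) \<in> S l \<Longrightarrow> x \<in> space M \<and> y \<in> space M" for x y l
    by (auto simp: S_def atom_def)
  have proj: "fst ` (S l \<inter> space M \<times> C) \<in> sets M" if "C \<in> sets M" for l C
    by (rule sets_fst_arcs) (use S that in auto)
  define A where "A l = {x \<in> space M. \<exists>!y. (x, y) \<in> S l}" for l
  have A: "A l \<in> sets M" for l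
  proof -
    \<comment> \<open>A section is a singleton if it is nonempty and no B i splits it; each clause
      is a projection of a Borel set of arcs.\<close>
    have "A l = fst ` (S l \<inter> space M \<times> space M) -
        (\<Union>i. fst ` (S l \<inter> space M \<times> B i) \<inter> fst ` (S l \<inter> space M \<times> (space M - B i)))" (is "_ = ?R")
    proof
      show "A l \<subseteq> ?R"
      proof
        fix x assume "x \<in> A l"
        then obtain y where y: "(x, y) \<in> S l" "\<And>z. (x, z) \<in> S l \<Longrightarrow> z = y" unfolding A_def by blast
        have "(x, y) \<in> S l \<inter> space M \<times> space M" using y(1) SJ[OF y(1)] by simp
        then have "x \<in> fst ` (S l \<inter> space M \<times> space M)" by (metis fst_conv imageI)
        moreover have "x \<notin> fst ` (S l \<inter> space M \<times> B i) \<inter> fst ` (S l \<inter> space M \<times> (space M - B i))" for i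
        proof
          assume "x \<in> fst ` (S l \<inter> space M \<times> B i) \<inter> fst ` (S l \<inter> space M \<times> (space M - B i))"
          then obtain z z' where "(x, z) \<in> S l" "z \<in> B i" "(x, z') \<in> S l" "z' \<notin> B i" by auto
          then show False using y(2)[of z] y(2)[of z'] by simp
        qed
        ultimately show "x \<in> ?R" by blast
      qed
      show "?R \<subseteq> A l"
      proof
        fix x assume x: "x \<in> ?R"
        then obtain y where y: "(x, y) \<in> S l" by auto
        have "z = y" if z: "(x, z) \<in> S l" for z
        proof (rule ccontr)
          assume "z \<noteq> y"
          then obtain i where i: "z \<in> B i \<longleftrightarrow> y \<notin> B i" using Bsep SJ[OF y] SJ[OF z] by blast
          have "(\<exists>z. (x, z) \<in> S l \<inter> space M \<times> B i) \<and> (\<exists>z. (x, z) \<in> S l \<inter> space M \<times> (space M - B i))"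
            using y z i SJ[OF y] SJ[OF z] by (cases "y \<in> B i") auto
          then have "x \<in> fst ` (S l \<inter> space M \<times> B i) \<inter> fst ` (S l \<inter> space M \<times> (space M - B i))"
            by (metis IntI fst_conv imageI)
          then show False using x by blast
        qed
        then show "x \<in> A l" using y SJ[OF y] unfolding A_def by blast
      qed
    qed
    then show ?thesis using proj by auto
  qed
  define g where "g l x = (if x \<in> A l then THE y. (x, y) \<in> S l else x)" for l x
  have gS: "(x, g l x) \<in> S l" "\<And>z. (x, z) \<in> S l \<Longrightarrow> z = g l x" if "x \<in> A l" for l x
  proof -
    have ex1: "\<exists>!y. (x, y) \<in> S l" using that by (simp add: A_def)
    then have *: "(x, THE y. (x, y) \<in> S l) \<in> S l" by (rule theI')
    show "(x, g l x) \<in> S l" using * that by (simp add: g_def)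
    show "z = g l x" if "(x, z) \<in> S l" for z using * that ex1 \<open>x \<in> A l\<close> unfolding g_def by auto
  qed
  have g: "g l \<in> measurable M M" for l
  proof (rule measurableI)
    fix x assume "x \<in> space M" then show "g l x \<in> space M" using gS(1)[of x l] SJ by (cases "x \<in> A l") (auto simp: g_def)
  next
    fix C assume C: "C \<in> sets M"
    have "g l -` C \<inter> space M = (A l \<inter> fst ` (S l \<inter> space M \<times> C)) \<union> ((space M - A l) \<inter> C)" (is "?L = ?R")
    proof (intro set_eqI iffI)
      fix x assume x: "x \<in> ?L"
      show "x \<in> ?R"
      proof (cases "x \<in> A l")
        case True
        then have "(x, g l x) \<in> S l \<inter> space M \<times> C" using gS(1) x by auto
        then show ?thesis using True by force
      next
        case False then show ?thesis using x by (auto simp: g_def)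
      qed
    next
      fix x assume x: "x \<in> ?R"
      show "x \<in> ?L"
      proof (cases "x \<in> A l")
        case True
        then obtain y where "(x, y) \<in> S l" "y \<in> C" using x by auto
        then show ?thesis using gS(2)[OF True] SJ by auto
      next
        case False then show ?thesis using x by (auto simp: g_def)
      qed
    qed
    then show "g l -` C \<inter> space M \<in> sets M" using proj[OF C] A C by auto
  qed
  define f where "f i = (case i of 0 \<Rightarrow> (\<lambda>x. x) | Suc j \<Rightarrow> g (from_nat j))" for i
  have "f i \<in> measurable M M" for i unfolding f_def using g by (cases i) auto
  moreover have "range (\<lambda>i. f i x) = insert x {y. {x, y} \<in> E}" if x: "x \<in> space M" for x
  proof
    have "g l x \<in> insert x {y. {x, y} \<in> E}" for l
      using gS(1)[of x l] by (cases "x \<in> A l") (auto simp: g_def S_def arcs_def)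
    then show "range (\<lambda>i. f i x) \<subseteq> insert x {y. {x, y} \<in> E}"
      unfolding f_def by (fastforce split: nat.split)
    have "y \<in> range (\<lambda>i. f i x)" if y: "{x, y} \<in> E" for y
    proof -
      have yJ: "y \<in> space M" using edges_inD[OF edges y] by simp
      have "\<forall>z. \<exists>i. {x, z} \<in> E \<and> z \<noteq> y \<longrightarrow> (z \<in> B i \<longleftrightarrow> y \<notin> B i)"
        using Bsep yJ edges_inD(2)[OF edges] by metis
      then obtain i where i: "\<And>z. {x, z} \<in> E \<Longrightarrow> z \<noteq> y \<Longrightarrow> z \<in> B (i z) \<longleftrightarrow> y \<notin> B (i z)" by metis
      \<comment> \<open>Long enough to include an index separating y from every other neighbour of
        x.\<close>
      define n where "n = Suc (Max (i ` {z. {x, z} \<in> E}))"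
      have n: "i z < n" if "{x, z} \<in> E" for z
        unfolding n_def using finite_nbrs that by (auto simp: less_Suc_eq_le)
      define l where "l = map (\<lambda>i. y \<in> B i) [0..<n]"
      have "(x, y) \<in> S l" using x yJ y by (auto simp: S_def arcs_def atom_def l_def)
      moreover have "z = y" if "(x, z) \<in> S l" for z
      proof (rule ccontr)
        assume "z \<noteq> y"
        moreover have E: "{x, z} \<in> E" using that by (auto simp: S_def arcs_def)
        moreover have "z \<in> B (i z) \<longleftrightarrow> y \<in> B (i z)" using that n[OF E] by (auto simp: S_def atom_def l_def)
        ultimately show False using i by blast
      qed
      ultimately have "x \<in> A l" using x unfolding A_def by blast
      then have "g l x = y" using gS(2) \<open>(x, y) \<in> S l\<close> by blast
      then have "f (Suc (to_nat l)) x = y" by (simp add: f_def)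
      then show ?thesis by (metis rangeI)
    qed
    moreover have "f 0 x = x" by (simp add: f_def)
    then have "x \<in> range (\<lambda>i. f i x)" by (metis rangeI)
    ultimately show "insert x {y. {x, y} \<in> E} \<subseteq> range (\<lambda>i. f i x)" by auto
  qed
  ultimately show thesis using that by blast
qed

text \<open>Compositions of neighbour maps, indexed by pairs. Repetitions are allowed, so
  distinctness has to be demanded separately wherever the enumeration is used for counting or for
  bijections.\<close>

lemma ball_enumeration:
  "\<exists>g :: nat \<Rightarrow> 'a \<Rightarrow> 'a. (\<forall>i. g i \<in> measurable M M) \<and> (\<forall>x\<in>space M. range (\<lambda>i. g i x) = ball E r x)"
proof (induction r)
  case 0
  show ?case by (intro exI[of _ "\<lambda>_ x. x"]) auto
next
  case (Suc r)
  then obtain g :: "nat \<Rightarrow> 'a \<Rightarrow> 'a" where g: "\<And>i. g i \<in> measurable M M" "\<And>x. x \<in> space M \<Longrightarrow> range (\<lambda>i. g i x) = ball E r x"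
    by blast
  obtain f :: "nat \<Rightarrow> 'a \<Rightarrow> 'a" where f: "\<And>i. f i \<in> measurable M M"
    "\<And>x. x \<in> space M \<Longrightarrow> range (\<lambda>i. f i x) = insert x {y. {x, y} \<in> E}"
    by (rule nbr_enumeration) blast
  define h where "h n = f (fst (prod_decode n)) \<circ> g (snd (prod_decode n))" for n
  have "h n \<in> measurable M M" for n unfolding h_def using f(1) g(1) measurable_comp by blast
  moreover have "range (\<lambda>n. h n x) = ball E (Suc r) x" if x: "x \<in> space M" for x
  proof -
    have "range (\<lambda>n. h n x) = (\<Union>j. range (\<lambda>i. f i (g j x)))"
    proof (intro set_eqI iffI)
      fix y assume "y \<in> (\<Union>j. range (\<lambda>i. f i (g j x)))"
      then obtain i j where "y = f i (g j x)" by auto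
      then have "y = h (prod_encode (i, j)) x" by (simp add: h_def)
      then show "y \<in> range (\<lambda>n. h n x)" by blast
    qed (auto simp: h_def)
    also have "\<dots> = (\<Union>j. insert (g j x) {z. {g j x, z} \<in> E})"
      using f(2)[OF measurable_space[OF g(1) x]] by simp
    also have "\<dots> = (\<Union>y\<in>range (\<lambda>i. g i x). insert y {z. {y, z} \<in> E})" by auto
    finally show ?thesis using g(2)[OF x] by (simp add: ball_Suc)
  qed
  ultimately show ?case by blast
qed

lemma sets_Collect_adjacent:
  assumes [measurable]: "u \<in> measurable N M" "v \<in> measurable N M"
  shows "{x \<in> space N. {u x, v x} \<in> E} \<in> sets N"
proof -
  have "{x \<in> space N. {u x, v x} \<in> E} = {x \<in> space N. (u x, v x) \<in> arcs}" by (simp add: arcs_def)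
  also have "\<dots> \<in> sets N" by measurable
  finally show ?thesis .
qed

end

text \<open>An isomorphism read backwards starts from the fixed set \<open>{..<N}\<close>, so it is
  described by a list of N positions in the enumeration of the ball.\<close>

lemma ball_iso_col_alt:
  "ball_iso_col E r c x (N, rt, A) col \<longleftrightarrow>
     (\<exists>\<phi>. bij_betw \<phi> {..<N} (ball E r x) \<and> rt < N \<and> \<phi> rt = x \<and>
       (\<forall>a<N. \<forall>b<N. {\<phi> a, \<phi> b} \<in> E \<longleftrightarrow> {a, b} \<in> A) \<and> (\<forall>a<N. c (\<phi> a) = col a))" (is "?L \<longleftrightarrow> ?R")
proof
  assume ?L
  then obtain h where h: "bij_betw h (ball E r x) {..<N}" "h x = rt"
    "\<And>y z. y \<in> ball E r x \<Longrightarrow> z \<in> ball E r x \<Longrightarrow> {y, z} \<in> E \<longleftrightarrow> {h y, h z} \<in> A"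
    "\<And>y. y \<in> ball E r x \<Longrightarrow> c y = col (h y)" unfolding ball_iso_col_def by auto
  define \<phi> where "\<phi> = inv_into (ball E r x) h"
  have \<phi>: "bij_betw \<phi> {..<N} (ball E r x)" unfolding \<phi>_def using h(1) by (rule bij_betw_inv_into)
  have h\<phi>: "h (\<phi> a) = a" "\<phi> a \<in> ball E r x" if "a < N" for a
    unfolding \<phi>_def using h(1) that by (auto simp: bij_betw_inv_into_right bij_betw_def inv_into_into)
  have "rt < N" using h(1,2) centre_in_ball[of x E r] unfolding bij_betw_def by auto
  moreover have "\<phi> rt = x" unfolding \<phi>_def h(2)[symmetric] using h(1) by (simp add: bij_betw_inv_into_left)
  ultimately show ?R using \<phi> h(3,4) h\<phi> by (intro exI[of _ \<phi>]) auto
next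
  assume ?R
  then obtain \<phi> where \<phi>: "bij_betw \<phi> {..<N} (ball E r x)" "rt < N" "\<phi> rt = x"
    "\<And>a b. a < N \<Longrightarrow> b < N \<Longrightarrow> {\<phi> a, \<phi> b} \<in> E \<longleftrightarrow> {a, b} \<in> A" "\<And>a. a < N \<Longrightarrow> c (\<phi> a) = col a" by auto
  define h where "h = inv_into {..<N} \<phi>"
  have h: "bij_betw h (ball E r x) {..<N}" unfolding h_def using \<phi>(1) by (rule bij_betw_inv_into)
  have \<phi>h: "\<phi> (h y) = y" "h y < N" if "y \<in> ball E r x" for y
    using that \<phi>(1) h by (auto simp: h_def bij_betw_inv_into_right bij_betw_def)
  have "h x = rt" unfolding h_def \<phi>(3)[symmetric] using \<phi>(1,2) by (simp add: bij_betw_inv_into_left)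
  then show ?L unfolding ball_iso_col_def using h \<phi>(4,5) \<phi>h by (auto intro!: exI[of _ h]) (metis+)
qed

lemma ball_iso_eq_col: "ball_iso E r x \<alpha> = ball_iso_col E r (\<lambda>_. 0) x \<alpha> (\<lambda>_. 0)"
  unfolding ball_iso_def ball_iso_col_def by auto

context borel_graph begin

text \<open>The isomorphisms range over countably many lists of enumeration indices, and for a fixed
  list every requirement is a measurable condition on x; surjectivity is tested on the
  enumeration.\<close>

lemma sets_ball_iso_col:
  assumes c [measurable]: "c \<in> measurable M (count_space UNIV)"
  shows "{x \<in> space M. ball_iso_col E r c x \<alpha> col} \<in> sets M"
proof -
  obtain N rt A where \<alpha>: "\<alpha> = (N, rt, A)" by (cases \<alpha>)
  obtain g :: "nat \<Rightarrow> 'a \<Rightarrow> 'a" where g [measurable]: "\<And>i. g i \<in> measurable M M"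
    and gr: "\<And>x. x \<in> space M \<Longrightarrow> range (\<lambda>i. g i x) = ball E r x"
    using ball_enumeration[of r] by blast
  have id [measurable]: "(\<lambda>x. x) \<in> measurable M M" by simp
  have [measurable]: "Measurable.pred M (\<lambda>x. g i x = g j x)" "Measurable.pred M (\<lambda>x. g i x = x)"
    "Measurable.pred M (\<lambda>x. {g i x, g j x} \<in> E)" for i j
    using sets_Collect_eq_standard_borel[OF standard g g] sets_Collect_eq_standard_borel[OF standard g id]
      sets_Collect_adjacent[OF g g] by (auto simp: pred_def)
  define P where "P is x \<longleftrightarrow> rt < N \<and> (\<forall>a<N. \<forall>b<N. a \<noteq> b \<longrightarrow> g (is ! a) x \<noteq> g (is ! b) x) \<and>
     (\<forall>i. \<exists>a<N. g i x = g (is ! a) x) \<and> g (is ! rt) x = x \<and>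
     (\<forall>a<N. \<forall>b<N. {g (is ! a) x, g (is ! b) x} \<in> E \<longleftrightarrow> {a, b} \<in> A) \<and> (\<forall>a<N. c (g (is ! a) x) = col a)" for "is" x
  have P: "{x \<in> space M. P is x} \<in> sets M" for "is" unfolding P_def by measurable
  have "ball_iso_col E r c x \<alpha> col \<longleftrightarrow> (\<exists>is. P is x)" if x: "x \<in> space M" for x
  proof
    assume "ball_iso_col E r c x \<alpha> col"
    then obtain \<phi> where \<phi>: "bij_betw \<phi> {..<N} (ball E r x)" "rt < N" "\<phi> rt = x"
      "\<And>a b. a < N \<Longrightarrow> b < N \<Longrightarrow> {\<phi> a, \<phi> b} \<in> E \<longleftrightarrow> {a, b} \<in> A" "\<And>a. a < N \<Longrightarrow> c (\<phi> a) = col a"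
      unfolding \<alpha> ball_iso_col_alt by auto
    have "\<forall>a. \<exists>i. a < N \<longrightarrow> g i x = \<phi> a" using \<phi>(1) gr[OF x] unfolding bij_betw_def by (metis imageE imageI lessThan_iff)
    then obtain s where s: "\<And>a. a < N \<Longrightarrow> g (s a) x = \<phi> a" by metis
    have "P (map s [0..<N]) x"
      unfolding P_def
    proof (intro conjI allI impI)
      fix a b assume "a < N" "b < N" "a \<noteq> b"
      then show "g (map s [0..<N] ! a) x \<noteq> g (map s [0..<N] ! b) x"
        using \<phi>(1) s unfolding bij_betw_def by (auto dest: inj_onD)
    next
      fix i
      have "g i x \<in> \<phi> ` {..<N}" using \<phi>(1) gr[OF x] unfolding bij_betw_def by auto
      then show "\<exists>a<N. g i x = g (map s [0..<N] ! a) x" using s by auto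
    qed (use \<phi> s in auto)
    then show "\<exists>is. P is x" ..
  next
    assume "\<exists>is. P is x"
    then obtain "is" where "P is x" ..
    then have p: "rt < N" "\<And>a b. a < N \<Longrightarrow> b < N \<Longrightarrow> a \<noteq> b \<Longrightarrow> g (is ! a) x \<noteq> g (is ! b) x"
     "\<And>i. \<exists>a<N. g i x = g (is ! a) x" "g (is ! rt) x = x"
     "\<And>a b. a < N \<Longrightarrow> b < N \<Longrightarrow> {g (is ! a) x, g (is ! b) x} \<in> E \<longleftrightarrow> {a, b} \<in> A" "\<And>a. a < N \<Longrightarrow> c (g (is ! a) x) = col a"
      unfolding P_def by auto
    have "bij_betw (\<lambda>a. g (is ! a) x) {..<N} (ball E r x)"
      unfolding bij_betw_def
    proof
      show "inj_on (\<lambda>a. g (is ! a) x) {..<N}" using p(2) by (auto intro!: inj_onI)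
      show "(\<lambda>a. g (is ! a) x) ` {..<N} = ball E r x"
        using p(3) unfolding gr[OF x, symmetric] by fastforce
    qed
    then show "ball_iso_col E r c x \<alpha> col" unfolding \<alpha> ball_iso_col_alt using p by (intro exI[of _ "\<lambda>a. g (is ! a) x"]) auto
  qed
  then have "{x \<in> space M. ball_iso_col E r c x \<alpha> col} = (\<Union>is. {x \<in> space M. P is x})" by auto
  also have "\<dots> \<in> sets M" using P by (intro sets.countable_UN') auto
  finally show ?thesis .
qed

lemma sets_ball_iso: "{x \<in> space M. ball_iso E r x \<alpha>} \<in> sets M"
  unfolding ball_iso_eq_col by (rule sets_ball_iso_col) simp

end

section \<open>Subgraphs of graphings\<close>

context borel_graph begin

text \<open>A counting measure in place of \<open>card\<close>, so that additivity in A over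
  countable disjoint unions is inherited.\<close>

definition arc_count :: "('a \<times> 'a) set \<Rightarrow> 'a \<Rightarrow> ennreal" where
  "arc_count A x = emeasure (count_space UNIV) {y. (x, y) \<in> A \<and> {x, y} \<in> E}"

lemma arc_count_eq_card: "arc_count A x = ennreal (real (card {y. (x, y) \<in> A \<and> {x, y} \<in> E}))"
proof -
  have "finite {y. (x, y) \<in> A \<and> {x, y} \<in> E}" by (rule finite_subset[OF _ finite_nbrs[of x]]) auto
  then show ?thesis unfolding arc_count_def by (simp add: emeasure_count_space_finite ennreal_of_nat_eq_real_of_nat)
qed

lemma arc_count_le: "arc_count A x \<le> ennreal (real D)"
proof -
  have "card {y. (x, y) \<in> A \<and> {x, y} \<in> E} \<le> D"
    using card_mono[OF finite_nbrs[of x], of "{y. (x, y) \<in> A \<and> {x, y} \<in> E}"] card_nbrs[of x] by force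
  then show ?thesis unfolding arc_count_eq_card by (simp add: ennreal_leI)
qed

text \<open>At least m arcs of A leave x exactly if some list of m enumeration indices names
  distinct ends of such arcs, and lists are countable.\<close>

lemma arc_count_measurable [measurable]:
  assumes A [measurable]: "A \<in> sets (M \<Otimes>\<^sub>M M)"
  shows "arc_count A \<in> borel_measurable M"
proof -
  obtain f :: "nat \<Rightarrow> 'a \<Rightarrow> 'a" where f [measurable]: "\<And>i. f i \<in> measurable M M"
    and fr: "\<And>x. x \<in> space M \<Longrightarrow> range (\<lambda>i. f i x) = insert x {y. {x, y} \<in> E}"
    by (rule nbr_enumeration) blast
  have [measurable]: "Measurable.pred M (\<lambda>x. f i x = f j x)" for i j
    using sets_Collect_eq_standard_borel[OF standard f f] by (simp add: pred_def)
  define S where "S x = {y. (x, y) \<in> A \<and> {x, y} \<in> E}" for x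
  have fin: "finite (S x)" for x unfolding S_def by (rule finite_subset[OF _ finite_nbrs[of x]]) auto
  define P where "P is x \<longleftrightarrow> (\<forall>a<length is. (x, f (is ! a) x) \<in> A \<inter> arcs) \<and>
    (\<forall>a<length is. \<forall>b<length is. a \<noteq> b \<longrightarrow> f (is ! a) x \<noteq> f (is ! b) x)" for "is" x
  have P [measurable]: "Measurable.pred M (P is)" for "is" unfolding P_def by measurable
  have eq: "m \<le> card (S x) \<longleftrightarrow> (\<exists>is. length is = m \<and> P is x)" if x: "x \<in> space M" for m x
  proof
    assume "m \<le> card (S x)"
    then obtain Y where Y: "Y \<subseteq> S x" "card Y = m" "finite Y" using fin by (meson obtain_subset_with_card_n)
    then obtain ys where ys: "distinct ys" "set ys = Y" "length ys = m"
      by (metis finite_distinct_list distinct_card)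
    have "Y \<subseteq> range (\<lambda>i. f i x)" using Y(1) unfolding fr[OF x] S_def by auto
    then have "\<forall>y. \<exists>i. y \<in> Y \<longrightarrow> f i x = y" by fast
    then obtain s where s: "\<And>y. y \<in> Y \<Longrightarrow> f (s y) x = y" by metis
    have "f (map s ys ! a) x = ys ! a" "ys ! a \<in> S x" if "a < m" for a using that ys s Y by auto
    then have "P (map s ys) x" using ys unfolding P_def S_def arcs_def by (auto simp: nth_eq_iff_index_eq)
    then show "\<exists>is. length is = m \<and> P is x" using ys by (intro exI[of _ "map s ys"]) auto
  next
    assume "\<exists>is. length is = m \<and> P is x"
    then obtain "is" where p: "length is = m" "P is x" by auto
    have "card ((\<lambda>a. f (is ! a) x) ` {..<m}) = m"
      using p unfolding P_def by (subst card_image) (auto intro!: inj_onI)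
    moreover have "(\<lambda>a. f (is ! a) x) ` {..<m} \<subseteq> S x" using p unfolding P_def S_def arcs_def by auto
    ultimately show "m \<le> card (S x)" using card_mono[OF fin] by metis
  qed
  have meas: "{x \<in> space M. m \<le> card (S x)} \<in> sets M" for m
  proof -
    have "{x \<in> space M. m \<le> card (S x)} = {x \<in> space M. \<exists>is. length is = m \<and> P is x}" using eq by auto
    also have "\<dots> \<in> sets M" by measurable
    finally show ?thesis .
  qed
  have "(\<lambda>x. card (S x)) \<in> measurable M (count_space UNIV)"
  proof (subst measurable_count_space_eq2_countable, intro conjI ballI)
    fix m :: nat
    have "(\<lambda>x. card (S x)) -` {m} \<inter> space M = {x \<in> space M. m \<le> card (S x)} - {x \<in> space M. Suc m \<le> card (S x)}"
      by auto
    then show "(\<lambda>x. card (S x)) -` {m} \<inter> space M \<in> sets M" using meas by auto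
  qed auto
  then have "(\<lambda>x. ennreal (real (card (S x)))) \<in> borel_measurable M" by simp
  then show ?thesis unfolding arc_count_eq_card[abs_def] S_def by simp
qed

lemma arc_count_rect: "arc_count (A \<times> B) x = ennreal (real (deg E B x)) * indicator A x"
proof (cases "x \<in> A")
  case True
  then have "{y. (x, y) \<in> A \<times> B \<and> {x, y} \<in> E} = {y \<in> B. {x, y} \<in> E}" by auto
  then show ?thesis using True unfolding arc_count_eq_card deg_def by simp
qed (simp add: arc_count_eq_card)

text \<open>For rectangles this is the balance condition itself. Both sides are additive over
  disjoint unions, and the degree bound makes them finite, so that complements may be subtracted.
  Rectangles generate the product algebra and are closed under intersections.\<close>

lemma nn_integral_arc_count_swap:
  assumes fin: "finite_measure M"
    and bal: "\<And>A B. A \<in> sets M \<Longrightarrow> B \<in> sets M \<Longrightarrow>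
        (\<integral>\<^sup>+ x\<in>A. ennreal (real (deg E B x)) \<partial>M) = (\<integral>\<^sup>+ x\<in>B. ennreal (real (deg E A x)) \<partial>M)"
    and A: "A \<in> sets (M \<Otimes>\<^sub>M M)"
  shows "(\<integral>\<^sup>+ x. arc_count A x \<partial>M) = (\<integral>\<^sup>+ x. arc_count (A\<inverse>) x \<partial>M)"
proof -
  interpret finite_measure M by fact
  have swap: "A\<inverse> \<in> sets (M \<Otimes>\<^sub>M M)" if "A \<in> sets (M \<Otimes>\<^sub>M M)" for A
  proof -
    have "A\<inverse> = (\<lambda>(x, y). (y, x)) -` A \<inter> space (M \<Otimes>\<^sub>M M)"
      using sets.sets_into_space[OF that] by (auto simp: space_pair_measure)
    also have "\<dots> \<in> sets (M \<Otimes>\<^sub>M M)"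
      using that by (intro measurable_sets[of _ _ "M \<Otimes>\<^sub>M M"] measurable_pair_swap')
    finally show ?thesis .
  qed
  have bnd: "(\<integral>\<^sup>+ x. arc_count A x \<partial>M) \<noteq> \<infinity>" for A
  proof -
    have "(\<integral>\<^sup>+ x. arc_count A x \<partial>M) \<le> (\<integral>\<^sup>+ x. ennreal (real D) \<partial>M)"
      by (intro nn_integral_mono arc_count_le)
    also have "\<dots> < \<infinity>" using emeasure_finite[of "space M"] by (simp add: ennreal_mult_eq_top_iff less_top[symmetric])
    finally show ?thesis by simp
  qed
  let ?\<Omega> = "space M \<times> space M"
  have "A \<in> sigma_sets ?\<Omega> {a \<times> b | a b. a \<in> sets M \<and> b \<in> sets M}" using A unfolding sets_pair_measure .
  with Int_stable_pair_measure_generator pair_measure_closed show ?thesis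
  proof (induction rule: sigma_sets_induct_disjoint)
    case (basic X)
    then obtain a b where X: "X = a \<times> b" "a \<in> sets M" "b \<in> sets M" by auto
    have "X\<inverse> = b \<times> a" unfolding X by auto
    then show ?case using bal[OF X(2,3)] by (simp add: X arc_count_rect)
  next
    case empty
    then show ?case by simp
  next
    case (compl X)
    have X: "X \<in> sets (M \<Otimes>\<^sub>M M)" using compl(1) unfolding sets_pair_measure .
    have add: "(\<integral>\<^sup>+ x. arc_count Y x \<partial>M) + (\<integral>\<^sup>+ x. arc_count (?\<Omega> - Y) x \<partial>M) = (\<integral>\<^sup>+ x. arc_count ?\<Omega> x \<partial>M)"
      if Y: "Y \<in> sets (M \<Otimes>\<^sub>M M)" for Y
    proof -
      have Om: "?\<Omega> \<in> sets (M \<Otimes>\<^sub>M M)" by auto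
      have YO: "Y \<subseteq> ?\<Omega>" using sets.sets_into_space[OF Y] by (simp add: space_pair_measure)
      have "arc_count Y x + arc_count (?\<Omega> - Y) x = arc_count ?\<Omega> x" for x
        unfolding arc_count_def using YO by (subst plus_emeasure) (auto intro!: arg_cong[where f="emeasure _"])
      then show ?thesis using Y Om by (subst nn_integral_add[symmetric]) auto
    qed
    have sw: "(?\<Omega> - X)\<inverse> = ?\<Omega> - X\<inverse>" by auto
    have "(\<integral>\<^sup>+ x. arc_count X x \<partial>M) + (\<integral>\<^sup>+ x. arc_count (?\<Omega> - X) x \<partial>M) =
      (\<integral>\<^sup>+ x. arc_count X x \<partial>M) + (\<integral>\<^sup>+ x. arc_count ((?\<Omega> - X)\<inverse>) x \<partial>M)"
      using add[OF X] add[OF swap[OF X]] compl(2) unfolding sw by simp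
    then show ?case using bnd by (simp add: ennreal_add_left_cancel)
  next
    case (union X)
    have X: "X i \<in> sets (M \<Otimes>\<^sub>M M)" for i using union(2) unfolding sets_pair_measure by auto
    have sum: "(\<integral>\<^sup>+ x. arc_count (\<Union>i. Y i) x \<partial>M) = (\<Sum>i. \<integral>\<^sup>+ x. arc_count (Y i) x \<partial>M)"
      if Y: "\<And>i. Y i \<in> sets (M \<Otimes>\<^sub>M M)" "disjoint_family Y" for Y :: "nat \<Rightarrow> _"
    proof -
      have "arc_count (\<Union>i. Y i) x = (\<Sum>i. arc_count (Y i) x)" for x
      proof -
        have "disjoint_family (\<lambda>i. {y. (x, y) \<in> Y i \<and> {x, y} \<in> E})"
          using Y(2) unfolding disjoint_family_on_def by blast
        then show ?thesis unfolding arc_count_def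
          by (subst suminf_emeasure) (auto intro!: arg_cong[where f="emeasure _"])
      qed
      then show ?thesis using Y(1) by (simp add: nn_integral_suminf)
    qed
    have "disjoint_family (\<lambda>i. (X i)\<inverse>)"
      using union(1) unfolding disjoint_family_on_def by blast
    from sum[OF swap[OF X] this] sum[OF X union(1)] show ?case using union(3) by (simp add: converse_UNION)
  qed
qed

end

lemma graphing_imp_borel_graph:
  assumes "graphing (M, E)"
  shows "\<exists>D. borel_graph M E D"
  using assms unfolding graphing_def borel_graph_def Let_def by auto

text \<open>Arcs of F from A to B are the arcs of E in a Borel set, and this set is transposed when
  A and B are exchanged, since F is undirected. It is no rectangle in general, hence the extension
  of balance to all Borel sets of arcs.\<close>

lemma graphing_subset:
  assumes G: "graphing (M, E)" and F: "F \<subseteq> E" "edge_borel M F"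
  shows "graphing (M, F)"
proof -
  obtain D where "borel_graph M E D" using graphing_imp_borel_graph[OF G] ..
  then interpret borel_graph M E D .
  interpret F: borel_graph M F D
    by unfold_locales (use F standard edges degree edges_in_subset bounded_degree_subset in auto)
  have M: "prob_space M" and bal: "\<And>A B. A \<in> sets M \<Longrightarrow> B \<in> sets M \<Longrightarrow>
        (\<integral>\<^sup>+ x\<in>A. ennreal (real (deg E B x)) \<partial>M) = (\<integral>\<^sup>+ x\<in>B. ennreal (real (deg E A x)) \<partial>M)"
    using G unfolding graphing_def Let_def by auto
  have "(\<integral>\<^sup>+ x\<in>A. ennreal (real (deg F B x)) \<partial>M) = (\<integral>\<^sup>+ x\<in>B. ennreal (real (deg F A x)) \<partial>M)"
    if "A \<in> sets M" "B \<in> sets M" for A B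
  proof -
    have arcs: "F.arc_count X x = arc_count (X \<inter> F.arcs) x" for X x
    proof -
      have "{y. (x, y) \<in> X \<and> {x, y} \<in> F} = {y. (x, y) \<in> X \<inter> F.arcs \<and> {x, y} \<in> E}"
        using F(1) by (auto simp: F.arcs_def)
      then show ?thesis unfolding F.arc_count_def arc_count_def by simp
    qed
    have X: "A \<times> B \<inter> F.arcs \<in> sets (M \<Otimes>\<^sub>M M)" using that F.arcs_sets by auto
    have conv: "(A \<times> B \<inter> F.arcs)\<inverse> = B \<times> A \<inter> F.arcs"
      by (auto simp: F.arcs_def insert_commute)
    have "(\<integral>\<^sup>+ x. arc_count (A \<times> B \<inter> F.arcs) x \<partial>M) = (\<integral>\<^sup>+ x. arc_count (B \<times> A \<inter> F.arcs) x \<partial>M)"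
      unfolding conv[symmetric] by (rule nn_integral_arc_count_swap[OF prob_space.finite_measure[OF M] bal X])
    then show ?thesis unfolding arcs[symmetric] F.arc_count_rect by simp
  qed
  then show ?thesis
    using M standard F.edges F.borel F.degree unfolding graphing_def Let_def by auto
qed

text \<open>With the discrete topology every subset is Borel, and balance is double counting of the
  adjacent pairs in A and B.\<close>

lemma graphing_finite:
  assumes V: "fin_graph D V E"
  shows "graphing (as_graphing V E)"
proof -
  let ?M = "uniform_count_measure V"
  have fin: "finite V" "V \<noteq> {}" and E: "edges_in V E" "bounded_degree V E D" using V unfolding fin_graph_def by auto
  have "standard_borel ?M"
    unfolding standard_borel_def
  proof (intro exI[of _ "discrete_topology V"] conjI)
    have "{U. openin (discrete_topology V) U} = Pow V" by auto
    moreover have "sigma_sets V (Pow V) = Pow V" using sigma_sets_into_sp[of "Pow V" V] by (auto intro: sigma_sets.Basic)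
    ultimately show "sets ?M = borel_sets (discrete_topology V)" by (simp add: sets_uniform_count_measure)
  qed (use fin in \<open>auto simp: completely_metrizable_space_discrete_topology separable_space_discrete_topology
         space_uniform_count_measure countable_finite\<close>)
  moreover have "edge_borel ?M E"
    unfolding edge_borel_def
  proof (rule sets.countable)
    show "countable {(x, y). x \<in> space ?M \<and> y \<in> space ?M \<and> {x, y} \<in> E}"
      by (rule countable_subset[of _ "V \<times> V"]) (use fin in \<open>auto simp: space_uniform_count_measure countable_finite\<close>)
    fix a assume "a \<in> {(x, y). x \<in> space ?M \<and> y \<in> space ?M \<and> {x, y} \<in> E}"
    then have "{a} = {fst a} \<times> {snd a}" "{fst a} \<in> sets ?M" "{snd a} \<in> sets ?M"
      by (auto simp: space_uniform_count_measure sets_uniform_count_measure)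
    then show "{a} \<in> sets (?M \<Otimes>\<^sub>M ?M)" by (metis pair_measureI)
  qed
  moreover have "(\<integral>\<^sup>+ x\<in>A. ennreal (real (deg E B x)) \<partial>?M) = (\<integral>\<^sup>+ x\<in>B. ennreal (real (deg E A x)) \<partial>?M)"
    if "A \<in> sets ?M" "B \<in> sets ?M" for A B
  proof -
    have *: "(\<integral>\<^sup>+ x\<in>A. ennreal (real (deg E B x)) \<partial>?M) =
      (\<Sum>x\<in>V. \<Sum>y\<in>V. ennreal (1 / card V) * (if x \<in> A \<and> y \<in> B \<and> {x, y} \<in> E then 1 else 0))"
      if "A \<subseteq> V" "B \<subseteq> V" for A B
    proof -
      have "ennreal (real (deg E B x)) * indicator A x = (\<Sum>y\<in>V. if x \<in> A \<and> y \<in> B \<and> {x, y} \<in> E then 1 else 0)" for x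
      proof (cases "x \<in> A")
        case True
        have "V \<inter> {y. y \<in> B \<and> {x, y} \<in> E} = {y \<in> B. {x, y} \<in> E}" using that by auto
        then show ?thesis using True fin by (simp add: deg_def sum.If_cases ennreal_of_nat_eq_real_of_nat)
      qed simp
      then show ?thesis unfolding uniform_count_measure_def
        using fin by (simp add: nn_integral_point_measure_finite sum_distrib_left)
    qed
    have "A \<subseteq> V" "B \<subseteq> V" using that by (auto simp: sets_uniform_count_measure)
    then show ?thesis
      using sum.swap[of "\<lambda>x y. ennreal (1 / card V) * (if x \<in> A \<and> y \<in> B \<and> {x, y} \<in> E then 1 else 0)" V V]
        *[of A B] *[of B A] by (simp add: insert_commute conj_commute conj_left_commute)
  qed
  ultimately show ?thesis
    unfolding graphing_def as_graphing_def Let_def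
    using fin E prob_space_uniform_count_measure[OF fin] by (auto simp: space_uniform_count_measure)
qed

lemma fin_graph_subset: "fin_graph D V E \<Longrightarrow> F \<subseteq> E \<Longrightarrow> fin_graph D V F"
  unfolding fin_graph_def using edges_in_subset bounded_degree_subset by blast

lemma measure_uniform_count:
  assumes "finite V" "A \<subseteq> V"
  shows "measure (uniform_count_measure V) A = real (card A) / real (card V)"
  using assms by (simp add: measure_uniform_count_measure)

section \<open>Isomorphism types of coloured balls\<close>

text \<open>Two vertex types are allowed, so that one relation compares balls of two graphs as well
  as a ball with its finite model.\<close>

definition ball_eqv :: "nat \<Rightarrow> 'a set set \<Rightarrow> ('a \<Rightarrow> nat) \<Rightarrow> 'a \<Rightarrow> 'b set set \<Rightarrow> ('b \<Rightarrow> nat) \<Rightarrow> 'b \<Rightarrow> bool" where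
  "ball_eqv r E c x E' c' x' \<longleftrightarrow> (\<exists>h. bij_betw h (ball E r x) (ball E' r x') \<and> h x = x' \<and>
     (\<forall>y\<in>ball E r x. \<forall>z\<in>ball E r x. {y, z} \<in> E \<longleftrightarrow> {h y, h z} \<in> E') \<and>
     (\<forall>y\<in>ball E r x. c y = c' (h y)))"

lemma ball_eqv_sym:
  assumes "ball_eqv r E c x E' c' x'" shows "ball_eqv r E' c' x' E c x"
proof -
  obtain h where h: "bij_betw h (ball E r x) (ball E' r x')" "h x = x'"
     "\<And>y z. y \<in> ball E r x \<Longrightarrow> z \<in> ball E r x \<Longrightarrow> {y, z} \<in> E \<longleftrightarrow> {h y, h z} \<in> E'"
     "\<And>y. y \<in> ball E r x \<Longrightarrow> c y = c' (h y)" using assms unfolding ball_eqv_def by auto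
  define k where "k = inv_into (ball E r x) h"
  have k: "bij_betw k (ball E' r x') (ball E r x)" unfolding k_def using h(1) by (rule bij_betw_inv_into)
  have hk: "h (k y) = y" "k y \<in> ball E r x" if "y \<in> ball E' r x'" for y
    using that h(1) k by (auto simp: k_def bij_betw_inv_into_right bij_betw_def)
  have "k x' = x" unfolding k_def h(2)[symmetric] using h(1) by (simp add: bij_betw_inv_into_left)
  then show ?thesis unfolding ball_eqv_def using k h(3,4) hk by (intro exI[of _ k]) (metis (no_types, lifting))
qed

lemma ball_eqv_trans:
  assumes "ball_eqv r E c x E' c' x'" "ball_eqv r E' c' x' E'' c'' x''" shows "ball_eqv r E c x E'' c'' x''"
proof -
  obtain h where h: "bij_betw h (ball E r x) (ball E' r x')" "h x = x'"
     "\<And>y z. y \<in> ball E r x \<Longrightarrow> z \<in> ball E r x \<Longrightarrow> {y, z} \<in> E \<longleftrightarrow> {h y, h z} \<in> E'"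
     "\<And>y. y \<in> ball E r x \<Longrightarrow> c y = c' (h y)" using assms(1) unfolding ball_eqv_def by auto
  obtain k where k: "bij_betw k (ball E' r x') (ball E'' r x'')" "k x' = x''"
     "\<And>y z. y \<in> ball E' r x' \<Longrightarrow> z \<in> ball E' r x' \<Longrightarrow> {y, z} \<in> E' \<longleftrightarrow> {k y, k z} \<in> E''"
     "\<And>y. y \<in> ball E' r x' \<Longrightarrow> c' y = c'' (k y)" using assms(2) unfolding ball_eqv_def by auto
  have hb: "h y \<in> ball E' r x'" if "y \<in> ball E r x" for y using h(1) that unfolding bij_betw_def by auto
  show ?thesis unfolding ball_eqv_def
    by (rule exI[of _ "k \<circ> h"]) (use bij_betw_trans[OF h(1) k(1)] h k hb in auto)
qed

lemma image_ball_subset: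
  assumes "ball E r x \<subseteq> X" "\<And>y z. y \<in> X \<Longrightarrow> z \<in> X \<Longrightarrow> {y, z} \<in> E \<Longrightarrow> {h y, h z} \<in> E'"
  shows "h ` ball E r x \<subseteq> ball E' r (h x)"
  using assms(1)
proof (induction r)
  case (Suc r)
  have sub: "ball E r x \<subseteq> X" using Suc.prems ball_mono[of r "Suc r" E x] by auto
  show ?case
  proof
    fix w assume "w \<in> h ` ball E (Suc r) x"
    then obtain z y where w: "w = h z" "y \<in> ball E r x" "z = y \<or> {y, z} \<in> E" "z \<in> ball E (Suc r) x"
      unfolding ball_Suc by blast
    have "h y \<in> ball E' r (h x)" using Suc.IH[OF sub] w by auto
    moreover have "z = y \<or> {h y, h z} \<in> E'" using assms(2) w sub Suc.prems by blast
    ultimately show "w \<in> ball E' (Suc r) (h x)" unfolding ball_Suc w(1) by auto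
  qed
qed simp

text \<open>Paths inside X are carried forward by h and back by its inverse, so an isomorphism
  between larger sets restricts to the balls that they contain.\<close>

lemma bij_betw_ball:
  assumes h: "bij_betw h X X'" and x: "x \<in> X" and sub: "ball E r x \<subseteq> X" "ball E' r (h x) \<subseteq> X'"
    and adj: "\<And>y z. y \<in> X \<Longrightarrow> z \<in> X \<Longrightarrow> {y, z} \<in> E \<longleftrightarrow> {h y, h z} \<in> E'"
  shows "bij_betw h (ball E r x) (ball E' r (h x))"
proof -
  define k where "k = inv_into X h"
  have k: "k y \<in> X" "h (k y) = y" if "y \<in> X'" for y
    using that h bij_betw_inv_into_right[OF h that] by (auto simp: k_def bij_betw_def inv_into_into)
  have kx: "k (h x) = x" using h x by (simp add: k_def bij_betw_inv_into_left)
  have "k ` ball E' r (h x) \<subseteq> ball E r (k (h x))"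
    by (rule image_ball_subset[OF sub(2)]) (use adj k in auto)
  then have "h ` k ` ball E' r (h x) \<subseteq> h ` ball E r x" unfolding kx by (rule image_mono)
  moreover have "h ` k ` ball E' r (h x) = ball E' r (h x)" using k(2) sub(2) by (force simp: image_image)
  moreover have "h ` ball E r x \<subseteq> ball E' r (h x)" by (rule image_ball_subset[OF sub(1)]) (use adj in auto)
  ultimately show ?thesis using h sub(1) unfolding bij_betw_def by (auto intro: inj_on_subset)
qed

lemma rooted_graph_ball:
  assumes "rooted_graph r (N, rt, A)" shows "ball A r rt = {..<N}"
  using assms ball_subset[of "{..<N}" A rt r] unfolding rooted_graph_def by auto

lemma ball_iso_col_eqv:
  assumes "rooted_graph r (N, rt, A)"
  shows "ball_iso_col E r c x (N, rt, A) col \<longleftrightarrow> ball_eqv r E c x A col rt"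
  unfolding ball_iso_col_def ball_eqv_def rooted_graph_ball[OF assms] by simp

lemma ball_iso_eqv:
  assumes "rooted_graph r (N, rt, A)"
  shows "ball_iso E r x (N, rt, A) \<longleftrightarrow> ball_eqv r E (\<lambda>_. 0) x A (\<lambda>_. 0) rt"
  unfolding ball_iso_eq_col by (rule ball_iso_col_eqv[OF assms])

lemma ball_iso_cong:
  assumes "rooted_graph r \<alpha>" "ball_eqv r E (\<lambda>_. 0) x E' (\<lambda>_. 0) x'"
  shows "ball_iso E r x \<alpha> \<longleftrightarrow> ball_iso E' r x' \<alpha>"
proof -
  obtain N rt A where \<alpha>: "\<alpha> = (N, rt, A)" by (cases \<alpha>)
  show ?thesis unfolding \<alpha> ball_iso_eqv[OF assms(1)[unfolded \<alpha>]]
    using ball_eqv_trans[OF assms(2)] ball_eqv_trans[OF ball_eqv_sym[OF assms(2)]] by auto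
qed

definition edge_filter :: "(nat \<Rightarrow> nat \<Rightarrow> bool) \<Rightarrow> 'a set set \<Rightarrow> ('a \<Rightarrow> nat) \<Rightarrow> 'a set set" where
  "edge_filter \<delta> E c = {e \<in> E. \<exists>u v. e = {u, v} \<and> \<delta> (c u) (c v)}"

lemma doubleton_in_edge_filter:
  assumes "symp \<delta>"
  shows "{y, z} \<in> edge_filter \<delta> E c \<longleftrightarrow> {y, z} \<in> E \<and> \<delta> (c y) (c z)"
  using sympD[OF assms] unfolding edge_filter_def by (auto simp: doubleton_eq_iff)

lemma ball_subgraph: "F \<subseteq> E \<Longrightarrow> q \<le> r \<Longrightarrow> ball F q x \<subseteq> ball E r x"
  using image_ball_subset[of F q x UNIV "\<lambda>x. x" E] ball_mono[of q r E x] by auto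

text \<open>Whether an edge is kept depends on the colours of its ends, and the filtered ball of
  radius q stays inside the coloured ball of radius r; so the coloured ball already determines it,
  without any loss of radius.\<close>

lemma ball_eqv_edge_filter:
  assumes eqv: "ball_eqv r E c x E' c' x'" and q: "q \<le> r" and \<delta>: "symp \<delta>"
  shows "ball_eqv q (edge_filter \<delta> E c) (\<lambda>_. 0) x (edge_filter \<delta> E' c') (\<lambda>_. 0) x'"
proof -
  obtain h where h: "bij_betw h (ball E r x) (ball E' r x')" "h x = x'"
     "\<And>y z. y \<in> ball E r x \<Longrightarrow> z \<in> ball E r x \<Longrightarrow> {y, z} \<in> E \<longleftrightarrow> {h y, h z} \<in> E'"
     "\<And>y. y \<in> ball E r x \<Longrightarrow> c y = c' (h y)" using eqv unfolding ball_eqv_def by auto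
  let ?F = "edge_filter \<delta> E c" and ?F' = "edge_filter \<delta> E' c'"
  have sub: "ball ?F q x \<subseteq> ball E r x" "ball ?F' q x' \<subseteq> ball E' r x'"
    by (rule ball_subgraph[OF _ q]; auto simp: edge_filter_def)+
  have adj: "{y, z} \<in> ?F \<longleftrightarrow> {h y, h z} \<in> ?F'" if "y \<in> ball E r x" "z \<in> ball E r x" for y z
    using h(3,4) that unfolding doubleton_in_edge_filter[OF \<delta>] by auto
  have "bij_betw h (ball ?F q x) (ball ?F' q (h x))"
    by (rule bij_betw_ball[OF h(1)]) (use sub h(2) adj in auto)
  then show ?thesis unfolding ball_eqv_def h(2) using h(2) adj sub by (intro exI[of _ h]) auto
qed

text \<open>The colouring is extensional, so the set is finite; the size bound is that of a ball of
  radius r. Isomorphic duplicates remain and are removed later by choosing representatives.\<close>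

definition ball_types :: "nat \<Rightarrow> nat \<Rightarrow> nat \<Rightarrow> (rgraph \<times> (nat \<Rightarrow> nat)) set" where
  "ball_types D K r = {((N, rt, A), col) | N rt A col.
     rooted_graph r (N, rt, A) \<and> N \<le> Suc D ^ r \<and> col \<in> {..<N} \<rightarrow>\<^sub>E {..<K}}"

lemma finite_ball_types: "finite (ball_types D K r)"
proof (rule finite_subset)
  let ?B = "Suc D ^ r"
  show "ball_types D K r \<subseteq> ({..?B} \<times> {..?B} \<times> Pow (Pow {..<?B})) \<times> (\<Union>N\<in>{..?B}. {..<N} \<rightarrow>\<^sub>E {..<K})"
  proof
    fix \<beta> assume "\<beta> \<in> ball_types D K r"
    then obtain N rt A col where \<beta>: "\<beta> = ((N, rt, A), col)" "rooted_graph r (N, rt, A)" "N \<le> ?B" "col \<in> {..<N} \<rightarrow>\<^sub>E {..<K}"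
      unfolding ball_types_def by blast
    then have "rt < N" "edges_in {..<N} A" by (auto simp: rooted_graph_def)
    have "A \<subseteq> Pow {..<?B}"
    proof
      fix e assume "e \<in> A"
      then obtain a b where "a < N" "b < N" "e = {a, b}" using \<open>edges_in {..<N} A\<close> unfolding edges_in_def by blast
      then show "e \<in> Pow {..<?B}" using \<beta>(3) by simp
    qed
    then show "\<beta> \<in> ({..?B} \<times> {..?B} \<times> Pow (Pow {..<?B})) \<times> (\<Union>N\<in>{..?B}. {..<N} \<rightarrow>\<^sub>E {..<K})"
      using \<beta> \<open>rt < N\<close> by auto
  qed
  show "finite (({..?B} \<times> {..?B} \<times> Pow (Pow {..<?B})) \<times> (\<Union>N\<in>{..?B}. {..<N} \<rightarrow>\<^sub>E {..<K}))"
    by (simp add: finite_PiE)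
qed

lemma rooted_graph_ball_types:
  assumes "\<beta> \<in> ball_types D K r" shows "rooted_graph r (fst \<beta>)"
proof -
  obtain N rt A col where "\<beta> = ((N, rt, A), col)" "rooted_graph r (N, rt, A)"
    using assms unfolding ball_types_def by blast
  then show ?thesis by simp
qed

lemma ball_types_cover:
  assumes E: "edges_in J E" "bounded_degree J E D" and x: "x \<in> J" and c: "\<And>y. y \<in> J \<Longrightarrow> c y < K"
  shows "\<exists>\<beta>\<in>ball_types D K r. ball_iso_col E r c x (fst \<beta>) (snd \<beta>)"
proof -
  define X where "X = ball E r x"
  define N where "N = card X"
  have fin: "finite X" and N: "N \<le> Suc D ^ r" unfolding X_def N_def using finite_card_ball[OF E x] by auto
  obtain h where h: "bij_betw h X {..<N}"
    using ex_bij_betw_finite_nat[OF fin] unfolding N_def by (auto simp: atLeast0LessThan)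
  have inj: "h y = h z \<longleftrightarrow> y = z" if "y \<in> X" "z \<in> X" for y z
    using h that unfolding bij_betw_def by (auto dest: inj_onD)
  have hN: "h y < N" if "y \<in> X" for y using h that unfolding bij_betw_def by auto
  define A where "A = {{h y, h z} | y z. y \<in> X \<and> z \<in> X \<and> {y, z} \<in> E}"
  have adj: "{y, z} \<in> E \<longleftrightarrow> {h y, h z} \<in> A" if "y \<in> X" "z \<in> X" for y z
  proof
    assume "{h y, h z} \<in> A"
    then obtain y' z' where "{h y, h z} = {h y', h z'}" "y' \<in> X" "z' \<in> X" "{y', z'} \<in> E" unfolding A_def by blast
    then show "{y, z} \<in> E" using inj that by (auto simp: doubleton_eq_iff insert_commute)
  qed (use that in \<open>auto simp: A_def\<close>)
  define col where "col = restrict (\<lambda>a. c (inv_into X h a)) {..<N}"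
  have xX: "x \<in> X" by (simp add: X_def)
  have "edges_in {..<N} A"
    unfolding edges_in_def
  proof
    fix e assume "e \<in> A"
    then obtain y z where yz: "e = {h y, h z}" "y \<in> X" "z \<in> X" "{y, z} \<in> E" unfolding A_def by blast
    then show "\<exists>x y. x \<noteq> y \<and> x \<in> {..<N} \<and> y \<in> {..<N} \<and> e = {x, y}"
      using hN inj edges_inD(3)[OF E(1) yz(4)] by (intro exI[of _ "h y"] exI[of _ "h z"]) auto
  qed
  moreover have "h ` ball E r x \<subseteq> ball A r (h x)"
    by (rule image_ball_subset[of _ _ _ X]) (use adj in \<open>auto simp: X_def\<close>)
  then have "{..<N} \<subseteq> ball A r (h x)" using h unfolding bij_betw_def X_def by auto
  ultimately have rg: "rooted_graph r (N, h x, A)" unfolding rooted_graph_def using hN[OF xX] by auto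
  have "col \<in> {..<N} \<rightarrow>\<^sub>E {..<K}"
  proof -
    have "inv_into X h a \<in> J" if "a < N" for a
      using that h ball_subset[OF E(1) x, of r] unfolding bij_betw_def X_def by (auto simp: inv_into_into subset_eq)
    then show ?thesis unfolding col_def using c by auto
  qed
  then have "((N, h x, A), col) \<in> ball_types D K r" unfolding ball_types_def using rg N by auto
  moreover have "c y = col (h y)" if "y \<in> X" for y
    using that hN[OF that] h by (simp add: col_def bij_betw_inv_into_left)
  then have "ball_iso_col E r c x (N, h x, A) col"
    unfolding ball_iso_col_def X_def[symmetric] prod.case using h adj by blast
  ultimately show ?thesis by (metis fst_conv snd_conv)
qed

text \<open>An invariant event is a union of isomorphism classes of coloured balls, of which only
  finitely many occur for a given degree bound and number of colours. The index set R works for all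
  graphings at once, which is what allows two of them to be compared.\<close>

lemma statistic_eq_sum_types:
  fixes Q :: "'a set set \<Rightarrow> ('a \<Rightarrow> nat) \<Rightarrow> 'a \<Rightarrow> bool"
  assumes Q: "\<And>E c x E' c' x'. ball_eqv r E c x E' c' x' \<Longrightarrow> Q E c x = Q E' c' x'"
  shows "\<exists>R\<subseteq>ball_types D K r. \<forall>M E c. graphing (M, E) \<longrightarrow> bounded_degree (space M) E D \<longrightarrow> borel_coloring M K c \<longrightarrow>
     measure M {x \<in> space M. Q E c x} = (\<Sum>\<beta>\<in>R. P_col (M, E) r c \<beta>)"
proof -
  let ?B = "ball_types D K r"
  define eqv where "eqv \<beta> \<beta>' \<longleftrightarrow> ball_eqv r (snd (snd (fst \<beta>))) (snd \<beta>) (fst (snd (fst \<beta>)))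
     (snd (snd (fst \<beta>'))) (snd \<beta>') (fst (snd (fst \<beta>')))" for \<beta> \<beta>' :: "rgraph \<times> (nat \<Rightarrow> nat)"
  define occ where "occ E c x \<beta> \<longleftrightarrow> ball_iso_col E r c x (fst \<beta>) (snd \<beta>)" for E :: "'a set set" and c x \<beta>
  have occ: "occ E c x \<beta> \<longleftrightarrow> ball_eqv r E c x (snd (snd (fst \<beta>))) (snd \<beta>) (fst (snd (fst \<beta>)))"
    if "\<beta> \<in> ?B" for E :: "'a set set" and c x \<beta>
    using ball_iso_col_eqv[of r "fst (fst \<beta>)" "fst (snd (fst \<beta>))" "snd (snd (fst \<beta>))" E c x "snd \<beta>"]
      rooted_graph_ball_types[OF that] unfolding occ_def by simp
  have eqv_sym: "eqv \<beta> \<beta>' \<Longrightarrow> eqv \<beta>' \<beta>" for \<beta> \<beta>' unfolding eqv_def by (rule ball_eqv_sym)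
  have eqv_trans: "eqv \<beta> \<beta>' \<Longrightarrow> eqv \<beta>' \<beta>'' \<Longrightarrow> eqv \<beta> \<beta>''" for \<beta> \<beta>' \<beta>'' unfolding eqv_def by (rule ball_eqv_trans)
  have eqv_refl: "eqv \<beta> \<beta>" for \<beta> unfolding eqv_def ball_eqv_def by (rule exI[of _ "\<lambda>x. x"]) (auto simp: bij_betw_def)
  \<comment> \<open>One representative per class: isomorphic types describe the same event and would
    be counted several times.\<close>
  define \<rho> where "\<rho> \<beta> = (SOME \<beta>'. \<beta>' \<in> ?B \<and> eqv \<beta> \<beta>')" for \<beta>
  have \<rho>: "\<rho> \<beta> \<in> ?B" "eqv \<beta> (\<rho> \<beta>)" if "\<beta> \<in> ?B" for \<beta>
  proof -
    have "\<rho> \<beta> \<in> ?B \<and> eqv \<beta> (\<rho> \<beta>)" unfolding \<rho>_def by (rule someI[of _ \<beta>]) (use that eqv_refl in auto)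
    then show "\<rho> \<beta> \<in> ?B" "eqv \<beta> (\<rho> \<beta>)" by auto
  qed
  have \<rho>_eq: "\<rho> \<beta> = \<rho> \<beta>'" if "eqv \<beta> \<beta>'" for \<beta> \<beta>'
  proof -
    have "eqv \<beta> = eqv \<beta>'" using eqv_trans eqv_sym that by blast
    then show ?thesis by (simp add: \<rho>_def)
  qed
  \<comment> \<open>Since Q is invariant, a single occurrence in any graph decides whether a type
    belongs to R.\<close>
  define R where "R = {\<beta> \<in> \<rho> ` ?B. \<exists>E c x. occ E c x \<beta> \<and> Q E c x}"
  have RB: "R \<subseteq> ?B" using \<rho>(1) unfolding R_def by auto
  have fin: "finite R" using finite_subset[OF RB finite_ball_types] .
  have "measure M {x \<in> space M. Q E c x} = (\<Sum>\<beta>\<in>R. P_col (M, E) r c \<beta>)"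
    if G: "graphing (M, E)" and D: "bounded_degree (space M) E D" and c: "borel_coloring M K c" for M E c
  proof -
    obtain D' where "borel_graph M E D'" using graphing_imp_borel_graph[OF G] ..
    then interpret borel_graph M E D' .
    interpret prob_space M using G unfolding graphing_def Let_def by simp
    have sets: "{x \<in> space M. occ E c x \<beta>} \<in> sets M" for \<beta>
      unfolding occ_def by (rule sets_ball_iso_col[OF borel_coloring_measurable[OF c]])
    have eq: "{x \<in> space M. Q E c x} = (\<Union>\<beta>\<in>R. {x \<in> space M. occ E c x \<beta>})"
    proof (intro set_eqI iffI)
      fix x assume "x \<in> {x \<in> space M. Q E c x}"
      then have x: "x \<in> space M" "Q E c x" by auto
      have "\<And>y. y \<in> space M \<Longrightarrow> c y < K" using c unfolding borel_coloring_def by auto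
      then obtain \<beta> where \<beta>: "\<beta> \<in> ?B" "occ E c x \<beta>"
        using ball_types_cover[OF edges D x(1), of c K r] unfolding occ_def by auto
      have "occ E c x (\<rho> \<beta>)"
        using ball_eqv_trans[OF \<beta>(2)[unfolded occ[OF \<beta>(1)]] \<rho>(2)[OF \<beta>(1), unfolded eqv_def]]
        unfolding occ[OF \<rho>(1)[OF \<beta>(1)]] .
      then show "x \<in> (\<Union>\<beta>\<in>R. {x \<in> space M. occ E c x \<beta>})" using x \<beta>(1) unfolding R_def by blast
    next
      fix x assume "x \<in> (\<Union>\<beta>\<in>R. {x \<in> space M. occ E c x \<beta>})"
      then obtain \<beta> where \<beta>: "\<beta> \<in> R" "x \<in> space M" "occ E c x \<beta>" by auto
      then obtain E' c' x' where E': "occ E' c' x' \<beta>" "Q E' c' x'" unfolding R_def by auto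
      have \<beta>B: "\<beta> \<in> ?B" using RB \<beta>(1) by auto
      have "ball_eqv r E c x E' c' x'"
        using ball_eqv_trans[OF \<beta>(3)[unfolded occ[OF \<beta>B]] ball_eqv_sym[OF E'(1)[unfolded occ[OF \<beta>B]]]] .
      then show "x \<in> {x \<in> space M. Q E c x}" using Q E'(2) \<beta>(2) by blast
    qed
    have "disjoint_family_on (\<lambda>\<beta>. {x \<in> space M. occ E c x \<beta>}) R"
      unfolding disjoint_family_on_def
    proof (intro ballI impI)
      fix \<beta> \<beta>' assume b: "\<beta> \<in> R" "\<beta>' \<in> R" "\<beta> \<noteq> \<beta>'"
      show "{x \<in> space M. occ E c x \<beta>} \<inter> {x \<in> space M. occ E c x \<beta>'} = {}"
      proof (rule ccontr)
        assume "\<not> ?thesis"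
        then obtain x where x: "occ E c x \<beta>" "occ E c x \<beta>'" by auto
        have B: "\<beta> \<in> ?B" "\<beta>' \<in> ?B" using RB b by auto
        have "eqv \<beta> \<beta>'"
          unfolding eqv_def
          by (rule ball_eqv_trans[OF ball_eqv_sym[OF x(1)[unfolded occ[OF B(1)]]] x(2)[unfolded occ[OF B(2)]]])
        moreover obtain \<gamma> \<gamma>' where g: "\<gamma> \<in> ?B" "\<gamma>' \<in> ?B" "\<beta> = \<rho> \<gamma>" "\<beta>' = \<rho> \<gamma>'" using b unfolding R_def by auto
        ultimately have "eqv \<gamma> \<gamma>'" using \<rho>(2) eqv_trans eqv_sym by metis
        then show False using \<rho>_eq g b(3) by metis
      qed
    qed
    then show ?thesis unfolding eq using sets fin
      by (subst finite_measure_finite_Union) (auto simp: P_col_def occ_def)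
  qed
  then show ?thesis using RB by blast
qed

text \<open>The bound counts all types and not only those in R, so that it does not depend on
  Q.\<close>

lemma statistics_close:
  fixes Q :: "'a set set \<Rightarrow> ('a \<Rightarrow> nat) \<Rightarrow> 'a \<Rightarrow> bool"
  assumes Q: "\<And>E c x E' c' x'. ball_eqv r E c x E' c' x' \<Longrightarrow> Q E c x = Q E' c' x'"
    and G: "graphing (M, E)" "bounded_degree (space M) E D" "borel_coloring M K c"
    and G': "graphing (M', E')" "bounded_degree (space M') E' D" "borel_coloring M' K c'"
    and close: "\<And>\<beta>. rooted_graph r (fst \<beta>) \<Longrightarrow> \<bar>P_col (M, E) r c \<beta> - P_col (M', E') r c' \<beta>\<bar> \<le> \<epsilon>"
  shows "\<bar>measure M {x \<in> space M. Q E c x} - measure M' {x \<in> space M'. Q E' c' x}\<bar>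
     \<le> real (card (ball_types D K r)) * \<epsilon>"
proof -
  obtain R where R: "R \<subseteq> ball_types D K r" "\<And>M E c. graphing (M, E) \<Longrightarrow> bounded_degree (space M) E D \<Longrightarrow> borel_coloring M K c \<Longrightarrow>
     measure M {x \<in> space M. Q E c x} = (\<Sum>\<beta>\<in>R. P_col (M, E) r c \<beta>)"
    using statistic_eq_sum_types[of r Q, OF Q] by blast
  have "\<bar>(\<Sum>\<beta>\<in>R. P_col (M, E) r c \<beta>) - (\<Sum>\<beta>\<in>R. P_col (M', E') r c' \<beta>)\<bar> \<le> (\<Sum>\<beta>\<in>R. \<bar>P_col (M, E) r c \<beta> - P_col (M', E') r c' \<beta>\<bar>)"
    unfolding sum_subtractf[symmetric] by (rule sum_abs)
  also have "\<dots> \<le> (\<Sum>\<beta>\<in>ball_types D K r. \<bar>P_col (M, E) r c \<beta> - P_col (M', E') r c' \<beta>\<bar>)"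
    by (rule sum_mono2[OF finite_ball_types R(1)]) auto
  also have "\<dots> \<le> real (card (ball_types D K r)) * \<epsilon>"
    using close by (intro sum_bounded_above) (auto dest: rooted_graph_ball_types)
  finally show ?thesis unfolding R(2)[OF G] R(2)[OF G'] .
qed

lemma P_loc_edge_filter_close:
  fixes M M' :: "'a measure"
  assumes \<delta>: "symp \<delta>" and q: "q \<le> r" "rooted_graph q \<alpha>"
    and G: "graphing (M, E)" "bounded_degree (space M) E D" "borel_coloring M K c"
    and G': "graphing (M', E')" "bounded_degree (space M') E' D" "borel_coloring M' K c'"
    and close: "\<And>\<beta>. rooted_graph r (fst \<beta>) \<Longrightarrow> \<bar>P_col (M, E) r c \<beta> - P_col (M', E') r c' \<beta>\<bar> \<le> \<epsilon>"
  shows "\<bar>P_loc (M, edge_filter \<delta> E c) q \<alpha> - P_loc (M', edge_filter \<delta> E' c') q \<alpha>\<bar> \<le> real (card (ball_types D K r)) * \<epsilon>"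
  using statistics_close[of r "\<lambda>E c x. ball_iso (edge_filter \<delta> E c) q x \<alpha>",
      OF ball_iso_cong[OF q(2) ball_eqv_edge_filter[OF _ q(1) \<delta>]] G G' close] unfolding P_loc_def by simp

section \<open>Colourings of finite graphs\<close>

text \<open>A new vertex sees at most \<Delta> earlier colours, so one of \<Delta> + 1 is free. The
  relation may be reflexive, in which case the vertex itself is included in the count.\<close>

lemma greedy_coloring:
  fixes P :: "'a \<Rightarrow> 'a \<Rightarrow> bool"
  assumes "finite V" and sym: "\<And>x y. P x y \<Longrightarrow> P y x" and "\<And>x. x \<in> V \<Longrightarrow> card {y \<in> V. P x y} \<le> \<Delta>"
  shows "\<exists>a :: 'a \<Rightarrow> nat. (\<forall>x\<in>V. a x \<le> \<Delta>) \<and> (\<forall>x\<in>V. \<forall>y\<in>V. P x y \<longrightarrow> x \<noteq> y \<longrightarrow> a x \<noteq> a y)"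
  using assms(1,3)
proof (induction V)
  case empty
  then show ?case by auto
next
  case (insert v V)
  have "card {y \<in> V. P x y} \<le> \<Delta>" if "x \<in> V" for x
  proof -
    have "card {y \<in> V. P x y} \<le> card {y \<in> insert v V. P x y}"
      using insert.hyps by (intro card_mono) auto
    then show ?thesis using insert.prems[of x] that by simp
  qed
  then have "\<exists>a :: 'a \<Rightarrow> nat. (\<forall>x\<in>V. a x \<le> \<Delta>) \<and> (\<forall>x\<in>V. \<forall>y\<in>V. P x y \<longrightarrow> x \<noteq> y \<longrightarrow> a x \<noteq> a y)"
    by (rule insert.IH)
  then obtain a :: "'a \<Rightarrow> nat" where a: "\<forall>x\<in>V. a x \<le> \<Delta>" "\<forall>x\<in>V. \<forall>y\<in>V. P x y \<longrightarrow> x \<noteq> y \<longrightarrow> a x \<noteq> a y"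
    by (elim exE conjE)
  have "card (a ` {y \<in> V. P v y}) \<le> card {y \<in> insert v V. P v y}"
    using insert.hyps by (intro order_trans[OF card_image_le] card_mono) auto
  also have "\<dots> \<le> \<Delta>" using insert.prems[of v] by simp
  finally have "\<not> {..\<Delta>} \<subseteq> a ` {y \<in> V. P v y}"
    using insert.hyps card_mono[of "a ` {y \<in> V. P v y}" "{..\<Delta>}"] by force
  then obtain i where i: "i \<le> \<Delta>" "i \<notin> a ` {y \<in> V. P v y}" by auto
  show ?case
  proof (intro exI[of _ "a(v := i)"] conjI ballI impI)
    fix x assume "x \<in> insert v V" then show "(a(v := i)) x \<le> \<Delta>" using a(1) i(1) by auto
  next
    fix x y assume xy: "x \<in> insert v V" "y \<in> insert v V" "P x y" "x \<noteq> y"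
    have nv: "a w \<noteq> i" if "w \<in> V" "P v w" for w using i(2) that by blast
    consider "x = v" "y \<in> V" | "y = v" "x \<in> V" | "x \<in> V" "y \<in> V" "x \<noteq> v" "y \<noteq> v" using xy by blast
    then show "(a(v := i)) x \<noteq> (a(v := i)) y"
    proof cases
      case 1 then show ?thesis using nv[of y] xy by auto
    next
      case 2 then show ?thesis using nv[of x] sym[OF xy(3)] xy(4) by auto
    next
      case 3 then show ?thesis using a(2) xy by simp
    qed
  qed
qed

lemma ball_sym: "y \<in> ball E r x \<Longrightarrow> x \<in> ball E r y"
proof -
  have "(adjp E ^^ n) y x" if "(adjp E ^^ n) x y" for n
    using that
  proof (induction n arbitrary: y)
    case (Suc n)
    then obtain z where "(adjp E ^^ n) x z" "adjp E z y" by auto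
    then have "(adjp E ^^ n) z x" by (intro Suc.IH)
    moreover have "adjp E y z" using \<open>adjp E z y\<close> by (simp add: adjp_def insert_commute)
    ultimately show ?case by (rule relpowp_Suc_I2[rotated])
  qed simp
  then show "y \<in> ball E r x \<Longrightarrow> x \<in> ball E r y" unfolding ball_def by auto
qed

text \<open>A proper colouring of the R-th power of the graph. The number of colours depends on D
  and R alone, which makes it usable for a whole sequence of graphs.\<close>

lemma ball_coloring:
  assumes G: "fin_graph D V E"
  obtains a :: "'a \<Rightarrow> nat" where "\<And>x. x \<in> V \<Longrightarrow> a x < Suc (Suc D ^ R)"
    "\<And>x y. x \<in> V \<Longrightarrow> y \<in> ball E R x \<Longrightarrow> a x = a y \<Longrightarrow> x = y"
proof -
  have V: "finite V" "edges_in V E" "bounded_degree V E D" using G unfolding fin_graph_def by auto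
  have card: "card {y \<in> V. y \<in> ball E R x} \<le> Suc D ^ R" if "x \<in> V" for x
  proof -
    have "{y \<in> V. y \<in> ball E R x} \<subseteq> ball E R x" by blast
    from card_mono[OF finite_card_ball(1)[OF V(2,3) that] this]
    show ?thesis using finite_card_ball(2)[OF V(2,3) that, of R] by (rule order_trans)
  qed
  have "\<exists>a :: 'a \<Rightarrow> nat. (\<forall>x\<in>V. a x \<le> Suc D ^ R) \<and> (\<forall>x\<in>V. \<forall>y\<in>V. y \<in> ball E R x \<longrightarrow> x \<noteq> y \<longrightarrow> a x \<noteq> a y)"
    by (rule greedy_coloring[OF V(1) ball_sym card])
  then obtain a :: "'a \<Rightarrow> nat" where a: "\<forall>x\<in>V. a x \<le> Suc D ^ R" "\<forall>x\<in>V. \<forall>y\<in>V. y \<in> ball E R x \<longrightarrow> x \<noteq> y \<longrightarrow> a x \<noteq> a y"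
    by (elim exE conjE)
  show thesis
  proof (rule that[of a])
    show "a x < Suc (Suc D ^ R)" if "x \<in> V" for x using a(1) that by (simp add: less_Suc_eq_le)
    show "x = y" if "x \<in> V" "y \<in> ball E R x" "a x = a y" for x y
      using a(2) that ball_subset[OF V(2) that(1), of R] by blast
  qed
qed

section \<open>Encoding edge colourings by vertex colourings\<close>

text \<open>A vertex colour codes a label of the vertex together with a table that assigns to each label
  the colour of the edge leading to the neighbour with that label.\<close>

definition vlabel :: "nat \<Rightarrow> nat" where "vlabel c = fst (from_nat c :: nat \<times> nat list)"
definition vtable :: "nat \<Rightarrow> nat \<Rightarrow> nat" where
  "vtable c i = (let l = snd (from_nat c :: nat \<times> nat list) in if i < length l then l ! i else 0)"

text \<open>In a genuine encoding the two table entries agree. The maximum makes the rule symmetric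
  for arbitrary colourings, and for k > 0 the cut at k - 1 makes every result an edge colour; both
  matter for colourings that are obtained only by approximation.\<close>

definition decode :: "nat \<Rightarrow> nat \<Rightarrow> nat \<Rightarrow> nat" where
  "decode k c c' = min (max (vtable c (vlabel c')) (vtable c' (vlabel c))) (k - 1)"

definition decode_in :: "nat \<Rightarrow> nat set \<Rightarrow> nat \<Rightarrow> nat \<Rightarrow> bool" where
  "decode_in k S c c' \<longleftrightarrow> decode k c c' \<in> S"

lemma decode_commute: "decode k c c' = decode k c' c"
  unfolding decode_def by (simp add: max.commute)

lemma symp_decode_in: "symp (decode_in k S)"
  unfolding symp_def decode_in_def using decode_commute by metis

text \<open>The default k is not an edge colour. \<open>LEAST\<close> makes the entry total when no
  neighbour carries the label, and definite when several do.\<close>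

definition edge_entry :: "nat \<Rightarrow> 'a set set \<Rightarrow> ('a set \<Rightarrow> nat) \<Rightarrow> ('a \<Rightarrow> nat) \<Rightarrow> 'a \<Rightarrow> nat \<Rightarrow> nat" where
  "edge_entry k E F a x i = (LEAST j. j = k \<or> (\<exists>y. {x, y} \<in> E \<and> a y = i \<and> F {x, y} = j))"

definition encode :: "nat \<Rightarrow> nat \<Rightarrow> 'a set set \<Rightarrow> ('a set \<Rightarrow> nat) \<Rightarrow> ('a \<Rightarrow> nat) \<Rightarrow> 'a \<Rightarrow> nat" where
  "encode k m E F a x = to_nat (a x, map (edge_entry k E F a x) [0..<m])"

text \<open>A number above all codes built from m labels and entries up to k; being independent of
  the graph, it fixes one number of colours for the whole sequence.\<close>

definition code_bound :: "nat \<Rightarrow> nat \<Rightarrow> nat" where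
  "code_bound k m = Suc (Max (to_nat ` ({..<m} \<times> {l. set l \<subseteq> {..k} \<and> length l = m})))"

lemma edge_entry_le: "edge_entry k E F a x i \<le> k"
  unfolding edge_entry_def by (rule Least_le) simp

lemma encode_less:
  assumes "a x < m" shows "encode k m E F a x < code_bound k m"
proof -
  have "finite (to_nat ` ({..<m} \<times> {l :: nat list. set l \<subseteq> {..k} \<and> length l = m}))"
    by (intro finite_imageI finite_cartesian_product finite_lists_length_eq) auto
  moreover have "encode k m E F a x \<in> to_nat ` ({..<m} \<times> {l :: nat list. set l \<subseteq> {..k} \<and> length l = m})"
    unfolding encode_def using assms edge_entry_le[of k E F a x] by (intro imageI) auto
  ultimately show ?thesis unfolding code_bound_def by (simp add: less_Suc_eq_le)
qed

text \<open>Distinct labels are required only around y and z, so the lemma also works at those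
  points of a graphing where the labels happen to separate.\<close>

lemma decode_encode:
  assumes yz: "{y, z} \<in> E" and k: "F {y, z} < k" and a: "a y < m" "a z < m"
    and inj: "\<And>w. {y, w} \<in> E \<Longrightarrow> a w = a z \<Longrightarrow> w = z" "\<And>w. {z, w} \<in> E \<Longrightarrow> a w = a y \<Longrightarrow> w = y"
  shows "decode k (encode k m E F a y) (encode k m E F a z) = F {y, z}"
proof -
  have entry: "edge_entry k E F a y (a z) = F {y, z}"
    if "{y, z} \<in> E" "\<And>w. {y, w} \<in> E \<Longrightarrow> a w = a z \<Longrightarrow> w = z" "F {y, z} < k" for y z
    unfolding edge_entry_def by (rule Least_equality) (use that in auto)
  have "edge_entry k E F a y (a z) = F {y, z}" "edge_entry k E F a z (a y) = F {y, z}"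
    using entry[of y z] entry[of z y] yz k inj by (auto simp: insert_commute)
  then show ?thesis using a k unfolding decode_def encode_def vtable_def vlabel_def by simp
qed

definition decoded :: "nat \<Rightarrow> ('a \<Rightarrow> nat) \<Rightarrow> 'a set \<Rightarrow> nat" where
  "decoded k c e = (THE j. \<exists>u v. e = {u, v} \<and> j = decode k (c u) (c v))"

lemma decoded_doubleton: "decoded k c {u, v} = decode k (c u) (c v)"
  unfolding decoded_def by (rule the_equality) (auto simp: doubleton_eq_iff decode_commute)

lemma decoded_less:
  assumes "edges_in J E" "e \<in> E" "k \<ge> 1" shows "decoded k c e < k"
proof -
  obtain u v where "e = {u, v}" using assms unfolding edges_in_def by blast
  then show ?thesis using assms(3) by (simp add: decoded_doubleton decode_def)
qed

text \<open>Unions of decoded colour classes are edge filters, the form to which the comparison of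
  ball statistics applies.\<close>

lemma decoded_filter:
  assumes "edges_in J E"
  shows "{e \<in> E. decoded k c e \<in> S} = edge_filter (decode_in k S) E c"
proof -
  have "decoded k c e \<in> S \<longleftrightarrow> (\<exists>u v. e = {u, v} \<and> decode_in k S (c u) (c v))" if e: "e \<in> E" for e
  proof -
    obtain x y where "e = {x, y}" using assms e unfolding edges_in_def by blast
    then show ?thesis unfolding decode_in_def using decoded_doubleton by metis
  qed
  then show ?thesis unfolding edge_filter_def by auto
qed

lemma edge_borel_edge_filter:
  assumes E: "edge_borel M E" and c: "borel_coloring M K c" and \<delta>: "symp \<delta>"
  shows "edge_borel M (edge_filter \<delta> E c)"
proof -
  note borel_coloring_measurable[OF c, measurable]
  let ?A = "{(x, y). x \<in> space M \<and> y \<in> space M \<and> {x, y} \<in> E}"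
  have [measurable]: "?A \<in> sets (M \<Otimes>\<^sub>M M)" using E unfolding edge_borel_def .
  have "{(x, y). x \<in> space M \<and> y \<in> space M \<and> {x, y} \<in> edge_filter \<delta> E c} =
      {p \<in> space (M \<Otimes>\<^sub>M M). p \<in> ?A \<and> (\<exists>i j. c (fst p) = i \<and> c (snd p) = j \<and> \<delta> i j)}"
    unfolding doubleton_in_edge_filter[OF \<delta>] by (auto simp: space_pair_measure)
  also have "\<dots> \<in> sets (M \<Otimes>\<^sub>M M)" by measurable
  finally show ?thesis unfolding edge_borel_def .
qed

section \<open>Closeness of local statistics and Borel edge colourings\<close>

definition loc_close :: "nat \<Rightarrow> real \<Rightarrow> 'a graphing \<Rightarrow> 'b graphing \<Rightarrow> bool" where
  "loc_close r \<epsilon> H H' \<longleftrightarrow> (\<forall>q\<in>{1..r}. \<forall>\<alpha>. rooted_graph q \<alpha> \<longrightarrow> \<bar>P_loc H q \<alpha> - P_loc H' q \<alpha>\<bar> \<le> \<epsilon>)"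

lemma loc_close_sym: "loc_close r \<epsilon> H H' \<Longrightarrow> loc_close r \<epsilon> H' H"
  unfolding loc_close_def by (metis abs_minus_commute)

lemma loc_close_trans:
  "loc_close r \<epsilon> H H' \<Longrightarrow> loc_close r \<epsilon>' H' H'' \<Longrightarrow> loc_close r (\<epsilon> + \<epsilon>') H H''"
  unfolding loc_close_def by (smt (verit))

lemma loc_close_mono: "loc_close r \<epsilon> H H' \<Longrightarrow> r' \<le> r \<Longrightarrow> \<epsilon> \<le> \<epsilon>' \<Longrightarrow> loc_close r' \<epsilon>' H H'"
  unfolding loc_close_def by force

lemma hausd_lessD:
  assumes "hausd d A B < \<epsilon>"
  shows "a \<in> A \<Longrightarrow> \<exists>b\<in>B. d a b < \<epsilon>" "b \<in> B \<Longrightarrow> \<exists>a\<in>A. d a b < \<epsilon>"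
proof -
  have 1: "(SUP a\<in>A. INF b\<in>B. d a b) < \<epsilon>" "(SUP b\<in>B. INF a\<in>A. d a b) < \<epsilon>" using assms unfolding hausd_def by auto
  show "\<exists>b\<in>B. d a b < \<epsilon>" if "a \<in> A"
  proof -
    have "(INF b\<in>B. d a b) < \<epsilon>" using that by (intro le_less_trans[OF _ 1(1)] SUP_upper)
    then show ?thesis unfolding INF_less_iff .
  qed
  show "\<exists>a\<in>A. d a b < \<epsilon>" if "b \<in> B"
  proof -
    have "(INF a\<in>A. d a b) < \<epsilon>" using that by (intro le_less_trans[OF _ 1(2)] SUP_upper)
    then show ?thesis unfolding INF_less_iff .
  qed
qed

lemma dist_distr_lessD:
  assumes "dist_distr r p q < ereal \<epsilon>" "rooted_graph r (fst \<beta>)"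
  shows "\<bar>p \<beta> - q \<beta>\<bar> \<le> \<epsilon>"
proof -
  have "ereal \<bar>p \<beta> - q \<beta>\<bar> \<le> dist_distr r p q" unfolding dist_distr_def using assms(2) by (intro SUP_upper) auto
  then have "ereal \<bar>p \<beta> - q \<beta>\<bar> < ereal \<epsilon>" using assms(1) by (rule le_less_trans)
  then show ?thesis by simp
qed

text \<open>The condition that \<open>quotients\<close> puts on an edge map, for the Borel edge
  sets.\<close>

definition graph_edge_coloring :: "nat \<Rightarrow> 'a graphing \<Rightarrow> ('a set \<Rightarrow> nat) \<Rightarrow> bool" where
  "graph_edge_coloring k H F \<longleftrightarrow> (\<forall>e\<in>snd H. F e < k) \<and> (\<forall>i<k. {e \<in> snd H. F e = i} \<in> borel_edge_subsets H)"

lemma graph_edge_coloring_decoded: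
  assumes G: "graphing (M, E)" and c: "borel_coloring M K c" and k: "k \<ge> 1"
  shows "graph_edge_coloring k (M, E) (decoded k c)"
proof -
  have E: "edges_in (space M) E" "edge_borel M E" using G unfolding graphing_def by (auto simp: Let_def)
  have "{e \<in> E. decoded k c e = i} \<in> borel_edge_subsets (M, E)" for i
    using decoded_filter[OF E(1), of k c "{i}"] edge_borel_edge_filter[OF E(2) c symp_decode_in[of k "{i}"]]
    unfolding borel_edge_subsets_def by auto
  then show ?thesis unfolding graph_edge_coloring_def using decoded_less[OF E(1) _ k] by auto
qed

lemma borel_edge_subset_preimage:
  assumes F: "graph_edge_coloring k (M, E) F"
  shows "edge_borel M {e \<in> E. F e \<in> S}"
proof -
  have "{(x, y). x \<in> space M \<and> y \<in> space M \<and> {x, y} \<in> {e \<in> E. F e \<in> S}} =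
      (\<Union>i\<in>S \<inter> {..<k}. {(x, y). x \<in> space M \<and> y \<in> space M \<and> {x, y} \<in> {e \<in> E. F e = i}})"
    using F unfolding graph_edge_coloring_def by auto
  also have "\<dots> \<in> sets (M \<Otimes>\<^sub>M M)"
    using F unfolding graph_edge_coloring_def borel_edge_subsets_def edge_borel_def
    by (intro sets.countable_UN') auto
  finally show ?thesis unfolding edge_borel_def .
qed

text \<open>A table entry asks for a neighbour with given label and edge colour. The arcs to such
  neighbours form a Borel set with bounded sections, so its projection is Borel.\<close>

lemma borel_coloring_encode:
  assumes G: "graphing (M, E)" and F: "graph_edge_coloring k (M, E) F"
    and a: "a \<in> measurable M (count_space UNIV)" "\<And>x. x \<in> space M \<Longrightarrow> a x < m"
  shows "borel_coloring M (code_bound k m) (encode k m E F a)"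
proof -
  obtain D where "borel_graph M E D" using graphing_imp_borel_graph[OF G] ..
  then interpret borel_graph M E D .
  note a(1)[measurable]
  have [measurable]: "Measurable.pred M (\<lambda>x. \<exists>y. {x, y} \<in> E \<and> a y = i \<and> F {x, y} = j)" for i j
  proof -
    have eb: "edge_borel M {e \<in> E. F e \<in> {j}}" by (rule borel_edge_subset_preimage[OF F])
    have "{y \<in> space M. a y = i} \<in> sets M" by measurable
    then have "space M \<times> {y \<in> space M. a y = i} \<in> sets (M \<Otimes>\<^sub>M M)" by auto
    then have "fst ` ({(x, y). x \<in> space M \<and> y \<in> space M \<and> {x, y} \<in> {e \<in> E. F e \<in> {j}}} \<inter> space M \<times> {y \<in> space M. a y = i}) \<in> sets M"
      (is "fst ` ?A \<in> _")
      using eb unfolding edge_borel_def by (intro sets_fst_arcs) (auto simp: arcs_def)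
    moreover have "fst ` ?A = {x \<in> space M. \<exists>y. {x, y} \<in> E \<and> a y = i \<and> F {x, y} = j}"
    proof (intro set_eqI iffI)
      fix x assume "x \<in> {x \<in> space M. \<exists>y. {x, y} \<in> E \<and> a y = i \<and> F {x, y} = j}"
      then obtain y where y: "x \<in> space M" "{x, y} \<in> E" "a y = i" "F {x, y} = j" by auto
      then have "(x, y) \<in> ?A" using edges_inD(2)[OF edges y(2)] by simp
      from imageI[OF this, of fst] show "x \<in> fst ` ?A" by (simp only: fst_conv)
    qed auto
    ultimately show ?thesis by (simp add: pred_def)
  qed
  have entry [measurable]: "(\<lambda>x. edge_entry k E F a x i) \<in> measurable M (count_space UNIV)" for i
    unfolding edge_entry_def by measurable
  have "{x \<in> space M. encode k m E F a x = v} \<in> sets M" for v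
  proof -
    obtain i l where il: "(from_nat v :: nat \<times> nat list) = (i, l)" by fastforce
    have "encode k m E F a x = v \<longleftrightarrow> to_nat (i, l) = v \<and> length l = m \<and> a x = i \<and> (\<forall>j<m. edge_entry k E F a x j = l ! j)" for x
    proof
      assume e: "encode k m E F a x = v"
      then have "(i, l) = (a x, map (edge_entry k E F a x) [0..<m])"
        using il unfolding encode_def by (metis from_nat_to_nat)
      then show "to_nat (i, l) = v \<and> length l = m \<and> a x = i \<and> (\<forall>j<m. edge_entry k E F a x j = l ! j)"
        using e unfolding encode_def by auto
    next
      assume r: "to_nat (i, l) = v \<and> length l = m \<and> a x = i \<and> (\<forall>j<m. edge_entry k E F a x j = l ! j)"
      then have "map (edge_entry k E F a x) [0..<m] = l" by (intro nth_equalityI) auto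
      then show "encode k m E F a x = v" using r unfolding encode_def by auto
    qed
    then show ?thesis by simp
  qed
  then show ?thesis unfolding borel_coloring_def using encode_less[of a _ m k E F] a(2) by auto
qed

section \<open>Transfer of edge colourings between the finite graphs and the limit\<close>

locale loc_glob_sequence =
  fixes D :: nat and V :: "nat \<Rightarrow> 'a set" and EG :: "nat \<Rightarrow> 'a set set" and M :: "'a measure" and E :: "'a set set"
  assumes fin: "\<And>n. fin_graph D (V n) (EG n)" and G: "graphing (M, E)"
    and conv: "local_global_conv (\<lambda>n. as_graphing (V n) (EG n)) (M, E)"
begin

lemma eventually_hausd:
  assumes "k \<ge> 1" "r \<ge> 1" "\<epsilon> > 0"
  shows "\<forall>\<^sub>F n in sequentially. hausd (dist_distr r) (Q_kr k r (as_graphing (V n) (EG n))) (Q_kr k r (M, E)) < ereal \<epsilon>"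
  using conv assms unfolding local_global_conv_def by (intro order_tendstoD(2)[of _ 0]) auto

text \<open>The bound D belongs to the finite graphs and the limit brings its own; the list of ball
  types needs one bound for both.\<close>

lemma common_degree: "\<exists>D'. bounded_degree (space M) E D' \<and> (\<forall>n. bounded_degree (V n) (EG n) D')"
proof -
  obtain D1 where "bounded_degree (space M) E D1" using G unfolding graphing_def by (auto simp: Let_def)
  moreover have "bounded_degree (V n) (EG n) D" for n using fin unfolding fin_graph_def by auto
  ultimately show ?thesis using bounded_degree_mono[OF _ max.cobounded1] bounded_degree_mono[OF _ max.cobounded2] by blast
qed

lemma space_as_graphing: "space (uniform_count_measure (V n)) = V n"
  by (simp add: space_uniform_count_measure)

lemma graphing_n: "graphing (uniform_count_measure (V n), EG n)"
  using graphing_finite[OF fin[of n]] unfolding as_graphing_def .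

text \<open>The index n is found before F is chosen, because the encoding uses a number of vertex
  colours fixed by k and D. One F' serves all S, since each S is just another rule applied to the
  same pairs of vertex colours.\<close>

lemma edge_coloring_to_limit:
  assumes k: "k \<ge> 1" and r: "r \<ge> 1" and \<epsilon>: "\<epsilon> > 0"
  shows "\<forall>\<^sub>F n in sequentially. \<forall>F. (\<forall>e\<in>EG n. F e < k) \<longrightarrow>
    (\<exists>F'. graph_edge_coloring k (M, E) F' \<and>
      (\<forall>S. loc_close r \<epsilon> (as_graphing (V n) {e \<in> EG n. F e \<in> S}) (M, {e \<in> E. F' e \<in> S})))"
proof -
  obtain D' where D': "bounded_degree (space M) E D'" "\<And>n. bounded_degree (V n) (EG n) D'" using common_degree by auto
  \<comment> \<open>Two neighbours of a vertex are at distance at most 2, so labels that differ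
    within distance 2 distinguish the neighbours of each vertex; this is the number of colours that
    \<open>ball_coloring\<close> gives for radius 2.\<close>
  define m where "m = Suc (Suc D ^ 2)"
  define K where "K = code_bound k m"
  define L where "L = real (card (ball_types D' K r))"
  have K1: "K \<ge> 1" unfolding K_def code_bound_def by simp
  \<comment> \<open>Errors of up to L types add up, and L + 1 keeps the denominator
    positive.\<close>
  have eps: "\<epsilon> / (L + 1) > 0" using \<epsilon> by (simp add: L_def add_nonneg_pos)
  have Leps: "L * (\<epsilon> / (L + 1)) \<le> \<epsilon>" using \<epsilon> by (simp add: L_def field_simps)
  show ?thesis
    using eventually_hausd[OF K1 r eps]
  proof (eventually_elim, intro allI impI)
    fix n F
    assume H: "hausd (dist_distr r) (Q_kr K r (as_graphing (V n) (EG n))) (Q_kr K r (M, E)) < ereal (\<epsilon> / (L + 1))"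
      and F: "\<forall>e\<in>EG n. F e < k"
    let ?M = "uniform_count_measure (V n)"
    have En: "edges_in (V n) (EG n)" using fin[of n] unfolding fin_graph_def by auto
    obtain a where a: "\<And>x. x \<in> V n \<Longrightarrow> a x < m" "\<And>x y. x \<in> V n \<Longrightarrow> y \<in> ball (EG n) 2 x \<Longrightarrow> a x = a y \<Longrightarrow> x = y"
      using ball_coloring[OF fin[of n], of 2] unfolding m_def by metis
    define c where "c = encode k m (EG n) F a"
    have c: "borel_coloring ?M K c"
      unfolding borel_coloring_def c_def K_def using encode_less[of a _ m k "EG n" F] a(1)
      by (auto simp: space_as_graphing sets_uniform_count_measure)
    have inj: "w = z" if "{y, w} \<in> EG n" "{y, z} \<in> EG n" "a w = a z" for y z w
    proof -
      have "z \<in> ball (EG n) 2 w" unfolding numeral_2_eq_2 ball_Suc using that by (auto simp: insert_commute)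
      then show ?thesis using a(2)[of w z] that edges_inD(2)[OF En] by blast
    qed
    have dec: "decoded k c e = F e" if e: "e \<in> EG n" for e
    proof -
      obtain y z where yz: "e = {y, z}" using En e unfolding edges_in_def by blast
      have "decode k (encode k m (EG n) F a y) (encode k m (EG n) F a z) = F {y, z}"
        by (rule decode_encode) (use e yz F a(1) edges_inD[OF En, of y z] inj[of y _ z] inj[of z _ y] in \<open>auto simp: insert_commute\<close>)
      then show ?thesis unfolding yz decoded_doubleton c_def .
    qed
    have "P_col (as_graphing (V n) (EG n)) r c \<in> Q_kr K r (as_graphing (V n) (EG n))"
      unfolding Q_kr_def as_graphing_def using c by auto
    from hausd_lessD(1)[OF H this] obtain c' where c': "borel_coloring M K c'"
      "dist_distr r (P_col (as_graphing (V n) (EG n)) r c) (P_col (M, E) r c') < ereal (\<epsilon> / (L + 1))"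
      unfolding Q_kr_def by auto
    have "loc_close r \<epsilon> (as_graphing (V n) {e \<in> EG n. F e \<in> S}) (M, {e \<in> E. decoded k c' e \<in> S})" for S
    proof -
      have "{e \<in> EG n. F e \<in> S} = {e \<in> EG n. decoded k c e \<in> S}" using dec by auto
      also have "\<dots> = edge_filter (decode_in k S) (EG n) c" by (rule decoded_filter[OF En])
      finally have 1: "{e \<in> EG n. F e \<in> S} = edge_filter (decode_in k S) (EG n) c" .
      have 2: "{e \<in> E. decoded k c' e \<in> S} = edge_filter (decode_in k S) E c'"
        using G unfolding graphing_def by (intro decoded_filter) (auto simp: Let_def)
      show ?thesis unfolding loc_close_def 1 2 as_graphing_def
      proof (intro ballI allI impI)
        fix q \<alpha> assume q: "q \<in> {1..r}" "rooted_graph q \<alpha>"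
        have "\<bar>P_loc (?M, edge_filter (decode_in k S) (EG n) c) q \<alpha> - P_loc (M, edge_filter (decode_in k S) E c') q \<alpha>\<bar>
            \<le> real (card (ball_types D' K r)) * (\<epsilon> / (L + 1))"
          by (rule P_loc_edge_filter_close[OF symp_decode_in _ q(2) graphing_n _ c G D'(1) c'(1)])
            (use q D'(2) dist_distr_lessD[OF c'(2)] in \<open>auto simp: space_as_graphing as_graphing_def\<close>)
        then show "\<bar>P_loc (?M, edge_filter (decode_in k S) (EG n) c) q \<alpha> - P_loc (M, edge_filter (decode_in k S) E c') q \<alpha>\<bar> \<le> \<epsilon>"
          using Leps unfolding L_def by simp
      qed
    qed
    then show "\<exists>F'. graph_edge_coloring k (M, E) F' \<and>
      (\<forall>S. loc_close r \<epsilon> (as_graphing (V n) {e \<in> EG n. F e \<in> S}) (M, {e \<in> E. F' e \<in> S}))"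
      using graph_edge_coloring_decoded[OF G c'(1) k] by blast
  qed
qed

text \<open>The points whose ball is separated by the first n sets form increasing Borel sets, and
  these exhaust the space because each ball is finite; continuity of the measure makes the
  exceptional set small for large n.\<close>

lemma separating_labels:
  assumes \<epsilon>: "\<epsilon> > 0"
  obtains a :: "'a \<Rightarrow> nat" and m X where "a \<in> measurable M (count_space UNIV)" "\<And>x. x \<in> space M \<Longrightarrow> a x < m"
    "X \<in> sets M" "measure M (space M - X) < \<epsilon>"
    "\<And>x y z. x \<in> X \<Longrightarrow> y \<in> ball E r x \<Longrightarrow> z \<in> ball E r x \<Longrightarrow> a y = a z \<Longrightarrow> y = z"
proof -
  obtain D' where "borel_graph M E D'" using graphing_imp_borel_graph[OF G] ..
  then interpret borel_graph M E D' .
  interpret prob_space M using G unfolding graphing_def by (simp add: Let_def)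
  obtain B :: "nat \<Rightarrow> 'a set" where B [measurable]: "\<And>i. B i \<in> sets M"
    and Bsep: "\<And>x y. x \<in> space M \<Longrightarrow> y \<in> space M \<Longrightarrow> x \<noteq> y \<Longrightarrow> \<exists>i. x \<in> B i \<longleftrightarrow> y \<notin> B i"
    by (rule standard_borel_separating[OF standard]) blast
  obtain g :: "nat \<Rightarrow> 'a \<Rightarrow> 'a" where g [measurable]: "\<And>i. g i \<in> measurable M M"
    and gr: "\<And>x. x \<in> space M \<Longrightarrow> range (\<lambda>i. g i x) = ball E r x"
    using ball_enumeration[of r] by blast
  have eqm [measurable]: "Measurable.pred M (\<lambda>x. g i x = g j x)" for i j
    using sets_Collect_eq_standard_borel[OF standard g g] by (simp add: pred_def)
  \<comment> \<open>Quantifying over enumeration indices instead of points of the ball keeps the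
    condition countable, hence Borel.\<close>
  define X where "X n = {x \<in> space M. \<forall>i j. (\<forall>l<n. g i x \<in> B l \<longleftrightarrow> g j x \<in> B l) \<longrightarrow> g i x = g j x}" for n
  have X: "X n \<in> sets M" for n unfolding X_def by measurable
  have "incseq X"
  proof (rule incseq_SucI, rule subsetI)
    fix n x assume "x \<in> X n"
    then show "x \<in> X (Suc n)" unfolding X_def by (simp add: less_Suc_eq)
  qed
  moreover have "(\<Union>n. X n) = space M"
  proof
    show "space M \<subseteq> (\<Union>n. X n)"
    proof
      fix x assume x: "x \<in> space M"
      let ?P = "ball E r x \<times> ball E r x"
      have fin: "finite ?P" using finite_card_ball(1)[OF edges degree x] by auto
      have "\<forall>p. \<exists>i. p \<in> ?P \<and> fst p \<noteq> snd p \<longrightarrow> (fst p \<in> B i \<longleftrightarrow> snd p \<notin> B i)"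
        using Bsep ball_subset[OF edges x, of r] by (metis mem_Times_iff subsetD)
      then obtain s where s: "\<And>p. p \<in> ?P \<Longrightarrow> fst p \<noteq> snd p \<Longrightarrow> fst p \<in> B (s p) \<longleftrightarrow> snd p \<notin> B (s p)" by metis
      define n where "n = Suc (Max (s ` ?P))"
      have n: "s p < n" if "p \<in> ?P" for p unfolding n_def using fin that by (auto simp: less_Suc_eq_le)
      have "g i x = g j x" if "\<forall>l<n. g i x \<in> B l \<longleftrightarrow> g j x \<in> B l" for i j
      proof (rule ccontr)
        assume "g i x \<noteq> g j x"
        moreover have "(g i x, g j x) \<in> ?P" using gr[OF x] by auto
        ultimately show False using s[of "(g i x, g j x)"] n[of "(g i x, g j x)"] that by auto
      qed
      then have "x \<in> X n" unfolding X_def using x by blast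
      then show "x \<in> (\<Union>n. X n)" by blast
    qed
  qed (auto simp: X_def)
  ultimately have "(\<lambda>n. measure M (X n)) \<longlonglongrightarrow> measure M (space M)"
    using finite_Lim_measure_incseq[of X] X by auto
  then have "\<forall>\<^sub>F n in sequentially. measure M (X n) > 1 - \<epsilon>"
    using \<epsilon> prob_space by (intro order_tendstoD(1)) auto
  then obtain n where n: "measure M (X n) > 1 - \<epsilon>" by (auto simp: eventually_sequentially)
  define a where "a y = to_nat (map (\<lambda>i. y \<in> B i) [0..<n])" for y
  have fin: "finite (to_nat ` {l :: bool list. set l \<subseteq> UNIV \<and> length l = n})"
    by (intro finite_imageI finite_lists_length_eq) auto
  have "a y < Suc (Max (to_nat ` {l :: bool list. set l \<subseteq> UNIV \<and> length l = n}))" for y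
    unfolding less_Suc_eq_le by (rule Max_ge[OF fin]) (auto simp: a_def)
  moreover have "a \<in> measurable M (count_space UNIV)"
  proof (subst measurable_count_space_eq2_countable, intro conjI ballI)
    fix v
    obtain l where l: "(from_nat v :: bool list) = l" by blast
    have "a y = v \<longleftrightarrow> to_nat l = v \<and> length l = n \<and> (\<forall>i<n. y \<in> B i \<longleftrightarrow> l ! i)" for y
    proof
      assume e: "a y = v"
      then have "l = map (\<lambda>i. y \<in> B i) [0..<n]" using l unfolding a_def by (metis from_nat_to_nat)
      then show "to_nat l = v \<and> length l = n \<and> (\<forall>i<n. y \<in> B i \<longleftrightarrow> l ! i)" using e unfolding a_def by auto
    next
      assume r: "to_nat l = v \<and> length l = n \<and> (\<forall>i<n. y \<in> B i \<longleftrightarrow> l ! i)"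
      then have "map (\<lambda>i. y \<in> B i) [0..<n] = l" by (intro nth_equalityI) auto
      then show "a y = v" using r unfolding a_def by auto
    qed
    then have "a -` {v} \<inter> space M = {y \<in> space M. to_nat l = v \<and> length l = n \<and> (\<forall>i<n. y \<in> B i \<longleftrightarrow> l ! i)}" by auto
    also have "\<dots> \<in> sets M" by measurable
    finally show "a -` {v} \<inter> space M \<in> sets M" .
  qed auto
  moreover have "measure M (space M - X n) < \<epsilon>" using n prob_compl[OF X[of n]] by simp
  moreover have "y = z" if xyz: "x \<in> X n" "y \<in> ball E r x" "z \<in> ball E r x" "a y = a z" for x y z
  proof -
    have x: "x \<in> space M" using xyz(1) by (simp add: X_def)
    obtain i j where ij: "y = g i x" "z = g j x" using xyz(2,3) unfolding gr[OF x, symmetric] by auto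
    have "\<forall>l<n. y \<in> B l \<longleftrightarrow> z \<in> B l" using xyz(4) unfolding a_def by auto
    then show ?thesis using xyz(1) unfolding X_def ij by blast
  qed
  ultimately show thesis using that X by blast
qed

lemma edge_coloring_from_limit:
  assumes k: "k \<ge> 1" and r: "r \<ge> 1" and \<epsilon>: "\<epsilon> > 0"
  shows "\<forall>\<^sub>F n in sequentially. \<forall>F. graph_edge_coloring k (M, E) F \<longrightarrow>
    (\<exists>F'. (\<forall>e\<in>EG n. F' e < k) \<and>
      (\<forall>S. loc_close r \<epsilon> (as_graphing (V n) {e \<in> EG n. F' e \<in> S}) (M, {e \<in> E. F e \<in> S})))"
proof -
  obtain D' where D': "bounded_degree (space M) E D'" "\<And>n. bounded_degree (V n) (EG n) D'" using common_degree by auto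
  have EM: "edges_in (space M) E" "edge_borel M E" using G unfolding graphing_def by (auto simp: Let_def)
  \<comment> \<open>One half pays for points with bad labels, the other for the transfer. The labels
    separate balls of radius r + 1, because decoding an edge of the r-ball compares all neighbours
    of its ends.\<close>
  have "\<epsilon> / 2 > 0" using \<epsilon> by simp
  then obtain a :: "'a \<Rightarrow> nat" and m X where a: "a \<in> measurable M (count_space UNIV)" "\<And>x. x \<in> space M \<Longrightarrow> a x < m"
    and X: "X \<in> sets M" "measure M (space M - X) < \<epsilon> / 2"
    and inj: "\<And>x y z. x \<in> X \<Longrightarrow> y \<in> ball E (Suc r) x \<Longrightarrow> z \<in> ball E (Suc r) x \<Longrightarrow> a y = a z \<Longrightarrow> y = z"
    by (rule separating_labels[where r="Suc r"]) blast
  define K where "K = code_bound k m"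
  define L where "L = real (card (ball_types D' K r))"
  have K1: "K \<ge> 1" unfolding K_def code_bound_def by simp
  have eps: "\<epsilon> / 2 / (L + 1) > 0" using \<epsilon> by (simp add: L_def add_nonneg_pos)
  have Leps: "L * (\<epsilon> / 2 / (L + 1)) \<le> \<epsilon> / 2" using \<epsilon> by (simp add: L_def field_simps)
  show ?thesis
    using eventually_hausd[OF K1 r eps]
  proof (eventually_elim, intro allI impI)
    fix n F
    assume H: "hausd (dist_distr r) (Q_kr K r (as_graphing (V n) (EG n))) (Q_kr K r (M, E)) < ereal (\<epsilon> / 2 / (L + 1))"
      and F: "graph_edge_coloring k (M, E) F"
    let ?M = "uniform_count_measure (V n)"
    have En: "edges_in (V n) (EG n)" using fin[of n] unfolding fin_graph_def by auto
    define c where "c = encode k m E F a"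
    have c: "borel_coloring M K c" unfolding c_def K_def by (rule borel_coloring_encode[OF G F a])
    have "P_col (M, E) r c \<in> Q_kr K r (M, E)" unfolding Q_kr_def using c by auto
    from hausd_lessD(2)[OF H this] obtain c' where c': "borel_coloring ?M K c'"
      "dist_distr r (P_col (as_graphing (V n) (EG n)) r c') (P_col (M, E) r c) < ereal (\<epsilon> / 2 / (L + 1))"
      unfolding Q_kr_def as_graphing_def by auto
    have "loc_close r \<epsilon> (as_graphing (V n) {e \<in> EG n. decoded k c' e \<in> S}) (M, {e \<in> E. F e \<in> S})" for S
    proof -
      let ?F1 = "{e \<in> E. F e \<in> S}" and ?F2 = "edge_filter (decode_in k S) E c"
      have 1: "{e \<in> EG n. decoded k c' e \<in> S} = edge_filter (decode_in k S) (EG n) c'" by (rule decoded_filter[OF En])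
      have sub: "?F1 \<subseteq> E" "?F2 \<subseteq> E" by (auto simp: edge_filter_def)
      have std: "standard_borel M" using G unfolding graphing_def by (simp add: Let_def)
      interpret F1: borel_graph M ?F1 D'
        by (intro borel_graph.intro std edges_in_subset[OF EM(1) sub(1)] bounded_degree_subset[OF D'(1) sub(1)]
          borel_edge_subset_preimage[OF F])
      interpret F2: borel_graph M ?F2 D'
        by (intro borel_graph.intro std edges_in_subset[OF EM(1) sub(2)] bounded_degree_subset[OF D'(1) sub(2)]
          edge_borel_edge_filter[OF EM(2) c symp_decode_in])
      interpret prob_space M using G unfolding graphing_def by (simp add: Let_def)
      \<comment> \<open>Around a point of X decoding recovers F on every edge of the r-ball, so the
        two subgraphs have the same balls up to radius r. Elsewhere they may differ, at the price of
        the measure of the complement of X.\<close>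
      have eqv: "ball_eqv q ?F1 (\<lambda>_. 0) x ?F2 (\<lambda>_. 0) x" if x: "x \<in> X" and q: "q \<le> r" for x q
      proof -
        have adj: "{y, z} \<in> ?F1 \<longleftrightarrow> {y, z} \<in> ?F2" if yz: "y \<in> ball E r x" "z \<in> ball E r x" for y z
        proof (cases "{y, z} \<in> E")
          case True
          have nb: "w \<in> ball E (Suc r) x" if "{u, w} \<in> E" "u \<in> ball E r x" for u w
            unfolding ball_Suc using that by auto
          have yz': "y \<in> ball E (Suc r) x" "z \<in> ball E (Suc r) x" using yz ball_mono[of r "Suc r" E x] by auto
          have "decode k (encode k m E F a y) (encode k m E F a z) = F {y, z}"
            by (rule decode_encode[OF True])
              (use F True a(2) edges_inD[OF EM(1) True] inj[OF x nb[OF _ yz(1)] yz'(2)] inj[OF x nb[OF _ yz(2)] yz'(1)] in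
                \<open>auto simp: graph_edge_coloring_def\<close>)
          then show ?thesis using True unfolding doubleton_in_edge_filter[OF symp_decode_in] decode_in_def c_def by simp
        qed (use sub in auto)
        have "bij_betw (\<lambda>y. y) (ball ?F1 q x) (ball ?F2 q x)"
          by (rule bij_betw_ball[where X="ball E r x" and X'="ball E r x"])
            (use adj ball_subgraph[OF sub(1) q] ball_subgraph[OF sub(2) q] in \<open>auto simp: bij_betw_def\<close>)
        then show ?thesis unfolding ball_eqv_def using adj ball_subgraph[OF sub(1) q, of x]
          by (intro exI[of _ "\<lambda>y. y"]) blast
      qed
      show ?thesis unfolding loc_close_def 1
      proof (intro ballI allI impI)
        fix q \<alpha> assume q: "q \<in> {1..r}" "rooted_graph q \<alpha>"
        have A: "\<bar>P_loc (?M, edge_filter (decode_in k S) (EG n) c') q \<alpha> - P_loc (M, ?F2) q \<alpha>\<bar>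
            \<le> real (card (ball_types D' K r)) * (\<epsilon> / 2 / (L + 1))"
          by (rule P_loc_edge_filter_close[OF symp_decode_in _ q(2) graphing_n _ c'(1) G D'(1) c])
            (use q D'(2) dist_distr_lessD[OF c'(2)] in \<open>auto simp: space_as_graphing as_graphing_def\<close>)
        let ?A1 = "{x \<in> space M. ball_iso ?F1 q x \<alpha>}" and ?A2 = "{x \<in> space M. ball_iso ?F2 q x \<alpha>}"
        have XM: "X \<subseteq> space M" using sets.sets_into_space[OF X(1)] .
        have "ball_iso ?F1 q x \<alpha> \<longleftrightarrow> ball_iso ?F2 q x \<alpha>" if "x \<in> X" for x
          using ball_iso_cong[OF q(2) eqv[OF that]] q(1) by simp
        then have "?A1 \<subseteq> ?A2 \<union> (space M - X)" "?A2 \<subseteq> ?A1 \<union> (space M - X)" by auto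
        then have "measure M ?A1 \<le> measure M ?A2 + measure M (space M - X)" "measure M ?A2 \<le> measure M ?A1 + measure M (space M - X)"
          using X(1) F1.sets_ball_iso[of q \<alpha>] F2.sets_ball_iso[of q \<alpha>]
          by (meson finite_measure_mono measure_Un_le order_trans sets.Un sets.compl_sets)+
        then have "\<bar>P_loc (M, ?F2) q \<alpha> - P_loc (M, ?F1) q \<alpha>\<bar> \<le> \<epsilon> / 2" using X(2) unfolding P_loc_def fst_conv snd_conv by linarith
        then show "\<bar>P_loc (as_graphing (V n) (edge_filter (decode_in k S) (EG n) c')) q \<alpha> - P_loc (M, ?F1) q \<alpha>\<bar> \<le> \<epsilon>"
          using A Leps unfolding as_graphing_def L_def by linarith
      qed
    qed
    then show "\<exists>F'. (\<forall>e\<in>EG n. F' e < k) \<and>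
      (\<forall>S. loc_close r \<epsilon> (as_graphing (V n) {e \<in> EG n. F' e \<in> S}) (M, {e \<in> E. F e \<in> S}))"
      using decoded_less[OF En _ k] by blast
  qed
qed

end

section \<open>Limits of distributions on binary sequences\<close>

lemma pointwise_convergent_subsequence:
  fixes f :: "nat \<Rightarrow> 's::countable \<Rightarrow> real"
  assumes "\<And>j s. 0 \<le> f j s" "\<And>j s. f j s \<le> 1"
  obtains \<rho> q where "strict_mono \<rho>" "\<And>s. (\<lambda>j. f (\<rho> j) s) \<longlonglongrightarrow> q s"
proof -
  interpret subseqs "\<lambda>n \<rho>. convergent (\<lambda>j. f (\<rho> j) (from_nat n))"
  proof
    fix n :: nat and s :: "nat \<Rightarrow> nat" assume "strict_mono s"
    have "bounded (range (\<lambda>j. f (s j) (from_nat n)))"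
      unfolding bounded_iff using assms by (intro exI[of _ 1]) (auto simp: abs_of_nonneg)
    then obtain l r where "strict_mono r" "((\<lambda>j. f (s j) (from_nat n)) \<circ> r) \<longlonglongrightarrow> l"
      using bounded_imp_convergent_subsequence by blast
    then show "\<exists>r'. strict_mono r' \<and> convergent (\<lambda>j. f ((s \<circ> r') j) (from_nat n))"
      unfolding convergent_def o_def by blast
  qed
  have "convergent (\<lambda>j. f (diagseq j) (from_nat n))" for n
  proof -
    have "convergent (\<lambda>j. f ((diagseq \<circ> ((+) (Suc n))) j) (from_nat n))"
    proof (rule diagseq_holds)
      fix r s :: "nat \<Rightarrow> nat" and n :: nat
      assume "strict_mono r" "convergent (\<lambda>j. f (s j) (from_nat n))"
      then show "convergent (\<lambda>j. f ((s \<circ> r) j) (from_nat n))"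
        unfolding convergent_def using LIMSEQ_subseq_LIMSEQ[of "\<lambda>j. f (s j) (from_nat n)" _ r] by (auto simp: o_def)
    qed
    then have "convergent (\<lambda>j. f (diagseq (j + Suc n)) (from_nat n))" by (simp add: o_def add.commute)
    then show ?thesis using convergent_ignore_initial_segment[of "\<lambda>j. f (diagseq j) (from_nat n)" "Suc n"] by simp
  qed
  then have "convergent (\<lambda>j. f (diagseq j) s)" for s using from_nat_to_nat[of s] by metis
  then have "(\<lambda>j. f (diagseq j) s) \<longlonglongrightarrow> lim (\<lambda>j. f (diagseq j) s)" for s by (simp add: convergent_LIMSEQ_iff)
  then show thesis by (rule that[OF subseq_diagseq])
qed

text \<open>Bits are stored as reals, so that the ambient type of sequences supplies the product
  topology and its Borel sets.\<close>

definition binary_seqs :: "(nat \<Rightarrow> real) set" where "binary_seqs = {z. \<forall>i. z i \<in> {0, 1}}"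

definition bits :: "(nat \<Rightarrow> real) \<Rightarrow> nat \<Rightarrow> bool list" where "bits z n = initseg (\<lambda>i. z i = 1) n"

lemma bits_0 [simp]: "bits z 0 = []"
  and bits_Suc [simp]: "bits z (Suc n) = (z n = 1) # bits z n"
  and length_bits [simp]: "length (bits z n) = n"
  by (auto simp: bits_def)

lemma bits_eq_iff:
  assumes "z \<in> binary_seqs" "z' \<in> binary_seqs"
  shows "bits z n = bits z' n \<longleftrightarrow> (\<forall>i<n. z i = z' i)"
proof (induction n)
  case (Suc n)
  have "z n \<in> {0, 1}" "z' n \<in> {0, 1}" using assms unfolding binary_seqs_def by blast+
  then show ?case using Suc by (auto simp: less_Suc_eq)
qed simp

lemma sets_binary_seqs: "{z \<in> binary_seqs. bits z n = s} \<in> sets borel"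
proof -
  have "{z :: nat \<Rightarrow> real. (\<forall>i. z i = 0 \<or> z i = 1) \<and> bits z n = s} \<in> sets borel"
  proof (induction n arbitrary: s)
    case 0
    have "{z :: nat \<Rightarrow> real. (\<forall>i. z i = 0 \<or> z i = 1) \<and> [] = s} \<in> sets borel" by measurable
    then show ?case by simp
  next
    case (Suc n)
    have [measurable]: "Measurable.pred borel (\<lambda>z. (\<forall>i. z i = 0 \<or> z i = 1) \<and> bits z n = s)" for s
      using Suc[of s] by (simp add: pred_def)
    show ?case
    proof (cases s)
      case (Cons b t)
      have "{z :: nat \<Rightarrow> real. ((\<forall>i. z i = 0 \<or> z i = 1) \<and> bits z n = t) \<and> ((z n = 1) \<longleftrightarrow> b)} \<in> sets borel" by measurable
      then show ?thesis using Cons by (simp add: conj_ac)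
    qed simp
  qed
  then show ?thesis by (simp add: binary_seqs_def)
qed

text \<open>A measure with prescribed cylinder weights is the image of Lebesgue measure under the map
  that locates a point of the unit interval in successively split subintervals of these lengths.\<close>

fun left_end :: "(bool list \<Rightarrow> real) \<Rightarrow> bool list \<Rightarrow> real" where
  "left_end q [] = 0"
| "left_end q (b # s) = left_end q s + (if b then q (False # s) else 0)"

fun path :: "(bool list \<Rightarrow> real) \<Rightarrow> real \<Rightarrow> nat \<Rightarrow> bool list" where
  "path q u 0 = []"
| "path q u (Suc n) = (left_end q (path q u n) + q (False # path q u n) \<le> u) # path q u n"

lemma cylinder_measure:
  assumes q1: "q [] = 1" and q0: "\<And>s. 0 \<le> q s" and split: "\<And>s. q s = q (True # s) + q (False # s)"
  obtains \<nu> :: "(nat \<Rightarrow> real) measure" where "prob_space \<nu>" "sets \<nu> = sets borel" "measure \<nu> binary_seqs = 1"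
    "\<And>s. measure \<nu> {z \<in> binary_seqs. bits z (length s) = s} = q s"
proof -
  define P where "P = uniform_measure lborel {0..<1::real}"
  have spP: "space P = UNIV" "sets P = sets borel" by (auto simp: P_def)
  interpret P: prob_space P unfolding P_def by (rule prob_space_uniform_measure) auto
  have len [simp]: "length (path q u n) = n" for u n by (induction n) auto
  have path_bounds: "left_end q (path q u n) \<le> u \<and> u < left_end q (path q u n) + q (path q u n)" if "u \<in> {0..<1}" for u n
  proof (induction n)
    case 0
    then show ?case using that q1 by simp
  next
    case (Suc n)
    then show ?case using split[of "path q u n"] by auto
  qed
  \<comment> \<open>The half-open intervals of words of equal length are disjoint, so the interval
    containing u determines the word. A word of weight zero has an empty interval.\<close>
  have path_unique: "path q u n = s" if "u \<in> {0..<1}" "length s = n" "left_end q s \<le> u" "u < left_end q s + q s" for u n s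
    using that(2-4)
  proof (induction n arbitrary: s)
    case (Suc n)
    then obtain b t where s: "s = b # t" "length t = n" by (cases s) auto
    have "left_end q t \<le> u" "u < left_end q t + q t"
      using Suc.prems(2,3) split[of t] q0[of "False # t"] q0[of "True # t"] unfolding s by (cases b; simp)+
    then have "path q u n = t" using Suc.IH s(2) by blast
    then show ?case using Suc.prems(2,3) unfolding s by (cases b) auto
  qed simp
  have ends: "0 \<le> left_end q s \<and> left_end q s + q s \<le> 1" for s
  proof (induction s)
    case (Cons b s)
    then show ?case using split[of s] q0[of "False # s"] q0[of "True # s"] by auto
  qed (use q1 in auto)
  have meas: "{u. path q u n = s} \<in> sets borel" for n s
  proof (induction n arbitrary: s)
    case (Suc n)
    show ?case
    proof (cases s)
      case (Cons b t)
      have "{u. path q u (Suc n) = s} = {u. path q u n = t} \<inter> {u. (left_end q t + q (False # t) \<le> u) = b}"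
        using Cons by auto
      moreover have "{u. (left_end q t + q (False # t) \<le> u) = b} \<in> sets borel" by measurable
      ultimately show ?thesis using Suc[of t] by auto
    qed simp
  qed simp
  define T where "T u i = (if hd (path q u (Suc i)) then 1 else 0 :: real)" for u i
  have Tbin: "T u \<in> binary_seqs" for u by (auto simp: T_def binary_seqs_def)
  have Tbits: "bits (T u) n = path q u n" for u n
    by (induction n) (auto simp: T_def)
  have Tm: "T \<in> borel_measurable P"
  proof (rule measurable_coordinatewise_then_product)
    fix i
    have "{u. hd (path q u (Suc i))} = (\<Union>s\<in>{s. hd s}. {u. path q u (Suc i) = s})" by auto
    also have "\<dots> \<in> sets borel" by (intro sets.countable_UN' meas image_subsetI) auto
    finally have "Measurable.pred P (\<lambda>u. hd (path q u (Suc i)))" using spP by (simp add: pred_def del: path.simps)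
    then show "(\<lambda>u. T u i) \<in> borel_measurable P" unfolding T_def by measurable
  qed
  define \<nu> where "\<nu> = distr P borel T"
  have sn: "sets \<nu> = sets borel" by (simp add: \<nu>_def)
  interpret \<nu>: prob_space \<nu> unfolding \<nu>_def by (rule P.prob_space_distr[OF Tm])
  have bin: "binary_seqs \<in> sets borel" using sets_binary_seqs[of 0 "[]"] by simp
  have one: "measure \<nu> binary_seqs = 1"
    unfolding \<nu>_def using Tbin P.prob_space by (subst measure_distr[OF Tm bin]) (auto simp: vimage_def spP)
  have "measure \<nu> {z \<in> binary_seqs. bits z (length s) = s} = q s" for s
  proof -
    have "measure \<nu> {z \<in> binary_seqs. bits z (length s) = s} = measure P {u. path q u (length s) = s}"
      unfolding \<nu>_def using Tbin Tbits by (subst measure_distr[OF Tm sets_binary_seqs]) (auto simp: vimage_def spP)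
    also have "\<dots> = measure lborel ({0..<1} \<inter> {u. path q u (length s) = s})"
      unfolding P_def using meas by (subst measure_uniform_measure) auto
    also have "{0..<1} \<inter> {u. path q u (length s) = s} = {left_end q s..<left_end q s + q s}"
    proof (intro set_eqI iffI)
      fix u assume "u \<in> {0..<1} \<inter> {u. path q u (length s) = s}"
      then show "u \<in> {left_end q s..<left_end q s + q s}" using path_bounds[of u "length s"] by auto
    next
      fix u assume u: "u \<in> {left_end q s..<left_end q s + q s}"
      then have "u \<in> {0..<1}" using ends[of s] by auto
      then show "u \<in> {0..<1} \<inter> {u. path q u (length s) = s}" using path_unique[of u s "length s"] u by auto
    qed
    also have "measure lborel {left_end q s..<left_end q s + q s} = q s" using q0[of s] by simp
    finally show ?thesis .
  qed
  then show thesis using that \<nu>.prob_space_axioms sn one by blast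
qed

definition cylinder_event :: "nat \<Rightarrow> ((nat \<Rightarrow> real) \<Rightarrow> bool) \<Rightarrow> bool" where
  "cylinder_event N Q \<longleftrightarrow> (\<forall>z z'. (\<forall>i<N. z i = z' i) \<longrightarrow> Q z = Q z')"

text \<open>Convergence is wanted only for events that depend on finitely many coordinates. Such an
  event is a finite disjoint union of cylinders, so it is enough that the frequencies of all words
  converge along one subsequence; the limits inherit the consistency that a measure
  requires.\<close>

lemma limit_of_codes:
  fixes V :: "nat \<Rightarrow> 'v set" and \<Phi> :: "nat \<Rightarrow> 'v \<Rightarrow> nat \<Rightarrow> real"
  assumes V: "\<And>j. finite (V j)" "\<And>j. V j \<noteq> {}" and \<Phi>: "\<And>j x. \<Phi> j x \<in> binary_seqs"
  obtains \<rho> :: "nat \<Rightarrow> nat" and \<nu> :: "(nat \<Rightarrow> real) measure" where "strict_mono \<rho>" "prob_space \<nu>" "sets \<nu> = sets borel"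
    "measure \<nu> binary_seqs = 1"
    "\<And>N Q. cylinder_event N Q \<Longrightarrow> {z \<in> binary_seqs. Q z} \<in> sets borel"
    "\<And>N Q. cylinder_event N Q \<Longrightarrow>
       (\<lambda>j. real (card {x \<in> V (\<rho> j). Q (\<Phi> (\<rho> j) x)}) / real (card (V (\<rho> j)))) \<longlonglongrightarrow> measure \<nu> {z \<in> binary_seqs. Q z}"
proof -
  define p where "p j s = real (card {x \<in> V j. bits (\<Phi> j x) (length s) = s}) / real (card (V j))" for j s
  have cV: "real (card (V j)) > 0" for j using V by (simp add: card_gt_0_iff)
  have p0: "0 \<le> p j s" for j s by (simp add: p_def)
  have p1: "p j s \<le> 1" for j s
    unfolding p_def using V(1)[of j] cV[of j] card_mono[of "V j" "{x \<in> V j. bits (\<Phi> j x) (length s) = s}"] by auto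
  have pn: "p j [] = 1" for j unfolding p_def using cV[of j] by simp
  have ps: "p j s = p j (True # s) + p j (False # s)" for j s
  proof -
    have "{x \<in> V j. bits (\<Phi> j x) (length s) = s} =
      {x \<in> V j. bits (\<Phi> j x) (length (True # s)) = True # s} \<union> {x \<in> V j. bits (\<Phi> j x) (length (False # s)) = False # s}"
      by auto
    then have "card {x \<in> V j. bits (\<Phi> j x) (length s) = s} =
      card {x \<in> V j. bits (\<Phi> j x) (length (True # s)) = True # s} + card {x \<in> V j. bits (\<Phi> j x) (length (False # s)) = False # s}"
      using V(1)[of j] by (subst card_Un_disjoint[symmetric]) auto
    then show ?thesis unfolding p_def by (simp add: add_divide_distrib)
  qed
  obtain \<rho> q where \<rho>: "strict_mono \<rho>" "\<And>s. (\<lambda>j. p (\<rho> j) s) \<longlonglongrightarrow> q s"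
    using pointwise_convergent_subsequence[of p] p0 p1 by blast
  have "q [] = 1" using LIMSEQ_unique[OF \<rho>(2)[of "[]"]] pn by simp
  moreover have "0 \<le> q s" for s using LIMSEQ_le_const[OF \<rho>(2)[of s]] p0 by blast
  moreover have "q s = q (True # s) + q (False # s)" for s
    using LIMSEQ_unique[OF \<rho>(2)[of s]] tendsto_add[OF \<rho>(2)[of "True # s"] \<rho>(2)[of "False # s"]]
    unfolding ps[symmetric] by blast
  ultimately obtain \<nu> :: "(nat \<Rightarrow> real) measure" where \<nu>: "prob_space \<nu>" "sets \<nu> = sets borel" "measure \<nu> binary_seqs = 1"
    "\<And>s. measure \<nu> {z \<in> binary_seqs. bits z (length s) = s} = q s" by (rule cylinder_measure) blast
  interpret prob_space \<nu> by fact
  have main: "{z \<in> binary_seqs. Q z} \<in> sets borel \<and>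
     (\<lambda>j. real (card {x \<in> V (\<rho> j). Q (\<Phi> (\<rho> j) x)}) / real (card (V (\<rho> j)))) \<longlonglongrightarrow> measure \<nu> {z \<in> binary_seqs. Q z}"
    if Q: "cylinder_event N Q" for N Q
  proof
    define S where "S = {s. length s = N \<and> (\<exists>z\<in>binary_seqs. bits z N = s \<and> Q z)}"
    have "S \<subseteq> {s. set s \<subseteq> UNIV \<and> length s = N}" by (auto simp: S_def)
    then have fin: "finite S" by (rule finite_subset) (intro finite_lists_length_eq, simp)
    have iff: "Q z \<longleftrightarrow> bits z N \<in> S" if z: "z \<in> binary_seqs" for z
    proof
      assume "bits z N \<in> S"
      then obtain z' where "z' \<in> binary_seqs" "bits z' N = bits z N" "Q z'" unfolding S_def by auto
      then show "Q z" using bits_eq_iff[OF _ z, of z' N] Q unfolding cylinder_event_def by metis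
    qed (use z in \<open>auto simp: S_def\<close>)
    have eq: "{z \<in> binary_seqs. Q z} = (\<Union>s\<in>S. {z \<in> binary_seqs. bits z N = s})" using iff by auto
    show "{z \<in> binary_seqs. Q z} \<in> sets borel" unfolding eq using fin sets_binary_seqs by auto
    have "measure \<nu> {z \<in> binary_seqs. Q z} = (\<Sum>s\<in>S. measure \<nu> {z \<in> binary_seqs. bits z N = s})"
      unfolding eq using fin sets_binary_seqs \<nu>(2)
      by (subst finite_measure_finite_Union) (auto simp: disjoint_family_on_def)
    also have "\<dots> = (\<Sum>s\<in>S. q s)"
    proof (rule sum.cong)
      fix s assume "s \<in> S"
      then have "N = length s" by (simp add: S_def)
      then show "measure \<nu> {z \<in> binary_seqs. bits z N = s} = q s" using \<nu>(4)[of s] by simp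
    qed simp
    finally have lim: "measure \<nu> {z \<in> binary_seqs. Q z} = (\<Sum>s\<in>S. q s)" .
    have "real (card {x \<in> V j. Q (\<Phi> j x)}) / real (card (V j)) = (\<Sum>s\<in>S. p j s)" for j
    proof -
      have "{x \<in> V j. Q (\<Phi> j x)} = (\<Union>s\<in>S. {x \<in> V j. bits (\<Phi> j x) N = s})" using iff[OF \<Phi>] by auto
      then have "card {x \<in> V j. Q (\<Phi> j x)} = (\<Sum>s\<in>S. card {x \<in> V j. bits (\<Phi> j x) N = s})"
        using fin V(1)[of j] by (simp only:) (rule card_UN_disjoint, auto)
      also have "\<dots> = (\<Sum>s\<in>S. card {x \<in> V j. bits (\<Phi> j x) (length s) = s})"
        by (rule sum.cong) (auto simp: S_def)
      finally show ?thesis unfolding p_def by (simp add: sum_divide_distrib)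
    qed
    then show "(\<lambda>j. real (card {x \<in> V (\<rho> j). Q (\<Phi> (\<rho> j) x)}) / real (card (V (\<rho> j)))) \<longlonglongrightarrow> measure \<nu> {z \<in> binary_seqs. Q z}"
      unfolding lim using \<rho>(2) by (simp add: tendsto_sum)
  qed
  show thesis
    by (rule that[OF \<rho>(1) \<nu>(1-3)]) (use main in blast)+
qed

section \<open>Graphings from measure-preserving involutions\<close>

text \<open>The topology pulled back along \<phi> is homeomorphic to a closed set of sequences. It
  allows a standard Borel structure to be placed on a set of vertices that has no topology of its
  own.\<close>

lemma standard_borel_closed_embedding:
  fixes \<phi> :: "'a \<Rightarrow> nat \<Rightarrow> real"
  assumes inj: "inj_on \<phi> (space M)" and closed: "closed (\<phi> ` space M)"
    and sets: "sets M = {\<phi> -` B \<inter> space M | B. B \<in> sets borel}"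
  shows "standard_borel M"
proof -
  let ?X = "space M" and ?K = "\<phi> ` space M"
  define T where "T = pullback_topology ?X \<phi> euclidean"
  have top: "topspace T = ?X" by (simp add: T_def topspace_pullback_topology)
  have op: "openin T S \<longleftrightarrow> (\<exists>U. open U \<and> S = \<phi> -` U \<inter> ?X)" for S by (simp add: T_def openin_pullback_topology)
  have "homeomorphic_maps T (top_of_set ?K) \<phi> (inv_into ?X \<phi>)"
    unfolding homeomorphic_maps_def
  proof (intro conjI)
    show "continuous_map T (top_of_set ?K) \<phi>"
      unfolding continuous_map_def top
    proof (intro conjI allI impI)
      fix U assume "openin (top_of_set ?K) U"
      then obtain W where "open W" "U = ?K \<inter> W" by (auto simp: openin_open)
      then have "{x \<in> ?X. \<phi> x \<in> U} = \<phi> -` W \<inter> ?X" by auto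
      then show "openin T {x \<in> ?X. \<phi> x \<in> U}" using op \<open>open W\<close> by blast
    qed auto
    show "continuous_map (top_of_set ?K) T (inv_into ?X \<phi>)"
      unfolding continuous_map_def top
    proof (intro conjI allI impI)
      show "inv_into ?X \<phi> \<in> topspace (top_of_set ?K) \<rightarrow> ?X" by (auto simp: inv_into_into)
      fix U assume "openin T U"
      then obtain W where W: "open W" "U = \<phi> -` W \<inter> ?X" using op by auto
      have "{y \<in> topspace (top_of_set ?K). inv_into ?X \<phi> y \<in> U} = ?K \<inter> W"
        unfolding topspace_euclidean_subtopology
      proof (intro set_eqI iffI)
        fix y assume "y \<in> {y \<in> ?K. inv_into ?X \<phi> y \<in> U}"
        then show "y \<in> ?K \<inter> W" using W(2) f_inv_into_f[of y \<phi> ?X] by auto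
      next
        fix y assume "y \<in> ?K \<inter> W"
        then show "y \<in> {y \<in> ?K. inv_into ?X \<phi> y \<in> U}"
          using W(2) f_inv_into_f[of y \<phi> ?X] inv_into_into[of y \<phi> ?X] by auto
      qed
      then show "openin (top_of_set ?K) {y \<in> topspace (top_of_set ?K). inv_into ?X \<phi> y \<in> U}"
        using W(1) by (simp add: openin_open_Int)
    qed
  qed (use inj top in \<open>auto simp: f_inv_into_f\<close>)
  then have hom: "T homeomorphic_space (top_of_set ?K)" unfolding homeomorphic_space_def by blast
  have "completely_metrizable_space (top_of_set ?K)"
    using closed by (intro completely_metrizable_space_closedin completely_metrizable_space_euclidean) simp
  moreover have "separable_space (top_of_set ?K)"
  proof (intro second_countable_imp_separable_space second_countable_subtopology)
    obtain \<B> :: "(nat \<Rightarrow> real) set set" where B: "countable \<B>" "topological_basis \<B>" using ex_countable_basis by blast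
    show "second_countable (euclidean :: (nat \<Rightarrow> real) topology)"
      unfolding second_countable_def open_openin[symmetric]
    proof (intro exI[of _ \<B>] conjI ballI allI impI)
      fix U and x :: "nat \<Rightarrow> real" assume "open U \<and> x \<in> U"
      then show "\<exists>V\<in>\<B>. x \<in> V \<and> V \<subseteq> U" using topological_basisE[OF B(2)] by metis
    qed (use B topological_basis_open in auto)
  qed
  ultimately have "completely_metrizable_space T" "separable_space T"
    using homeomorphic_completely_metrizable_space[OF hom] homeomorphic_separable_space[OF hom] by auto
  moreover have "sets M = sigma_sets (topspace T) {U. openin T U}"
  proof -
    have "{U. openin T U} = {\<phi> -` A \<inter> ?X | A. A \<in> {S. open S}}" using op by auto
    then show ?thesis unfolding sets top using sigma_sets_vimage_commute[of \<phi> ?X UNIV "{S. open S}"] by (simp add: borel_def)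
  qed
  ultimately show ?thesis unfolding standard_borel_def using top by blast
qed

definition involution_edges :: "'a set \<Rightarrow> nat \<Rightarrow> (nat \<Rightarrow> 'a \<Rightarrow> 'a) \<Rightarrow> 'a set set" where
  "involution_edges X m \<tau> = {{x, \<tau> a x} | x a. x \<in> X \<and> a < m \<and> \<tau> a x \<noteq> x}"

lemma involution_edges_iff:
  assumes inv: "\<And>a x. a < m \<Longrightarrow> x \<in> X \<Longrightarrow> \<tau> a x \<in> X \<and> \<tau> a (\<tau> a x) = x"
  shows "{x, y} \<in> involution_edges X m \<tau> \<longleftrightarrow> x \<in> X \<and> x \<noteq> y \<and> (\<exists>a<m. y = \<tau> a x)"
proof
  assume "{x, y} \<in> involution_edges X m \<tau>"
  then obtain u a where "{x, y} = {u, \<tau> a u}" "u \<in> X" "a < m" "\<tau> a u \<noteq> u" unfolding involution_edges_def by blast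
  then show "x \<in> X \<and> x \<noteq> y \<and> (\<exists>a<m. y = \<tau> a x)"
    using inv[of a u] by (auto simp: doubleton_eq_iff)
next
  assume "x \<in> X \<and> x \<noteq> y \<and> (\<exists>a<m. y = \<tau> a x)"
  then obtain a where "x \<in> X" "a < m" "y = \<tau> a x" "\<tau> a x \<noteq> x" by auto
  then show "{x, y} \<in> involution_edges X m \<tau>" unfolding involution_edges_def by blast
qed

text \<open>Balance is invariance of the measure: substituting \<tau> a x for x exchanges A and B in
  the count of arcs along \<tau> a. Arcs that several involutions share are counted once, by their
  smallest index.\<close>

lemma graphing_of_involutions:
  assumes std: "standard_borel M" and M: "prob_space M"
    and \<tau>: "\<And>a. a < m \<Longrightarrow> \<tau> a \<in> measurable M M"
    and inv: "\<And>a x. a < m \<Longrightarrow> x \<in> space M \<Longrightarrow> \<tau> a (\<tau> a x) = x"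
    and pres: "\<And>a. a < m \<Longrightarrow> distr M M (\<tau> a) = M"
  shows "graphing (M, involution_edges (space M) m \<tau>)"
proof -
  let ?E = "involution_edges (space M) m \<tau>"
  have inv': "\<tau> a x \<in> space M \<and> \<tau> a (\<tau> a x) = x" if "a < m" "x \<in> space M" for a x
    using measurable_space[OF \<tau>[OF that(1)] that(2)] inv[OF that] by simp
  have iff: "{x, y} \<in> ?E \<longleftrightarrow> x \<in> space M \<and> x \<noteq> y \<and> (\<exists>a<m. y = \<tau> a x)" for x y
    by (rule involution_edges_iff) (rule inv')
  have id: "(\<lambda>x. x) \<in> measurable M M" by simp
  have "edges_in (space M) ?E"
    unfolding edges_in_def involution_edges_def using inv' by blast
  moreover have "edge_borel M ?E"
  proof -
    have "{(x, y). x \<in> space M \<and> y \<in> space M \<and> {x, y} \<in> ?E} =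
      (\<Union>a<m. {p \<in> space (M \<Otimes>\<^sub>M M). snd p = \<tau> a (fst p)} - {p \<in> space (M \<Otimes>\<^sub>M M). fst p = snd p})"
      unfolding iff by (auto simp: space_pair_measure)
    also have "\<dots> \<in> sets (M \<Otimes>\<^sub>M M)"
    proof (intro sets.finite_UN sets.Diff)
      fix a assume "a \<in> {..<m}"
      then have [measurable]: "\<tau> a \<in> measurable M M" using \<tau> by simp
      show "{p \<in> space (M \<Otimes>\<^sub>M M). snd p = \<tau> a (fst p)} \<in> sets (M \<Otimes>\<^sub>M M)"
        by (rule sets_Collect_eq_standard_borel[OF std]) measurable
      show "{p \<in> space (M \<Otimes>\<^sub>M M). fst p = snd p} \<in> sets (M \<Otimes>\<^sub>M M)"
        by (rule sets_Collect_eq_standard_borel[OF std]) measurable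
    qed simp
    finally show ?thesis unfolding edge_borel_def .
  qed
  moreover have "bounded_degree (space M) ?E m"
    unfolding bounded_degree_def
  proof
    fix x assume "x \<in> space M"
    have sub: "{y. {x, y} \<in> ?E} \<subseteq> (\<lambda>a. \<tau> a x) ` {..<m}" unfolding iff by auto
    then show "finite {y. {x, y} \<in> ?E} \<and> card {y. {x, y} \<in> ?E} \<le> m"
      using finite_subset[OF sub] card_mono[OF _ sub] card_image_le[of "{..<m}" "\<lambda>a. \<tau> a x"] by auto
  qed
  moreover have "(\<integral>\<^sup>+ x\<in>A. ennreal (real (deg ?E B x)) \<partial>M) = (\<integral>\<^sup>+ x\<in>B. ennreal (real (deg ?E A x)) \<partial>M)"
    if A: "A \<in> sets M" and B: "B \<in> sets M" for A B
  proof -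
    \<comment> \<open>\<open>F a\<close>: the arc along \<open>\<tau> a\<close> is not a loop and is not already realised by a smaller index.\<close>
    define F where "F a x \<longleftrightarrow> \<tau> a x \<noteq> x \<and> (\<forall>b<a. \<tau> b x \<noteq> \<tau> a x)" for a x
    \<comment> \<open>Minimality of the index survives reversing the arc: since the maps are
      involutions, \<tau> b leads from x to \<tau> a x exactly if it leads back.\<close>
    have Finv: "F a (\<tau> a x) \<longleftrightarrow> F a x" if "a < m" "x \<in> space M" for a x
    proof -
      have "\<tau> b (\<tau> a x) \<noteq> x \<longleftrightarrow> \<tau> b x \<noteq> \<tau> a x" if "b < a" for b
        using inv'[of b x] inv'[of b "\<tau> a x"] inv'[of a x] \<open>a < m\<close> \<open>x \<in> space M\<close> that by (metis order.strict_trans)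
      then show ?thesis using inv'[OF that] unfolding F_def by auto
    qed
    have Fm: "{x \<in> space M. F a x} \<in> sets M" if "a < m" for a
    proof -
      have "{x \<in> space M. F a x} = (space M - {x \<in> space M. \<tau> a x = x}) - (\<Union>b<a. {x \<in> space M. \<tau> b x = \<tau> a x})"
        unfolding F_def by auto
      also have "\<dots> \<in> sets M"
        using that \<tau> by (intro sets.Diff sets.finite_UN sets_Collect_eq_standard_borel[OF std] id) auto
      finally show ?thesis .
    qed
    have deg: "ennreal (real (deg ?E B x)) * indicator A x = (\<Sum>a<m. indicator {x \<in> space M. F a x} x * indicator B (\<tau> a x) * indicator A x)"
      if x: "x \<in> space M" for x A B
    proof -
      have "card {y \<in> B. {x, y} \<in> ?E} = card {a \<in> {..<m}. F a x \<and> \<tau> a x \<in> B}"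
      proof (rule bij_betw_same_card[symmetric], unfold bij_betw_def, intro conjI)
        show "inj_on (\<lambda>a. \<tau> a x) {a \<in> {..<m}. F a x \<and> \<tau> a x \<in> B}"
          unfolding F_def by (rule linorder_inj_onI') auto
        show "(\<lambda>a. \<tau> a x) ` {a \<in> {..<m}. F a x \<and> \<tau> a x \<in> B} = {y \<in> B. {x, y} \<in> ?E}"
        proof (intro set_eqI iffI)
          fix y assume "y \<in> {y \<in> B. {x, y} \<in> ?E}"
          then have y: "y \<in> B" "x \<noteq> y" "\<exists>a. a < m \<and> y = \<tau> a x" unfolding iff by auto
          define a where "a = (LEAST a. a < m \<and> y = \<tau> a x)"
          have a: "a < m" "y = \<tau> a x" using LeastI_ex[OF y(3)] by (auto simp: a_def)
          have "\<tau> b x \<noteq> y" if "b < a" for b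
            using not_less_Least[of b "\<lambda>a. a < m \<and> y = \<tau> a x"] that a(1) unfolding a_def by auto
          then have "F a x" unfolding F_def using a(2) y(2) by auto
          then show "y \<in> (\<lambda>a. \<tau> a x) ` {a \<in> {..<m}. F a x \<and> \<tau> a x \<in> B}" using a y(1) by auto
        qed (use x in \<open>auto simp: iff F_def\<close>)
      qed
      also have "\<dots> = (\<Sum>a<m. if F a x \<and> \<tau> a x \<in> B then 1 else 0)"
        by (simp add: sum.If_cases Int_def)
      finally have card: "card {y \<in> B. {x, y} \<in> ?E} = (\<Sum>a<m. if F a x \<and> \<tau> a x \<in> B then 1 else 0)" .
      have "ennreal (real (deg ?E B x)) = (\<Sum>a<m. if F a x \<and> \<tau> a x \<in> B then 1 else 0)"
        unfolding deg_def card unfolding ennreal_of_nat_eq_real_of_nat[symmetric] unfolding of_nat_sum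
        by (intro sum.cong) auto
      also have "\<dots> = (\<Sum>a<m. indicator {x \<in> space M. F a x} x * indicator B (\<tau> a x))"
        using x by (intro sum.cong) (auto simp: indicator_def)
      finally show ?thesis by (simp only: sum_distrib_right)
    qed
    have meas: "(\<lambda>x. indicator {x \<in> space M. F a x} x * indicator B (\<tau> a x) * indicator A x :: ennreal) \<in> borel_measurable M"
      if "a < m" "A \<in> sets M" "B \<in> sets M" for a A B
      using that \<tau>[OF that(1)] Fm[OF that(1)] by measurable
    have exp: "(\<integral>\<^sup>+ x\<in>A. ennreal (real (deg ?E B x)) \<partial>M) =
        (\<Sum>a<m. \<integral>\<^sup>+ x. indicator {x \<in> space M. F a x} x * indicator B (\<tau> a x) * indicator A x \<partial>M)"
      if "A \<in> sets M" "B \<in> sets M" for A B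
    proof -
      have "(\<integral>\<^sup>+ x\<in>A. ennreal (real (deg ?E B x)) \<partial>M) =
         (\<integral>\<^sup>+ x. (\<Sum>a<m. indicator {x \<in> space M. F a x} x * indicator B (\<tau> a x) * indicator A x) \<partial>M)"
        by (rule nn_integral_cong) (rule deg)
      then show ?thesis using meas that by (subst (asm) nn_integral_sum) auto
    qed
    have "(\<integral>\<^sup>+ x. indicator {x \<in> space M. F a x} x * indicator B (\<tau> a x) * indicator A x \<partial>M) =
       (\<integral>\<^sup>+ x. indicator {x \<in> space M. F a x} x * indicator A (\<tau> a x) * indicator B x \<partial>M)" if a: "a < m" for a
    proof -
      have "(\<integral>\<^sup>+ x. indicator {x \<in> space M. F a x} x * indicator B (\<tau> a x) * indicator A x \<partial>M) =
        (\<integral>\<^sup>+ x. indicator {x \<in> space M. F a x} x * indicator B (\<tau> a x) * indicator A x \<partial>(distr M M (\<tau> a)))"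
        using pres[OF a] by simp
      also have "\<dots> = (\<integral>\<^sup>+ x. indicator {x \<in> space M. F a x} (\<tau> a x) * indicator B (\<tau> a (\<tau> a x)) * indicator A (\<tau> a x) \<partial>M)"
        by (rule nn_integral_distr[OF \<tau>[OF a]]) (use meas[OF a A B] in simp)
      also have "\<dots> = (\<integral>\<^sup>+ x. indicator {x \<in> space M. F a x} x * indicator A (\<tau> a x) * indicator B x \<partial>M)"
        using inv'[OF a] Finv[OF a] by (intro nn_integral_cong) (auto simp: indicator_def)
      finally show ?thesis .
    qed
    then show ?thesis unfolding exp[OF A B] exp[OF B A] by (intro sum.cong) auto
  qed
  ultimately show ?thesis unfolding graphing_def Let_def using std M by auto
qed

section \<open>Balls as word orbits\<close>

definition words :: "nat \<Rightarrow> nat \<Rightarrow> nat list set" where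
  "words m r = {w. set w \<subseteq> {..<m} \<and> length w \<le> r}"

lemma finite_words: "finite (words m r)"
  unfolding words_def using finite_lists_length_le[of "{..<m}" r] by simp

lemma words_Cons: "a # w \<in> words m (Suc r) \<longleftrightarrow> a < m \<and> w \<in> words m r"
  unfolding words_def by auto

lemma words_mono: "r \<le> r' \<Longrightarrow> words m r \<subseteq> words m r'"
  unfolding words_def by auto

locale generated_graph =
  fixes X :: "'a set" and E :: "'a set set" and m :: nat and \<tau> :: "nat \<Rightarrow> 'a \<Rightarrow> 'a"
  assumes closed_gen: "\<And>a x. a < m \<Longrightarrow> x \<in> X \<Longrightarrow> \<tau> a x \<in> X"
    and edge_gen: "\<And>x y. x \<in> X \<Longrightarrow> {x, y} \<in> E \<longleftrightarrow> x \<noteq> y \<and> (\<exists>a<m. y = \<tau> a x)"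
begin

lemma foldr_closed: "w \<in> words m r \<Longrightarrow> x \<in> X \<Longrightarrow> foldr \<tau> w x \<in> X"
  by (induction w) (auto simp: words_def closed_gen)

text \<open>A path is a word of generators, and a letter that fixes the current vertex merely
  pauses.\<close>

lemma ball_eq_words: "x \<in> X \<Longrightarrow> ball E r x = (\<lambda>w. foldr \<tau> w x) ` words m r"
proof (induction r)
  case 0
  then show ?case by (auto simp: words_def)
next
  case (Suc r)
  show ?case
  proof (intro set_eqI iffI)
    fix z assume "z \<in> ball E (Suc r) x"
    then obtain y where y: "y \<in> ball E r x" "z = y \<or> {y, z} \<in> E" unfolding ball_Suc by blast
    then obtain w where w: "w \<in> words m r" "y = foldr \<tau> w x" using Suc by auto
    from y(2) show "z \<in> (\<lambda>w. foldr \<tau> w x) ` words m (Suc r)"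
    proof
      assume "z = y"
      then show ?thesis using w words_mono[of r "Suc r" m] by auto
    next
      assume "{y, z} \<in> E"
      then obtain a where "a < m" "z = \<tau> a y" using edge_gen[of y z] foldr_closed[OF w(1) Suc.prems] w(2) by auto
      then show ?thesis using w by (intro image_eqI[of _ _ "a # w"]) (auto simp: words_Cons)
    qed
  next
    fix z assume "z \<in> (\<lambda>w. foldr \<tau> w x) ` words m (Suc r)"
    then obtain w where w: "w \<in> words m (Suc r)" "z = foldr \<tau> w x" by auto
    show "z \<in> ball E (Suc r) x"
    proof (cases w)
      case Nil
      then show ?thesis using w by simp
    next
      case (Cons a v)
      then have v: "a < m" "v \<in> words m r" using w words_Cons by auto
      let ?y = "foldr \<tau> v x"
      have "?y \<in> ball E r x" "?y \<in> X" using Suc v foldr_closed by auto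
      moreover have "z = ?y \<or> {?y, z} \<in> E" using edge_gen[of ?y z] \<open>?y \<in> X\<close> v w Cons by auto
      ultimately show ?thesis unfolding ball_Suc by blast
    qed
  qed
qed

end

text \<open>The isomorphism sends the end of a word to the end of the same word; which words have
  equal ends therefore determines the ball. Length r + 1 enters because an edge between two vertices
  of the ball is a word extended by one letter.\<close>

lemma generated_ball_eqv:
  assumes G: "generated_graph X E m \<tau>" and G': "generated_graph X' E' m \<tau>'" and x: "x \<in> X" "x' \<in> X'"
    and eq: "\<And>w v. w \<in> words m (Suc r) \<Longrightarrow> v \<in> words m (Suc r) \<Longrightarrow>
       foldr \<tau> w x = foldr \<tau> v x \<longleftrightarrow> foldr \<tau>' w x' = foldr \<tau>' v x'"
  shows "ball_eqv r E (\<lambda>_. 0) x E' (\<lambda>_. 0) x'"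
proof -
  interpret G: generated_graph X E m \<tau> by fact
  interpret G': generated_graph X' E' m \<tau>' by fact
  define wd where "wd y = (SOME w. w \<in> words m r \<and> foldr \<tau> w x = y)" for y
  define h where "h y = foldr \<tau>' (wd y) x'" for y
  have sub: "w \<in> words m (Suc r)" if "w \<in> words m r" for w using that words_mono[of r "Suc r" m] by auto
  have h: "h (foldr \<tau> w x) = foldr \<tau>' w x'" if w: "w \<in> words m r" for w
  proof -
    have "wd (foldr \<tau> w x) \<in> words m r \<and> foldr \<tau> (wd (foldr \<tau> w x)) x = foldr \<tau> w x"
      unfolding wd_def by (rule someI[of _ w]) (use w in auto)
    then show ?thesis unfolding h_def using eq sub w by blast
  qed
  have B: "ball E r x = (\<lambda>w. foldr \<tau> w x) ` words m r" "ball E' r x' = (\<lambda>w. foldr \<tau>' w x') ` words m r"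
    using G.ball_eq_words G'.ball_eq_words x by auto
  have "bij_betw h (ball E r x) (ball E' r x')"
    unfolding bij_betw_def B
  proof
    show "inj_on h ((\<lambda>w. foldr \<tau> w x) ` words m r)"
      by (rule inj_onI) (use h eq sub in auto)
    show "h ` (\<lambda>w. foldr \<tau> w x) ` words m r = (\<lambda>w. foldr \<tau>' w x') ` words m r"
      unfolding image_image by (rule image_cong) (use h in auto)
  qed
  moreover have "h x = x'" using h[of "[]"] by (simp add: words_def)
  moreover have "{y, z} \<in> E \<longleftrightarrow> {h y, h z} \<in> E'" if yz: "y \<in> ball E r x" "z \<in> ball E r x" for y z
  proof -
    obtain w v where wv: "w \<in> words m r" "v \<in> words m r" "y = foldr \<tau> w x" "z = foldr \<tau> v x" using yz unfolding B by auto
    have "{y, z} \<in> E \<longleftrightarrow> foldr \<tau> w x \<noteq> foldr \<tau> v x \<and> (\<exists>a<m. foldr \<tau> v x = foldr \<tau> (a # w) x)"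
      using G.edge_gen[OF G.foldr_closed[OF wv(1) x(1)]] wv by simp
    also have "\<dots> \<longleftrightarrow> foldr \<tau>' w x' \<noteq> foldr \<tau>' v x' \<and> (\<exists>a<m. foldr \<tau>' v x' = foldr \<tau>' (a # w) x')"
      using eq[OF sub[OF wv(1)] sub[OF wv(2)]] eq[OF sub[OF wv(2)], of "_ # w"] wv(1) by (metis words_Cons)
    also have "\<dots> \<longleftrightarrow> {h y, h z} \<in> E'"
      using G'.edge_gen[OF G'.foldr_closed[OF wv(1) x(2)]] wv h by simp
    finally show ?thesis .
  qed
  ultimately show ?thesis unfolding ball_eqv_def by (intro exI[of _ h]) auto
qed

lemma ball_trans: "y \<in> ball E r x \<Longrightarrow> z \<in> ball E s y \<Longrightarrow> z \<in> ball E (r + s) x"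
proof (induction s arbitrary: z)
  case (Suc s)
  then obtain u where "u \<in> ball E s y" "z = u \<or> {u, z} \<in> E" unfolding ball_Suc by blast
  then have "u \<in> ball E (r + s) x" using Suc by blast
  then show ?case using \<open>z = u \<or> {u, z} \<in> E\<close> by (auto simp: ball_Suc)
qed simp

section \<open>Limits of finite graphs with involutions\<close>

text \<open>Sequences are read as functions on pairs of a word and a label index. In the code of a
  vertex, position (w, i) holds bit i of the label of the vertex reached along w.\<close>

definition coord :: "nat list \<Rightarrow> nat \<Rightarrow> nat" where "coord w i = prod_encode (list_encode w, i)"

text \<open>Moving the root along a turns the word w from the new root into w @ [a] from the old
  one: the letter goes to the end because \<open>foldr\<close> applies the last letter
  first.\<close>

definition shift :: "nat \<Rightarrow> (nat \<Rightarrow> real) \<Rightarrow> nat \<Rightarrow> real" where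
  "shift a z n = z (coord (list_decode (fst (prod_decode n)) @ [a]) (snd (prod_decode n)))"

lemma coord_surj: "\<exists>w i. n = coord w i"
  by (intro exI[of _ "list_decode (fst (prod_decode n))"] exI[of _ "snd (prod_decode n)"]) (simp add: coord_def)

lemma shift_coord [simp]: "shift a z (coord w i) = z (coord (w @ [a]) i)"
  by (simp add: shift_def coord_def)

lemma foldr_shift_coord: "foldr shift w z (coord u i) = z (coord (u @ w) i)"
  by (induction w arbitrary: u) auto

lemma shift_measurable: "shift a \<in> borel_measurable borel"
  by (rule measurable_coordinatewise_then_product) (unfold shift_def, measurable)

text \<open>By \<open>sep\<close>, for each radius a number of label bits that is the same for all j
  distinguishes vertices within that distance; this lets coincidences of words be read off finitely
  many coordinates. Indices from m on act as the identity, so that a code can list the words over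
  all natural numbers.\<close>

locale involution_codes =
  fixes V :: "nat \<Rightarrow> 'a set" and E :: "nat \<Rightarrow> 'a set set" and m :: nat
    and \<tau> :: "nat \<Rightarrow> nat \<Rightarrow> 'a \<Rightarrow> 'a" and lab :: "nat \<Rightarrow> 'a \<Rightarrow> nat \<Rightarrow> real"
  assumes fin: "\<And>j. finite (V j)" and ne: "\<And>j. V j \<noteq> {}"
    and \<tau>V: "\<And>j a x. x \<in> V j \<Longrightarrow> \<tau> j a x \<in> V j"
    and \<tau>\<tau>: "\<And>j a x. x \<in> V j \<Longrightarrow> \<tau> j a (\<tau> j a x) = x"
    and edge: "\<And>j x y. x \<in> V j \<Longrightarrow> {x, y} \<in> E j \<longleftrightarrow> x \<noteq> y \<and> (\<exists>a<m. y = \<tau> j a x)"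
    and \<tau>id: "\<And>j a x. x \<in> V j \<Longrightarrow> a \<ge> m \<Longrightarrow> \<tau> j a x = x"
    and lab01: "\<And>j x i. lab j x i \<in> {0, 1}"
    and sep: "\<And>R. \<exists>N. \<forall>j. \<forall>x\<in>V j. \<forall>y\<in>ball (E j) R x. (\<forall>i<N. lab j x i = lab j y i) \<longrightarrow> x = y"
begin

definition code :: "nat \<Rightarrow> 'a \<Rightarrow> nat \<Rightarrow> real" where
  "code j x n = lab j (foldr (\<tau> j) (list_decode (fst (prod_decode n))) x) (snd (prod_decode n))"

lemma code_coord: "code j x (coord w i) = lab j (foldr (\<tau> j) w x) i"
  by (simp add: code_def coord_def)

lemma code_binary: "code j x \<in> binary_seqs"
  using lab01 by (simp add: binary_seqs_def code_def)

lemma shift_code: "shift a (code j x) = code j (\<tau> j a x)"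
proof
  fix n
  obtain w i where "n = coord w i" using coord_surj by blast
  then show "shift a (code j x) n = code j (\<tau> j a x) n" by (simp add: code_coord)
qed

lemma foldr_in_V: "x \<in> V j \<Longrightarrow> foldr (\<tau> j) w x \<in> V j"
  by (induction w) (auto simp: \<tau>V)

lemma foldr_in_ball: "x \<in> V j \<Longrightarrow> foldr (\<tau> j) w x \<in> ball (E j) (length w) x"
proof (induction w)
  case (Cons a w)
  let ?y = "foldr (\<tau> j) w x"
  have "\<tau> j a ?y = ?y \<or> {?y, \<tau> j a ?y} \<in> E j"
    using edge[OF foldr_in_V[OF Cons.prems], of w "\<tau> j a ?y"] \<tau>id[OF foldr_in_V[OF Cons.prems], of a w] by (cases "a < m") auto
  then show ?case using Cons by (auto simp: ball_Suc)
qed simp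

text \<open>The closure of the set of all codes in the product topology. Identities between
  coordinates that hold for every code pass to it, so the shifts are involutions at every point and
  not only almost everywhere.\<close>

definition limit_space :: "(nat \<Rightarrow> real) set" where
  "limit_space = {z. \<forall>N. \<exists>j. \<exists>x\<in>V j. \<forall>i<N. z i = code j x i}"

lemma code_in_limit_space: "x \<in> V j \<Longrightarrow> code j x \<in> limit_space"
  unfolding limit_space_def by auto

lemma limit_space_finite:
  assumes "z \<in> limit_space" "finite I"
  shows "\<exists>j. \<exists>x\<in>V j. \<forall>i\<in>I. z i = code j x i"
proof -
  obtain N where "\<forall>i\<in>I. i < N" using assms(2) finite_nat_set_iff_bounded by blast
  then show ?thesis using assms(1) unfolding limit_space_def by blast
qed

lemma limit_space_binary: "limit_space \<subseteq> binary_seqs"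
proof
  fix z assume z: "z \<in> limit_space"
  have "z i \<in> {0, 1}" for i
    using limit_space_finite[OF z, of "{i}"] code_binary unfolding binary_seqs_def by fastforce
  then show "z \<in> binary_seqs" by (simp add: binary_seqs_def)
qed

lemma closed_limit_space: "closed limit_space"
proof -
  have "closed {z. \<exists>j. \<exists>x\<in>V j. \<forall>i<N. z i = code j x i}" for N
  proof -
    define W where "W = {map (code j x) [0..<N] | j x. x \<in> V j}"
    have "W \<subseteq> {s. set s \<subseteq> {0, 1} \<and> length s = N}"
      unfolding W_def using code_binary by (fastforce simp: binary_seqs_def)
    then have "finite W" by (rule finite_subset) (intro finite_lists_length_eq, simp)
    have "{z. \<exists>j. \<exists>x\<in>V j. \<forall>i<N. z i = code j x i} = (\<Union>s\<in>W. \<Inter>i\<in>{..<N}. {z. z i = s ! i})"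
      unfolding W_def by fastforce
    moreover have "closed {z :: nat \<Rightarrow> real. z i = s ! i}" for i and s :: "real list"
      by (intro closed_Collect_eq continuous_on_product_coordinates continuous_on_const)
    ultimately show ?thesis using \<open>finite W\<close> by (auto intro!: closed_UN closed_INT)
  qed
  moreover have "limit_space = (\<Inter>N. {z. \<exists>j. \<exists>x\<in>V j. \<forall>i<N. z i = code j x i})"
    unfolding limit_space_def by auto
  ultimately show ?thesis by auto
qed

lemma shift_limit_space:
  assumes z: "z \<in> limit_space" shows "shift a z \<in> limit_space"
  unfolding limit_space_def
proof (intro CollectI allI)
  fix N
  let ?I = "(\<lambda>n. coord (list_decode (fst (prod_decode n)) @ [a]) (snd (prod_decode n))) ` {..<N}"
  obtain j x where x: "x \<in> V j" "\<forall>i\<in>?I. z i = code j x i" using limit_space_finite[OF z, of ?I] by auto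
  then have "shift a z n = shift a (code j x) n" if "n < N" for n using that by (simp add: shift_def)
  then show "\<exists>j. \<exists>x\<in>V j. \<forall>i<N. shift a z i = code j x i" using x(1) \<tau>V unfolding shift_code by blast
qed

lemma shift_shift:
  assumes z: "z \<in> limit_space" shows "shift a (shift a z) = z"
proof
  fix n
  obtain w i where n: "n = coord w i" using coord_surj by blast
  obtain j x where x: "x \<in> V j" "\<forall>i\<in>{coord w i, coord (w @ [a, a]) i}. z i = code j x i"
    using limit_space_finite[OF z, of "{coord w i, coord (w @ [a, a]) i}"] by auto
  then show "shift a (shift a z) n = z n" using \<tau>\<tau>[OF x(1)] by (simp add: n code_coord)
qed

text \<open>The equivalence holds in every finite graph and each coordinate of it involves finitely
  many bits, so it passes to the limit space. The ends of two words of length at most R are at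
  distance at most R + R.\<close>

lemma limit_space_separation:
  assumes N: "\<forall>j. \<forall>x\<in>V j. \<forall>y\<in>ball (E j) (R + R) x. (\<forall>i<N. lab j x i = lab j y i) \<longrightarrow> x = y"
    and z: "z \<in> limit_space" and w: "length w \<le> R" "length v \<le> R"
  shows "foldr shift w z = foldr shift v z \<longleftrightarrow> (\<forall>i<N. z (coord w i) = z (coord v i))"
proof
  assume "foldr shift w z = foldr shift v z"
  then show "\<forall>i<N. z (coord w i) = z (coord v i)"
    using foldr_shift_coord[of w z "[]"] foldr_shift_coord[of v z "[]"] by (metis append_Nil)
next
  assume eq: "\<forall>i<N. z (coord w i) = z (coord v i)"
  show "foldr shift w z = foldr shift v z"
  proof
    fix n
    obtain u k where n: "n = coord u k" using coord_surj by blast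
    \<comment> \<open>All coordinates at hand: the two that are compared at n and the label bits
      that witness the coincidence. One code agrees with z on all of them.\<close>
    let ?I = "{coord (u @ w) k, coord (u @ v) k} \<union> coord w ` {..<N} \<union> coord v ` {..<N}"
    obtain j x where x: "x \<in> V j" "\<forall>i\<in>?I. z i = code j x i" using limit_space_finite[OF z, of ?I] by auto
    have "lab j (foldr (\<tau> j) w x) i = lab j (foldr (\<tau> j) v x) i" if "i < N" for i
      using eq x(2) that by (simp add: code_coord)
    moreover have "foldr (\<tau> j) v x \<in> ball (E j) (length w + length v) (foldr (\<tau> j) w x)"
      using ball_trans[OF ball_sym[OF foldr_in_ball[OF x(1)]] foldr_in_ball[OF x(1)]] .
    then have "foldr (\<tau> j) v x \<in> ball (E j) (R + R) (foldr (\<tau> j) w x)"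
      using w ball_mono[of "length w + length v" "R + R" "E j"] by (meson add_mono subsetD)
    ultimately have "foldr (\<tau> j) w x = foldr (\<tau> j) v x" using N foldr_in_V[OF x(1)] by blast
    then show "foldr shift w z n = foldr shift v z n"
      using x(2) by (simp add: n foldr_shift_coord code_coord)
  qed
qed

abbreviation limit_edges :: "(nat \<Rightarrow> real) set set" where
  "limit_edges \<equiv> involution_edges limit_space m shift"

lemma generated_limit: "generated_graph limit_space limit_edges m shift"
proof
  fix x y assume "x \<in> limit_space"
  then show "{x, y} \<in> limit_edges \<longleftrightarrow> x \<noteq> y \<and> (\<exists>a<m. y = shift a x)"
    using involution_edges_iff[of m limit_space shift x y] shift_limit_space shift_shift by blast
qed (rule shift_limit_space)

lemma generated_finite: "generated_graph (V j) (E j) m (\<tau> j)"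
  by unfold_locales (auto simp: \<tau>V edge)

text \<open>The ball depends only on coincidences among words of length at most r + 1, and each of
  these is visible in finitely many coordinates; this turns ball statistics into cylinder
  events.\<close>

lemma limit_ball_eqv:
  "\<exists>N. \<forall>z\<in>limit_space. \<forall>j. \<forall>x\<in>V j. (\<forall>i<N. z i = code j x i) \<longrightarrow> ball_eqv r limit_edges (\<lambda>_. 0) z (E j) (\<lambda>_. 0) x"
proof -
  let ?R = "Suc r"
  obtain N0 where N0: "\<forall>j. \<forall>x\<in>V j. \<forall>y\<in>ball (E j) (?R + ?R) x. (\<forall>i<N0. lab j x i = lab j y i) \<longrightarrow> x = y"
    using sep by blast
  have "finite (\<Union>w\<in>words m ?R. coord w ` {..<N0})" using finite_words by auto
  then obtain N where N: "\<forall>i\<in>(\<Union>w\<in>words m ?R. coord w ` {..<N0}). i < N" using finite_nat_set_iff_bounded by blast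
  have "ball_eqv r limit_edges (\<lambda>_. 0) z (E j) (\<lambda>_. 0) x"
    if z: "z \<in> limit_space" and x: "x \<in> V j" and eq: "\<forall>i<N. z i = code j x i" for z j x
  proof (rule generated_ball_eqv[OF generated_limit generated_finite z x])
    fix w v assume wv: "w \<in> words m ?R" "v \<in> words m ?R"
    then have len: "length w \<le> ?R" "length v \<le> ?R" by (auto simp: words_def)
    have co: "z (coord u i) = code j x (coord u i)" if "u \<in> words m ?R" "i < N0" for u i
      using that N eq by blast
    have "foldr shift w z = foldr shift v z \<longleftrightarrow> (\<forall>i<N0. code j x (coord w i) = code j x (coord v i))"
      unfolding limit_space_separation[OF N0 z len] using co wv by auto
    also have "\<dots> \<longleftrightarrow> foldr shift w (code j x) = foldr shift v (code j x)"
      unfolding limit_space_separation[OF N0 code_in_limit_space[OF x] len] ..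
    also have "\<dots> \<longleftrightarrow> foldr (\<tau> j) w x = foldr (\<tau> j) v x"
    proof
      assume "foldr shift w (code j x) = foldr shift v (code j x)"
      then have "lab j (foldr (\<tau> j) w x) i = lab j (foldr (\<tau> j) v x) i" for i
        using foldr_shift_coord[of w "code j x" "[]" i] foldr_shift_coord[of v "code j x" "[]" i] by (simp add: code_coord)
      moreover have "foldr (\<tau> j) v x \<in> ball (E j) (length w + length v) (foldr (\<tau> j) w x)"
        using ball_trans[OF ball_sym[OF foldr_in_ball[OF x]] foldr_in_ball[OF x]] .
      then have "foldr (\<tau> j) v x \<in> ball (E j) (?R + ?R) (foldr (\<tau> j) w x)"
        using len ball_mono[of "length w + length v" "?R + ?R" "E j"] by (meson add_mono subsetD)
      ultimately show "foldr (\<tau> j) w x = foldr (\<tau> j) v x" using N0 foldr_in_V[OF x] by blast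
    next
      have sc: "foldr shift u (code j x) = code j (foldr (\<tau> j) u x)" for u by (induction u) (auto simp: shift_code)
      assume "foldr (\<tau> j) w x = foldr (\<tau> j) v x"
      then show "foldr shift w (code j x) = foldr shift v (code j x)" unfolding sc by simp
    qed
    finally show "foldr shift w z = foldr shift v z \<longleftrightarrow> foldr (\<tau> j) w x = foldr (\<tau> j) v x" .
  qed
  then show ?thesis by blast
qed

end

lemma P_loc_finite:
  assumes "finite V"
  shows "P_loc (as_graphing V E) r \<alpha> = real (card {x \<in> V. ball_iso E r x \<alpha>}) / real (card V)"
  unfolding P_loc_def as_graphing_def fst_conv snd_conv space_uniform_count_measure
  using measure_uniform_count[OF assms, of "{x \<in> V. ball_iso E r x \<alpha>}"] by simp

context involution_codes begin

lemma local_limit: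
  fixes \<iota> :: "(nat \<Rightarrow> real) \<Rightarrow> 'a"
  assumes \<iota>: "inj_on \<iota> binary_seqs"
  shows "\<exists>\<rho> H. strict_mono \<rho> \<and> graphing (H :: 'a graphing) \<and> local_conv (\<lambda>j. as_graphing (V (\<rho> j)) (E (\<rho> j))) H"
proof -
  obtain \<rho> and \<nu> :: "(nat \<Rightarrow> real) measure" where \<rho>: "strict_mono \<rho>" and \<nu>: "prob_space \<nu>" "sets \<nu> = sets borel"
    "measure \<nu> binary_seqs = 1"
    and cyl_sets: "\<And>N Q. cylinder_event N Q \<Longrightarrow> {z \<in> binary_seqs. Q z} \<in> sets borel"
    and cyl_lim: "\<And>N Q. cylinder_event N Q \<Longrightarrow>
       (\<lambda>j. real (card {x \<in> V (\<rho> j). Q (code (\<rho> j) x)}) / real (card (V (\<rho> j)))) \<longlonglongrightarrow> measure \<nu> {z \<in> binary_seqs. Q z}"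
    by (rule limit_of_codes[of V code, OF fin ne code_binary]) blast
  interpret \<nu>: prob_space \<nu> by fact
  have sp\<nu>: "space \<nu> = UNIV" using sets_eq_imp_space_eq[OF \<nu>(2)] by simp
  let ?\<Omega> = limit_space
  have \<Omega>_sets: "?\<Omega> \<in> sets \<nu>" using closed_limit_space \<nu>(2) by auto
  have bin_sets: "binary_seqs \<in> sets \<nu>" using sets_binary_seqs[of 0 "[]"] \<nu>(2) by simp
  have AE_bin: "AE z in \<nu>. z \<in> binary_seqs" using \<nu>.prob_eq_1[OF bin_sets] \<nu>(3) by simp
  \<comment> \<open>Failing to agree with any code on the first N coordinates is a cylinder event of
    frequency zero in each finite graph, hence null in the limit; only countably many N have to be
    combined.\<close>
  have AE_\<Omega>: "AE z in \<nu>. z \<in> ?\<Omega>"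
  proof -
    have "AE z in \<nu>. \<exists>j. \<exists>x\<in>V j. \<forall>i<N. z i = code j x i" for N
    proof -
      let ?Q = "\<lambda>z. \<not> (\<exists>j. \<exists>x\<in>V j. \<forall>i<N. z i = code j x i)"
      have Q: "cylinder_event N ?Q" unfolding cylinder_event_def by auto
      have e: "{x \<in> V (\<rho> j). ?Q (code (\<rho> j) x)} = {}" for j by auto
      have "(\<lambda>j. 0) \<longlonglongrightarrow> measure \<nu> {z \<in> binary_seqs. ?Q z}"
        using cyl_lim[of N ?Q, OF Q] unfolding e by simp
      from LIMSEQ_unique[OF this tendsto_const] have "measure \<nu> {z \<in> binary_seqs. ?Q z} = 0" .
      then have "AE z in \<nu>. z \<notin> {z \<in> binary_seqs. ?Q z}"
        using cyl_sets[of N ?Q, OF Q] \<nu>(2) \<nu>.prob_eq_0 by simp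
      with AE_bin show ?thesis by eventually_elim auto
    qed
    then have "AE z in \<nu>. \<forall>N. \<exists>j. \<exists>x\<in>V j. \<forall>i<N. z i = code j x i" by (simp add: AE_all_countable)
    then show ?thesis by (simp add: limit_space_def)
  qed
  have shm [measurable]: "shift a \<in> measurable \<nu> \<nu>" for a
    using shift_measurable[of a] measurable_cong_sets[OF \<nu>(2) \<nu>(2)] by simp
  \<comment> \<open>\<tau> j a permutes V j and turns a code into its shift, so an event and its
    shifted version have equal frequencies. Products over finitely many coordinates determine the
    measure, and these are cylinder events.\<close>
  have inv: "distr \<nu> \<nu> (shift a) = \<nu>" for a
  proof (rule measure_eqI_PiM_infinite[where I=UNIV and M="\<lambda>_. borel"])
    show "sets (distr \<nu> \<nu> (shift a)) = sets (Pi\<^sub>M UNIV (\<lambda>_. borel))" "sets \<nu> = sets (Pi\<^sub>M UNIV (\<lambda>_. borel))"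
      using \<nu>(2) sets_PiM_equal_borel by auto
    show "finite_measure (distr \<nu> \<nu> (shift a))" by (rule \<nu>.finite_measure_distr[OF shm])
    fix A :: "nat \<Rightarrow> real set" and J :: "nat set" assume J: "finite J" and A: "\<And>i. i \<in> J \<Longrightarrow> A i \<in> sets borel"
    define C where "C = {z. \<forall>i\<in>J. z i \<in> A i}"
    have Ceq: "prod_emb UNIV (\<lambda>_. borel) J (Pi\<^sub>E J A) = C"
      unfolding prod_emb_def C_def by (auto simp: space_PiM PiE_iff)
    have Cs: "C \<in> sets \<nu>"
      using J A \<nu>(2) sets_PiM_equal_borel sets_PiM_I[of J UNIV A "\<lambda>_. borel"] unfolding Ceq by auto
    let ?\<pi> = "\<lambda>n. coord (list_decode (fst (prod_decode n)) @ [a]) (snd (prod_decode n))"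
    obtain N where N: "\<forall>i\<in>J \<union> ?\<pi> ` J. i < N" using J finite_nat_set_iff_bounded[of "J \<union> ?\<pi> ` J"] by blast
    have Q1: "cylinder_event N (\<lambda>z. z \<in> C)"
      using N unfolding C_def cylinder_event_def by auto
    have Q2: "cylinder_event N (\<lambda>z. shift a z \<in> C)"
      using N unfolding C_def cylinder_event_def shift_def by auto
    have "card {x \<in> V j. shift a (code j x) \<in> C} = card {x \<in> V j. code j x \<in> C}" for j
    proof (rule bij_betw_same_card[of "\<tau> j a"], unfold bij_betw_def shift_code, intro conjI)
      show "inj_on (\<tau> j a) {x \<in> V j. code j (\<tau> j a x) \<in> C}" using \<tau>\<tau> by (intro inj_onI) (metis (mono_tags) mem_Collect_eq)
      show "\<tau> j a ` {x \<in> V j. code j (\<tau> j a x) \<in> C} = {x \<in> V j. code j x \<in> C}"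
      proof (intro set_eqI iffI)
        fix y assume "y \<in> {x \<in> V j. code j x \<in> C}"
        then show "y \<in> \<tau> j a ` {x \<in> V j. code j (\<tau> j a x) \<in> C}"
          using \<tau>\<tau>[of y j a] \<tau>V[of y j a] by (intro image_eqI[of _ _ "\<tau> j a y"]) auto
      qed (use \<tau>V in auto)
    qed
    then have "measure \<nu> {z \<in> binary_seqs. shift a z \<in> C} = measure \<nu> {z \<in> binary_seqs. z \<in> C}"
      using LIMSEQ_unique[OF cyl_lim[of N "\<lambda>z. shift a z \<in> C", OF Q2]] cyl_lim[of N "\<lambda>z. z \<in> C", OF Q1] by simp
    moreover have "measure \<nu> {z \<in> binary_seqs. shift a z \<in> C} = measure \<nu> (shift a -` C \<inter> space \<nu>)"
    proof (rule measure_eq_AE)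
      show "AE z in \<nu>. z \<in> {z \<in> binary_seqs. shift a z \<in> C} \<longleftrightarrow> z \<in> shift a -` C \<inter> space \<nu>"
        using AE_bin by eventually_elim (auto simp: sp\<nu>)
      show "shift a -` C \<inter> space \<nu> \<in> sets \<nu>" using measurable_sets[OF shm Cs] .
      show "{z \<in> binary_seqs. shift a z \<in> C} \<in> sets \<nu>" using cyl_sets[of N "\<lambda>z. shift a z \<in> C", OF Q2] \<nu>(2) by simp
    qed
    moreover have "measure \<nu> {z \<in> binary_seqs. z \<in> C} = measure \<nu> C"
    proof (rule measure_eq_AE)
      show "AE z in \<nu>. z \<in> {z \<in> binary_seqs. z \<in> C} \<longleftrightarrow> z \<in> C" using AE_bin by eventually_elim auto
      show "{z \<in> binary_seqs. z \<in> C} \<in> sets \<nu>" using cyl_sets[of N "\<lambda>z. z \<in> C", OF Q1] \<nu>(2) by simp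
    qed (rule Cs)
    ultimately show "emeasure (distr \<nu> \<nu> (shift a)) (prod_emb UNIV (\<lambda>_. borel) J (Pi\<^sub>E J A)) =
        emeasure \<nu> (prod_emb UNIV (\<lambda>_. borel) J (Pi\<^sub>E J A))"
      unfolding Ceq by (simp add: emeasure_distr[OF shm Cs] \<nu>.emeasure_eq_measure)
  qed
  \<comment> \<open>The shifts are known to be involutions on the limit space only, while
    \<open>graphing_of_involutions\<close> asks for this at every point.\<close>
  define N0 where "N0 = restrict_space \<nu> ?\<Omega>"
  have spN0: "space N0 = ?\<Omega>" by (simp add: N0_def space_restrict_space sp\<nu>)
  have setsN0: "sets N0 = (\<inter>) ?\<Omega> ` sets borel" by (simp add: N0_def sets_restrict_space \<nu>(2))
  have em0: "emeasure N0 A = emeasure \<nu> A" if "A \<subseteq> ?\<Omega>" for A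
    unfolding N0_def using that \<Omega>_sets by (intro emeasure_restrict_space) (auto simp: sp\<nu>)
  have "emeasure \<nu> ?\<Omega> = 1"
    using \<nu>.prob_eq_1[OF \<Omega>_sets] AE_\<Omega> by (simp add: \<nu>.emeasure_eq_measure)
  then interpret N0: prob_space N0 by (intro prob_spaceI) (simp add: spN0 em0)
  have sub0: "A \<in> sets \<nu>" "A \<subseteq> ?\<Omega>" if "A \<in> sets N0" for A using that \<Omega>_sets \<nu>(2) unfolding setsN0 by auto
  have shN0: "shift a \<in> measurable N0 N0" for a
    unfolding N0_def using shift_limit_space
    by (intro measurable_restrict_space3 shm) (auto simp: sp\<nu>)
  have invN0: "distr N0 N0 (shift a) = N0" for a
  proof (rule measure_eqI)
    fix A assume "A \<in> sets (distr N0 N0 (shift a))"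
    then have A: "A \<in> sets N0" by simp
    have "emeasure (distr N0 N0 (shift a)) A = emeasure \<nu> (shift a -` A \<inter> ?\<Omega>)"
      using emeasure_distr[OF shN0 A] em0[of "shift a -` A \<inter> ?\<Omega>"] by (simp add: spN0)
    also have "\<dots> = emeasure \<nu> (shift a -` A \<inter> space \<nu>)"
      using AE_\<Omega> measurable_sets[OF shm sub0(1)[OF A]] \<Omega>_sets
      by (intro emeasure_eq_AE) (auto simp: sp\<nu>)
    also have "\<dots> = emeasure (distr \<nu> \<nu> (shift a)) A" using emeasure_distr[OF shm sub0(1)[OF A]] by simp
    also have "\<dots> = emeasure N0 A" unfolding inv using em0[OF sub0(2)[OF A]] by simp
    finally show "emeasure (distr N0 N0 (shift a)) A = emeasure N0 A" .
  qed simp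
  have \<iota>\<Omega>: "inj_on \<iota> ?\<Omega>" using inj_on_subset[OF \<iota> limit_space_binary] .
  define \<kappa> where "\<kappa> = inv_into ?\<Omega> \<iota>"
  have \<kappa>\<iota>: "\<kappa> (\<iota> z) = z" if "z \<in> ?\<Omega>" for z using inv_into_f_f[OF \<iota>\<Omega> that] by (simp add: \<kappa>_def)
  \<comment> \<open>The limit must live on the vertex type of the finite graphs, because
    \<open>local_conv\<close> relates graphings on one type.\<close>
  define M where "M = embed_measure N0 \<iota>"
  have injN0: "inj_on \<iota> (space N0)" using \<iota>\<Omega> by (simp add: spN0)
  have spM: "space M = \<iota> ` ?\<Omega>" by (simp add: M_def space_embed_measure spN0)
  have setsM: "sets M = {\<iota> ` A | A. A \<in> sets N0}" unfolding M_def by (rule sets_embed_measure'[OF injN0])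
  have \<iota>m: "\<iota> \<in> measurable N0 M" unfolding M_def by (rule measurable_embed_measure2'[OF injN0])
  have Mdistr: "M = distr N0 M \<iota>" unfolding M_def by (rule embed_measure_eq_distr'[OF injN0])
  have std: "standard_borel M"
  proof (rule standard_borel_closed_embedding[of \<kappa>])
    show "inj_on \<kappa> (space M)" unfolding spM using \<kappa>\<iota> by (auto intro!: inj_onI)
    have "\<kappa> ` space M = ?\<Omega>" unfolding spM image_image using \<kappa>\<iota> by simp
    then show "closed (\<kappa> ` space M)" using closed_limit_space by simp
    have im: "\<iota> ` (?\<Omega> \<inter> B) = \<kappa> -` B \<inter> space M" for B unfolding spM using \<kappa>\<iota> by auto
    show "sets M = {\<kappa> -` B \<inter> space M |B. B \<in> sets borel}"
      unfolding setsM setsN0 im[symmetric] by auto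
  qed
  have probM: "prob_space M" by (subst Mdistr) (rule N0.prob_space_distr[OF \<iota>m])
  define \<sigma> where "\<sigma> a y = \<iota> (shift a (\<kappa> y))" for a y
  have \<sigma>\<iota>: "\<sigma> a (\<iota> z) = \<iota> (shift a z)" if "z \<in> ?\<Omega>" for a z using \<kappa>\<iota>[OF that] by (simp add: \<sigma>_def)
  have \<iota>shm: "(\<lambda>z. \<iota> (shift a z)) \<in> measurable N0 M" for a using measurable_comp[OF shN0 \<iota>m] by (simp add: o_def)
  have \<sigma>m: "\<sigma> a \<in> measurable M M" for a
  proof -
    have "(\<lambda>z. \<sigma> a (\<iota> z)) \<in> measurable N0 M"
      by (rule measurable_cong[THEN iffD2, OF _ \<iota>shm]) (simp add: spN0 \<sigma>\<iota>)
    then show ?thesis unfolding M_def by (rule measurable_embed_measure1)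
  qed
  have "distr M M (\<sigma> a) = M" for a
  proof -
    have "distr M M (\<sigma> a) = distr (distr N0 M \<iota>) M (\<sigma> a)" using Mdistr by simp
    also have "\<dots> = distr N0 M (\<sigma> a \<circ> \<iota>)" by (rule distr_distr[OF \<sigma>m \<iota>m])
    also have "\<dots> = distr N0 M (\<iota> \<circ> shift a)" by (rule distr_cong) (auto simp: spN0 \<sigma>\<iota>)
    also have "\<dots> = distr (distr N0 N0 (shift a)) M \<iota>" by (rule distr_distr[symmetric, OF \<iota>m shN0])
    finally show ?thesis unfolding invN0 using Mdistr by simp
  qed
  moreover have \<sigma>\<sigma>: "\<sigma> a y \<in> space M \<and> \<sigma> a (\<sigma> a y) = y" if "y \<in> space M" for a y
    using that shift_shift shift_limit_space unfolding spM by (auto simp: \<sigma>\<iota>)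
  ultimately have graphing: "graphing (M, involution_edges (space M) m \<sigma>)"
    using graphing_of_involutions[OF std probM, of m \<sigma>] \<sigma>m by blast
  let ?E = "involution_edges (space M) m \<sigma>"
  have gen: "generated_graph (space M) ?E m \<sigma>"
  proof
    fix x y assume "x \<in> space M"
    then show "{x, y} \<in> ?E \<longleftrightarrow> x \<noteq> y \<and> (\<exists>a<m. y = \<sigma> a x)"
      using involution_edges_iff[of m "space M" \<sigma> x y] \<sigma>\<sigma> by blast
  qed (use \<sigma>\<sigma> in blast)
  have foldr\<sigma>: "foldr shift w z \<in> ?\<Omega> \<and> foldr \<sigma> w (\<iota> z) = \<iota> (foldr shift w z)" if "z \<in> ?\<Omega>" for w z
    using that by (induction w) (auto simp: \<sigma>\<iota> shift_limit_space)
  have "(\<lambda>j. P_loc (as_graphing (V (\<rho> j)) (E (\<rho> j))) r \<alpha>) \<longlonglongrightarrow> P_loc (M, ?E) r \<alpha>" if \<alpha>: "rooted_graph r \<alpha>" for r \<alpha>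
  proof -
    obtain N where N: "\<And>z j x. z \<in> ?\<Omega> \<Longrightarrow> x \<in> V j \<Longrightarrow> \<forall>i<N. z i = code j x i \<Longrightarrow> ball_eqv r limit_edges (\<lambda>_. 0) z (E j) (\<lambda>_. 0) x"
      using limit_ball_eqv[of r] by blast
    \<comment> \<open>A cylinder event that looks up the ball in any finite graph whose code agrees
      with z up to N; on the limit space the choice does not matter and Q is the ball event
      itself.\<close>
    define Q where "Q z \<longleftrightarrow> (\<exists>j. \<exists>x\<in>V j. (\<forall>i<N. z i = code j x i) \<and> ball_iso (E j) r x \<alpha>)" for z
    have Qcyl: "cylinder_event N Q" unfolding Q_def cylinder_event_def by auto
    have Q\<Omega>: "Q z \<longleftrightarrow> ball_iso limit_edges r z \<alpha>" if z: "z \<in> ?\<Omega>" for z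
    proof
      assume "Q z" then show "ball_iso limit_edges r z \<alpha>" unfolding Q_def using ball_iso_cong[OF \<alpha> N[OF z]] by blast
    next
      assume b: "ball_iso limit_edges r z \<alpha>"
      obtain j x where x: "x \<in> V j" "\<forall>i<N. z i = code j x i" using z unfolding limit_space_def by blast
      then show "Q z" unfolding Q_def using ball_iso_cong[OF \<alpha> N[OF z x]] b by blast
    qed
    have Qcode: "ball_iso (E j) r x \<alpha> \<longleftrightarrow> Q (code j x)" if x: "x \<in> V j" for j x
      using Q\<Omega>[OF code_in_limit_space[OF x]] ball_iso_cong[OF \<alpha> N[OF code_in_limit_space[OF x] x]] by simp
    have Q\<iota>: "ball_iso ?E r (\<iota> z) \<alpha> \<longleftrightarrow> Q z" if z: "z \<in> ?\<Omega>" for z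
    proof -
      have "ball_eqv r limit_edges (\<lambda>_. 0) z ?E (\<lambda>_. 0) (\<iota> z)"
        by (rule generated_ball_eqv[OF generated_limit gen z])
          (use z foldr\<sigma>[OF z] \<iota>\<Omega> in \<open>auto simp: spM dest: inj_onD\<close>)
      from ball_iso_cong[OF \<alpha> this] Q\<Omega>[OF z] show ?thesis by simp
    qed
    have Qs: "{z \<in> binary_seqs. Q z} \<in> sets \<nu>" using cyl_sets[of N Q, OF Qcyl] \<nu>(2) by simp
    have Q0: "{z \<in> ?\<Omega>. Q z} \<in> sets N0"
    proof -
      have "{z \<in> ?\<Omega>. Q z} = ?\<Omega> \<inter> {z \<in> binary_seqs. Q z}" using limit_space_binary by auto
      then show ?thesis using Qs \<nu>(2) unfolding setsN0 by auto
    qed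
    have "{y \<in> space M. ball_iso ?E r y \<alpha>} = \<iota> ` {z \<in> ?\<Omega>. Q z}" using Q\<iota> by (auto simp: spM)
    then have "P_loc (M, ?E) r \<alpha> = measure M (\<iota> ` {z \<in> ?\<Omega>. Q z})" unfolding P_loc_def by simp
    also have "\<dots> = measure N0 {z \<in> ?\<Omega>. Q z}"
    proof -
      have "\<iota> ` {z \<in> ?\<Omega>. Q z} \<in> sets (embed_measure N0 \<iota>)" using setsM Q0 unfolding M_def by blast
      from emeasure_embed_measure'[OF injN0 this]
      have "emeasure M (\<iota> ` {z \<in> ?\<Omega>. Q z}) = emeasure N0 (\<iota> -` \<iota> ` {z \<in> ?\<Omega>. Q z} \<inter> ?\<Omega>)" unfolding M_def spN0 .
      also have "\<iota> -` \<iota> ` {z \<in> ?\<Omega>. Q z} \<inter> ?\<Omega> = {z \<in> ?\<Omega>. Q z}" using \<iota>\<Omega> by (auto dest: inj_onD)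
      finally show ?thesis by (simp add: measure_def)
    qed
    also have "\<dots> = measure \<nu> {z \<in> ?\<Omega>. Q z}" using em0[of "{z \<in> ?\<Omega>. Q z}"] by (simp add: measure_def)
    also have "\<dots> = measure \<nu> {z \<in> binary_seqs. Q z}"
    proof (rule measure_eq_AE)
      show "AE z in \<nu>. z \<in> {z \<in> ?\<Omega>. Q z} \<longleftrightarrow> z \<in> {z \<in> binary_seqs. Q z}"
        using AE_\<Omega> by eventually_elim (use limit_space_binary in auto)
    qed (use Qs sub0(1)[OF Q0] in auto)
    finally have lim: "P_loc (M, ?E) r \<alpha> = measure \<nu> {z \<in> binary_seqs. Q z}" .
    have "{x \<in> V j. ball_iso (E j) r x \<alpha>} = {x \<in> V j. Q (code j x)}" for j using Qcode by auto
    then have "P_loc (as_graphing (V j) (E j)) r \<alpha> = real (card {x \<in> V j. Q (code j x)}) / real (card (V j))" for j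
      using P_loc_finite[OF fin] by simp
    then show ?thesis unfolding lim using cyl_lim[of N Q, OF Qcyl] by simp
  qed
  then have "local_conv (\<lambda>j. as_graphing (V (\<rho> j)) (E (\<rho> j))) (M, ?E)" unfolding local_conv_def by blast
  then show ?thesis using \<rho> graphing by blast
qed

end

text \<open>A proper edge colouring, obtained greedily with 2 * D + 1 colours, since an edge meets
  at most 2 * D edges, itself included. Involution a swaps the ends of each edge of colour a and
  fixes all other vertices.\<close>

lemma finite_graph_involutions:
  assumes G: "fin_graph D V E"
  shows "\<exists>\<tau>. (\<forall>x\<in>V. \<forall>a. \<tau> a x \<in> V \<and> \<tau> a (\<tau> a x) = x \<and> (a \<ge> Suc (2 * D) \<longrightarrow> \<tau> a x = x)) \<and>
     (\<forall>x\<in>V. \<forall>y. {x, y} \<in> E \<longleftrightarrow> x \<noteq> y \<and> (\<exists>a<Suc (2 * D). y = \<tau> a x))"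
proof -
  have V: "finite V" "edges_in V E" "bounded_degree V E D" using G unfolding fin_graph_def by auto
  have "E \<subseteq> Pow V" using V(2) unfolding edges_in_def by fastforce
  then have fE: "finite E" using V(1) finite_subset by blast
  have card: "card {e' \<in> E. e \<inter> e' \<noteq> {}} \<le> 2 * D" if eE: "e \<in> E" for e
  proof -
    obtain x y where e: "e = {x, y}" "x \<in> V" "y \<in> V" using V(2) eE unfolding edges_in_def by blast
    have star: "finite {e' \<in> E. x \<in> e'} \<and> card {e' \<in> E. x \<in> e'} \<le> D" if "x \<in> V" for x
    proof -
      have "{e' \<in> E. x \<in> e'} \<subseteq> (\<lambda>y. {x, y}) ` {y. {x, y} \<in> E}"
      proof
        fix e' assume e': "e' \<in> {e' \<in> E. x \<in> e'}"
        then obtain u v where "e' = {u, v}" using V(2) unfolding edges_in_def by blast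
        then have "\<exists>y. e' = {x, y}" using e' by blast
        then show "e' \<in> (\<lambda>y. {x, y}) ` {y. {x, y} \<in> E}" using e' by blast
      qed
      moreover have nb: "finite {y. {x, y} \<in> E}" "card {y. {x, y} \<in> E} \<le> D" using V(3) that unfolding bounded_degree_def by auto
      ultimately show ?thesis by (meson card_image_le card_mono finite_imageI finite_subset order_trans)
    qed
    have "{e' \<in> E. e \<inter> e' \<noteq> {}} \<subseteq> {e' \<in> E. x \<in> e'} \<union> {e' \<in> E. y \<in> e'}" unfolding e by auto
    then have "card {e' \<in> E. e \<inter> e' \<noteq> {}} \<le> card ({e' \<in> E. x \<in> e'} \<union> {e' \<in> E. y \<in> e'})"
      using star e by (intro card_mono) auto
    also have "\<dots> \<le> card {e' \<in> E. x \<in> e'} + card {e' \<in> E. y \<in> e'}" by (rule card_Un_le)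
    also have "\<dots> \<le> 2 * D" using star[OF e(2)] star[OF e(3)] by simp
    finally show ?thesis .
  qed
  have symm: "y \<inter> x \<noteq> {}" if "x \<inter> y \<noteq> {}" for x y :: "'a set" using that by blast
  have "\<exists>a :: 'a set \<Rightarrow> nat. (\<forall>x\<in>E. a x \<le> 2 * D) \<and> (\<forall>x\<in>E. \<forall>y\<in>E. x \<inter> y \<noteq> {} \<longrightarrow> x \<noteq> y \<longrightarrow> a x \<noteq> a y)"
    by (rule greedy_coloring[OF fE symm card])
  then obtain \<kappa> :: "'a set \<Rightarrow> nat" where \<kappa>: "\<forall>e\<in>E. \<kappa> e \<le> 2 * D" "\<forall>x\<in>E. \<forall>y\<in>E. x \<inter> y \<noteq> {} \<longrightarrow> x \<noteq> y \<longrightarrow> \<kappa> x \<noteq> \<kappa> y"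
    by (elim exE conjE)
  have uniq: "y = z" if yz: "{x, y} \<in> E" "{x, z} \<in> E" "\<kappa> {x, y} = \<kappa> {x, z}" for x y z
  proof -
    have "{x, y} \<inter> {x, z} \<noteq> {}" by simp
    then have "{x, y} = {x, z}" using \<kappa>(2)[rule_format, OF yz(1,2)] yz(3) by auto
    then show ?thesis by (auto simp: doubleton_eq_iff)
  qed
  define \<tau> where "\<tau> a x = (if \<exists>y. {x, y} \<in> E \<and> \<kappa> {x, y} = a then THE y. {x, y} \<in> E \<and> \<kappa> {x, y} = a else x)" for a x
  have \<tau>1: "\<tau> (\<kappa> {x, y}) x = y" if "{x, y} \<in> E" for x y
  proof -
    have "(THE z. {x, z} \<in> E \<and> \<kappa> {x, z} = \<kappa> {x, y}) = y"
      by (rule the_equality) (use that uniq in auto)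
    then show ?thesis unfolding \<tau>_def using that by auto
  qed
  have \<tau>2: "\<tau> a x = x \<or> ({x, \<tau> a x} \<in> E \<and> \<kappa> {x, \<tau> a x} = a)" for a x
  proof (cases "\<exists>y. {x, y} \<in> E \<and> \<kappa> {x, y} = a")
    case True
    then obtain y where "{x, y} \<in> E" "\<kappa> {x, y} = a" by blast
    then show ?thesis using \<tau>1[of x y] by simp
  qed (unfold \<tau>_def, simp only: if_False simp_thms)
  show ?thesis
  proof (intro exI[of _ \<tau>] conjI ballI allI impI)
    fix x a assume x: "x \<in> V"
    show "\<tau> a x \<in> V" using \<tau>2[of a x] x edges_inD(2)[OF V(2), of x "\<tau> a x"] by metis
    show "\<tau> a (\<tau> a x) = x" using \<tau>2[of a x] \<tau>1[of "\<tau> a x" x] by (metis insert_commute)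
    show "\<tau> a x = x" if "Suc (2 * D) \<le> a" using \<tau>2[of a x] \<kappa>(1) that by fastforce
  next
    fix x y assume x: "x \<in> V"
    show "{x, y} \<in> E \<longleftrightarrow> x \<noteq> y \<and> (\<exists>a<Suc (2 * D). y = \<tau> a x)"
    proof
      assume e: "{x, y} \<in> E"
      then show "x \<noteq> y \<and> (\<exists>a<Suc (2 * D). y = \<tau> a x)"
        using \<tau>1[OF e] \<kappa>(1) edges_inD(3)[OF V(2) e] by (metis less_Suc_eq_le)
    next
      assume "x \<noteq> y \<and> (\<exists>a<Suc (2 * D). y = \<tau> a x)"
      then show "{x, y} \<in> E" using \<tau>2[of _ x] by metis
    qed
  qed
qed

lemma involution_codes_exist:
  assumes G: "\<And>j. fin_graph D (V j) (E j)"
  shows "\<exists>m \<tau> lab. involution_codes V E m \<tau> lab"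
proof -
  have "\<forall>j. \<exists>\<tau>. (\<forall>x\<in>V j. \<forall>a. \<tau> a x \<in> V j \<and> \<tau> a (\<tau> a x) = x \<and> (a \<ge> Suc (2 * D) \<longrightarrow> \<tau> a x = x)) \<and>
     (\<forall>x\<in>V j. \<forall>y. {x, y} \<in> E j \<longleftrightarrow> x \<noteq> y \<and> (\<exists>a<Suc (2 * D). y = \<tau> a x))"
    using finite_graph_involutions[OF G] by blast
  from choice[OF this] obtain \<tau> where
    "\<forall>j. (\<forall>x\<in>V j. \<forall>a. \<tau> j a x \<in> V j \<and> \<tau> j a (\<tau> j a x) = x \<and> (a \<ge> Suc (2 * D) \<longrightarrow> \<tau> j a x = x)) \<and>
     (\<forall>x\<in>V j. \<forall>y. {x, y} \<in> E j \<longleftrightarrow> x \<noteq> y \<and> (\<exists>a<Suc (2 * D). y = \<tau> j a x))" ..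
  then have \<tau>: "\<And>j x a. x \<in> V j \<Longrightarrow> \<tau> j a x \<in> V j \<and> \<tau> j a (\<tau> j a x) = x \<and> (a \<ge> Suc (2 * D) \<longrightarrow> \<tau> j a x = x)"
    "\<And>j x y. x \<in> V j \<Longrightarrow> {x, y} \<in> E j \<longleftrightarrow> x \<noteq> y \<and> (\<exists>a<Suc (2 * D). y = \<tau> j a x)" by simp_all
  have "\<forall>p. \<exists>c :: 'a \<Rightarrow> nat. (\<forall>x\<in>V (fst p). c x < Suc (Suc D ^ snd p)) \<and>
      (\<forall>x\<in>V (fst p). \<forall>y\<in>ball (E (fst p)) (snd p) x. c x = c y \<longrightarrow> x = y)"
  proof
    fix p :: "nat \<times> nat"
    obtain c :: "'a \<Rightarrow> nat" where "\<And>x. x \<in> V (fst p) \<Longrightarrow> c x < Suc (Suc D ^ snd p)"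
      "\<And>x y. x \<in> V (fst p) \<Longrightarrow> y \<in> ball (E (fst p)) (snd p) x \<Longrightarrow> c x = c y \<Longrightarrow> x = y"
      by (rule ball_coloring[OF G, of "fst p" "snd p"]) blast
    then show "\<exists>c :: 'a \<Rightarrow> nat. (\<forall>x\<in>V (fst p). c x < Suc (Suc D ^ snd p)) \<and>
      (\<forall>x\<in>V (fst p). \<forall>y\<in>ball (E (fst p)) (snd p) x. c x = c y \<longrightarrow> x = y)" by blast
  qed
  from choice[OF this] obtain c' where c': "\<forall>p. (\<forall>x\<in>V (fst p). c' p x < Suc (Suc D ^ snd p)) \<and>
      (\<forall>x\<in>V (fst p). \<forall>y\<in>ball (E (fst p)) (snd p) x. c' p x = (c' p y :: nat) \<longrightarrow> x = y)" ..
  \<comment> \<open>The colourings for all radii are stored in unary: bit (R, c) tells whether x has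
    colour c in the R-th colouring. The number of colours for R does not depend on j, hence neither
    does the number of bits that separate vertices within distance R.\<close>
  define lab where "lab j x i = (if c' (j, fst (prod_decode i)) x = snd (prod_decode i) then 1 else 0 :: real)" for j x i
  have "\<exists>N. \<forall>j. \<forall>x\<in>V j. \<forall>y\<in>ball (E j) R x. (\<forall>i<N. lab j x i = lab j y i) \<longrightarrow> x = y" for R
  proof -
    obtain N where N: "\<forall>i\<in>(\<lambda>c. prod_encode (R, c)) ` {..<Suc (Suc D ^ R)}. i < N"
      using finite_nat_set_iff_bounded[of "(\<lambda>c. prod_encode (R, c)) ` {..<Suc (Suc D ^ R)}"] by blast
    have "x = y" if x: "x \<in> V j" and y: "y \<in> ball (E j) R x" and eq: "\<forall>i<N. lab j x i = lab j y i" for j x y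
    proof -
      have "c' (j, R) x < Suc (Suc D ^ R)" using c' x by fastforce
      then have "prod_encode (R, c' (j, R) x) < N" using N by blast
      then have "lab j x (prod_encode (R, c' (j, R) x)) = lab j y (prod_encode (R, c' (j, R) x))" using eq by blast
      then have "c' (j, R) x = c' (j, R) y" by (simp add: lab_def split: if_splits)
      moreover have "\<forall>x\<in>V j. \<forall>y\<in>ball (E j) R x. c' (j, R) x = c' (j, R) y \<longrightarrow> x = y" using c'[rule_format, of "(j, R)"] by simp
      ultimately show ?thesis using x y by blast
    qed
    then show ?thesis by blast
  qed
  then have "involution_codes V E (Suc (2 * D)) \<tau> lab"
    using G \<tau> unfolding involution_codes_def fin_graph_def by (auto simp: lab_def)
  then show ?thesis by blast
qed

text \<open>Moving a graph to an initial segment of the natural numbers leaves only finitely many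
  graphs of bounded size, whatever vertex sets they came from.\<close>

lemma finite_graph_on_nat:
  assumes G: "fin_graph D V E"
  shows "\<exists>A\<subseteq>Pow {..<card V}. \<forall>r \<alpha>. rooted_graph r \<alpha> \<longrightarrow> P_loc (as_graphing V E) r \<alpha> = P_loc (as_graphing {..<card V} A) r \<alpha>"
proof -
  have V: "finite V" "edges_in V E" using G unfolding fin_graph_def by auto
  obtain h where h: "bij_betw h V {..<card V}"
    using ex_bij_betw_finite_nat[OF V(1)] by (auto simp: atLeast0LessThan)
  have inj: "h y = h z \<longleftrightarrow> y = z" if "y \<in> V" "z \<in> V" for y z
    using h that unfolding bij_betw_def by (auto dest: inj_onD)
  have hV: "h y < card V" if "y \<in> V" for y using h that unfolding bij_betw_def by auto
  define A where "A = {{h y, h z} | y z. {y, z} \<in> E}"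
  have adj: "{y, z} \<in> E \<longleftrightarrow> {h y, h z} \<in> A" if "y \<in> V" "z \<in> V" for y z
  proof
    assume "{h y, h z} \<in> A"
    then obtain y' z' where yz: "{h y, h z} = {h y', h z'}" "{y', z'} \<in> E" unfolding A_def by blast
    then show "{y, z} \<in> E" using inj that edges_inD(1,2)[OF V(2) yz(2)] by (auto simp: doubleton_eq_iff insert_commute)
  qed (auto simp: A_def)
  have edA: "edges_in {..<card V} A"
    unfolding edges_in_def
  proof
    fix e assume "e \<in> A"
    then obtain y z where yz: "e = {h y, h z}" "{y, z} \<in> E" unfolding A_def by blast
    then show "\<exists>x y. x \<noteq> y \<and> x \<in> {..<card V} \<and> y \<in> {..<card V} \<and> e = {x, y}"
      using hV inj edges_inD[OF V(2) yz(2)] by (intro exI[of _ "h y"] exI[of _ "h z"]) auto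
  qed
  have "P_loc (as_graphing V E) r \<alpha> = P_loc (as_graphing {..<card V} A) r \<alpha>" if \<alpha>: "rooted_graph r \<alpha>" for r \<alpha>
  proof -
    have iso: "ball_iso E r x \<alpha> \<longleftrightarrow> ball_iso A r (h x) \<alpha>" if x: "x \<in> V" for x
    proof (rule ball_iso_cong[OF \<alpha>])
      have "bij_betw h (ball E r x) (ball A r (h x))"
        by (rule bij_betw_ball[OF h x ball_subset[OF V(2) x] ball_subset[OF edA]]) (use hV x adj in auto)
      then show "ball_eqv r E (\<lambda>_. 0) x A (\<lambda>_. 0) (h x)"
        unfolding ball_eqv_def using adj ball_subset[OF V(2) x, of r] by (intro exI[of _ h]) blast
    qed
    have "card {x \<in> V. ball_iso E r x \<alpha>} = card {y \<in> {..<card V}. ball_iso A r y \<alpha>}"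
    proof (rule bij_betw_same_card[of h], unfold bij_betw_def, intro conjI)
      show "inj_on h {x \<in> V. ball_iso E r x \<alpha>}" using h unfolding bij_betw_def by (auto intro: inj_on_subset)
      have "h ` V = {..<card V}" using h unfolding bij_betw_def by simp
      moreover have "h ` {x \<in> V. ball_iso E r x \<alpha>} = h ` {x \<in> V. ball_iso A r (h x) \<alpha>}" using iso by (metis (mono_tags, lifting) Collect_cong)
      moreover have "h ` {x \<in> V. ball_iso A r (h x) \<alpha>} = {y \<in> h ` V. ball_iso A r y \<alpha>}" by auto
      ultimately show "h ` {x \<in> V. ball_iso E r x \<alpha>} = {y \<in> {..<card V}. ball_iso A r y \<alpha>}" by simp
    qed
    then show ?thesis using P_loc_finite[OF V(1)] P_loc_finite[of "{..<card V}"] by simp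
  qed
  moreover have "A \<subseteq> Pow {..<card V}" using edA unfolding edges_in_def by fastforce
  ultimately show ?thesis by blast
qed

text \<open>If the sizes are bounded, a subsequence has constant statistics and one of its own
  members is the limit, so no new vertices are needed; this is the case that a small vertex type
  requires.\<close>

theorem local_compactness:
  fixes V :: "nat \<Rightarrow> 'a set"
  assumes G: "\<And>j. fin_graph D (V j) (E j)"
    and large: "(\<exists>\<iota> :: (nat \<Rightarrow> real) \<Rightarrow> 'a. inj_on \<iota> binary_seqs) \<or> (\<exists>N. \<forall>j. card (V j) \<le> N)"
  shows "\<exists>\<rho> H. strict_mono \<rho> \<and> graphing (H :: 'a graphing) \<and> local_conv (\<lambda>j. as_graphing (V (\<rho> j)) (E (\<rho> j))) H"
  using large
proof
  assume "\<exists>\<iota> :: (nat \<Rightarrow> real) \<Rightarrow> 'a. inj_on \<iota> binary_seqs"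
  then obtain \<iota> :: "(nat \<Rightarrow> real) \<Rightarrow> 'a" where \<iota>: "inj_on \<iota> binary_seqs" ..
  obtain m \<tau> lab where "involution_codes V E m \<tau> lab" using involution_codes_exist[of D V E, OF G] by blast
  from involution_codes.local_limit[OF this \<iota>] show ?thesis .
next
  assume "\<exists>N. \<forall>j. card (V j) \<le> N"
  then obtain N where N: "\<And>j. card (V j) \<le> N" by blast
  have "\<forall>j. \<exists>A\<subseteq>Pow {..<card (V j)}. \<forall>r \<alpha>. rooted_graph r \<alpha> \<longrightarrow>
      P_loc (as_graphing (V j) (E j)) r \<alpha> = P_loc (as_graphing {..<card (V j)} A) r \<alpha>"
    using finite_graph_on_nat[OF G] by blast
  then have "\<forall>j. \<exists>A. A \<subseteq> Pow {..<card (V j)} \<and> (\<forall>r \<alpha>. rooted_graph r \<alpha> \<longrightarrow>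
      P_loc (as_graphing (V j) (E j)) r \<alpha> = P_loc (as_graphing {..<card (V j)} A) r \<alpha>)" by simp
  from choice[OF this] obtain A where "\<forall>j. A j \<subseteq> Pow {..<card (V j)} \<and> (\<forall>r \<alpha>. rooted_graph r \<alpha> \<longrightarrow>
      P_loc (as_graphing (V j) (E j)) r \<alpha> = P_loc (as_graphing {..<card (V j)} (A j)) r \<alpha>)" ..
  then have A: "\<And>j. A j \<subseteq> Pow {..<card (V j)}"
    "\<And>j r \<alpha>. rooted_graph r \<alpha> \<Longrightarrow> P_loc (as_graphing (V j) (E j)) r \<alpha> = P_loc (as_graphing {..<card (V j)} (A j)) r \<alpha>"
    by blast+
  define T where "T j = (card (V j), A j)" for j
  have "range T \<subseteq> {..N} \<times> Pow (Pow {..<N})"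
  proof (rule image_subsetI)
    fix j
    have "Pow {..<card (V j)} \<subseteq> Pow {..<N}" using N[of j] by auto
    then show "T j \<in> {..N} \<times> Pow (Pow {..<N})" using A(1)[of j] N[of j] by (auto simp: T_def)
  qed
  then have "finite (range T)" by (rule finite_subset) auto
  then obtain j0 where inf: "infinite {j \<in> UNIV. T j = T j0}" using pigeonhole_infinite[of UNIV T] by auto
  then obtain \<rho> :: "nat \<Rightarrow> nat" where \<rho>: "strict_mono \<rho>" "\<And>n. T (\<rho> n) = T j0"
    using infinite_enumerate[OF inf] by auto
  have "P_loc (as_graphing (V (\<rho> n)) (E (\<rho> n))) r \<alpha> = P_loc (as_graphing (V j0) (E j0)) r \<alpha>" if "rooted_graph r \<alpha>" for n r \<alpha>
    using A(2)[OF that] \<rho>(2)[of n] by (simp add: T_def)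
  then have "local_conv (\<lambda>j. as_graphing (V (\<rho> j)) (E (\<rho> j))) (as_graphing (V j0) (E j0))"
    unfolding local_conv_def by simp
  then show ?thesis using \<rho>(1) graphing_finite[OF G] by blast
qed

section \<open>Atoms\<close>

text \<open>The support of the measure is nonempty and perfect: an open set containing a single
  point of the support would have the measure of that point, which is zero. A nonempty perfect set
  in a Polish space has at least the size of the continuum.\<close>

lemma atomless_imp_continuum:
  fixes M :: "'a measure"
  assumes std: "standard_borel M" and M: "prob_space M" and atomless: "\<And>x. x \<in> space M \<Longrightarrow> measure M {x} = 0"
  shows "\<exists>\<iota> :: (nat \<Rightarrow> real) \<Rightarrow> 'a. inj_on \<iota> binary_seqs"
proof -
  interpret prob_space M by fact
  obtain T where T: "polish_topology T" "topspace T = space M" "sets M = borel_sets T"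
    by (rule standard_borelE[OF std])
  have ne: "topspace T \<noteq> {}" using T(2) not_empty by simp
  obtain d q where dq: "Metric_space (space M) d" "Metric_space.mtopology (space M) d = T" "range q \<subseteq> space M"
      "\<And>x e. x \<in> space M \<Longrightarrow> e > 0 \<Longrightarrow> \<exists>n. d (q (n::nat)) x < e"
    by (rule polish_topology_metric[OF T(1) ne, unfolded T(2)]) blast
  interpret Metric_space "space M" d by fact
  have qM: "q i \<in> space M" for i using dq(3) by auto
  have op: "U \<in> sets M" if "openin T U" for U using that unfolding T(3) by auto
  have sing: "{x} \<in> sets M" if "x \<in> space M" for x
  proof -
    have "closedin T {x}" using closedin_Hausdorff_singleton[OF polish_imp_Hausdorff[OF T(1)]] that T(2) by simp
    then have "space M - {x} \<in> sets M" using op T(2) unfolding closedin_def by auto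
    from sets.compl_sets[OF this] show ?thesis using that by (simp add: double_diff)
  qed
  define S where "S = {x \<in> space M. \<forall>U. openin T U \<and> x \<in> U \<longrightarrow> measure M U > 0}"
  define B where "B p = mball (q (fst p)) (inverse (real (Suc (snd p))))" for p
  have Bop: "openin T (B p)" for p unfolding B_def using openin_mball dq(2) by metis
  \<comment> \<open>The complement of the support is covered by null balls from a countable base, so
    it is null itself.\<close>
  have null: "space M - S = (\<Union>p\<in>{p. measure M (B p) = 0}. B p)"
  proof (intro set_eqI iffI)
    fix x assume "x \<in> space M - S"
    then have xM: "x \<in> space M" and "\<not> (\<forall>U. openin T U \<and> x \<in> U \<longrightarrow> measure M U > 0)" unfolding S_def by auto
    then obtain U where U: "openin T U" "x \<in> U" "measure M U = 0" by (auto simp: zero_less_measure_iff)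
    then obtain e where e: "e > 0" "mball x e \<subseteq> U" using dq(2) openin_mtopology by metis
    obtain k where k: "inverse (real (Suc k)) < e / 2" using reals_Archimedean[of "e / 2"] e by auto
    obtain i where i: "d (q i) x < inverse (real (Suc k))" using dq(4)[OF xM, of "inverse (real (Suc k))"] by auto
    have "B (i, k) \<subseteq> U"
    proof
      fix y assume "y \<in> B (i, k)"
      then have y: "y \<in> space M" "d (q i) y < inverse (real (Suc k))" by (auto simp: B_def)
      have "d x y \<le> d (q i) x + d (q i) y" using triangle''[OF xM qM y(1)] .
      then have "y \<in> mball x e" using y xM i k by simp
      then show "y \<in> U" using e by blast
    qed
    then have "measure M (B (i, k)) = 0"
      using U finite_measure_mono[OF _ op[OF U(1)], of "B (i, k)"] measure_nonneg[of M "B (i, k)"] by simp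
    moreover have "x \<in> B (i, k)" using i xM qM by (simp add: B_def)
    ultimately show "x \<in> (\<Union>p\<in>{p. measure M (B p) = 0}. B p)" by blast
  next
    fix x assume "x \<in> (\<Union>p\<in>{p. measure M (B p) = 0}. B p)"
    then obtain p where "measure M (B p) = 0" "x \<in> B p" by blast
    then show "x \<in> space M - S" using Bop[of p] openin_subset[OF Bop[of p]] T(2) unfolding S_def by force
  qed
  have "space M - S \<in> null_sets M"
    unfolding null by (rule null_sets_UN') (auto intro!: null_setsI simp: emeasure_eq_measure op[OF Bop])
  then have nullS: "space M - S \<in> sets M" "measure M (space M - S) = 0" by (auto simp: measure_eq_0_null_sets)
  have "S \<subseteq> space M" by (auto simp: S_def)
  have "S \<noteq> {}" using nullS(2) prob_space by auto
  moreover have "T derived_set_of S = S"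
  proof (intro set_eqI iffI)
    fix x assume "x \<in> T derived_set_of S"
    then have x: "x \<in> space M" "\<And>U. x \<in> U \<Longrightarrow> openin T U \<Longrightarrow> \<exists>y\<in>S. y \<in> U" unfolding in_derived_set_of T(2) by blast+
    show "x \<in> S" unfolding S_def
    proof (intro CollectI conjI allI impI x(1))
      fix U assume "openin T U \<and> x \<in> U"
      then show "measure M U > 0" using x(2)[of U] unfolding S_def by blast
    qed
  next
    fix x assume x: "x \<in> S"
    show "x \<in> T derived_set_of S"
      unfolding in_derived_set_of T(2)
    proof (intro conjI allI impI)
      show "x \<in> space M" using x by (simp add: S_def)
      fix U assume U: "x \<in> U \<and> openin T U"
      show "\<exists>y. y \<noteq> x \<and> y \<in> S \<and> y \<in> U"
      proof (rule ccontr)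
        assume "\<not> ?thesis"
        then have "U \<subseteq> {x} \<union> (space M - S)" using openin_subset[of T U] U T(2) by blast
        moreover have xM: "x \<in> space M" using x by (simp add: S_def)
        ultimately have "measure M U \<le> measure M ({x} \<union> (space M - S))"
          by (intro finite_measure_mono sets.Un[OF sing[OF xM] nullS(1)])
        also have "\<dots> \<le> measure M {x} + measure M (space M - S)" by (rule measure_Un_le[OF sing[OF xM] nullS(1)])
        also have "\<dots> = 0" using atomless[of x] x nullS(2) by (simp add: S_def)
        finally show False using x U unfolding S_def by force
      qed
    qed
  qed
  ultimately have "(UNIV :: real set) \<lesssim> S"
    using Urysohn.lepoll_perfect_set[of T S] T(1) unfolding polish_topology_def by blast
  then obtain g :: "real \<Rightarrow> 'a" where g: "inj g" unfolding lepoll_def by blast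
  obtain b :: "nat set \<Rightarrow> real" where b: "bij b" using nat_sets_eqpoll_reals unfolding eqpoll_def by blast
  have "inj_on (\<lambda>z. {i. z i = 1}) binary_seqs"
  proof (rule inj_onI)
    fix z z' assume zz: "z \<in> binary_seqs" "z' \<in> binary_seqs" "{i. z i = 1} = {i. z' i = 1}"
    show "z = z'"
    proof
      fix i
      have "z i \<in> {0, 1}" "z' i \<in> {0, 1}" using zz(1,2) unfolding binary_seqs_def by blast+
      moreover have "z i = 1 \<longleftrightarrow> z' i = 1" using zz(3) by blast
      ultimately show "z i = z' i" by auto
    qed
  qed
  moreover have "inj (g \<circ> b)" using g bij_is_inj[OF b] by (rule inj_compose)
  ultimately have "inj_on ((g \<circ> b) \<circ> (\<lambda>z. {i. z i = 1})) binary_seqs"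
    by (intro comp_inj_on inj_on_subset[OF \<open>inj (g \<circ> b)\<close> subset_UNIV])
  then show ?thesis by (rule exI[of "\<lambda>\<iota>. inj_on \<iota> binary_seqs"])
qed

lemma card_mod_class_le:
  fixes k :: nat assumes "k > 0"
  shows "card {j \<in> {..<n}. j mod k = i} \<le> Suc (n div k)"
proof -
  have "card {j \<in> {..<n}. j mod k = i} \<le> card {..n div k}"
  proof (rule card_inj_on_le[of "\<lambda>j. j div k"])
    show "inj_on (\<lambda>j. j div k) {j \<in> {..<n}. j mod k = i}"
      by (rule inj_onI) (metis (mono_tags, lifting) div_mult_mod_eq mem_Collect_eq)
    show "(\<lambda>j. j div k) ` {j \<in> {..<n}. j mod k = i} \<subseteq> {..n div k}" by (auto intro: div_le_mono)
  qed simp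
  then show ?thesis by simp
qed

context loc_glob_sequence begin

text \<open>An atom of mass \<open>p\<close> forces every Borel colouring to have a colour class of measure at least \<open>p\<close>,
  whereas large finite sets have balanced colourings with small classes.\<close>

lemma atom_imp_bounded:
  assumes x: "x \<in> space M" and p: "measure M {x} > 0"
  shows "\<exists>N. \<forall>\<^sub>F n in sequentially. card (V n) \<le> N"
proof -
  let ?p = "measure M {x}"
  obtain D' where D': "bounded_degree (space M) E D'" "\<And>n. bounded_degree (V n) (EG n) D'" using common_degree by auto
  interpret prob_space M using G unfolding graphing_def by (simp add: Let_def)
  \<comment> \<open>Balanced classes have measure at most 2 / k, which is below p / 2; with a
    transfer error of p / 4 they still cannot match a class containing the atom.\<close>
  obtain k :: nat where k: "4 / ?p < real k" using reals_Archimedean2 by blast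
  have k0: "k > 0" using k p by (cases k) (auto simp: divide_less_0_iff not_less)
  have kp: "2 / real k < ?p / 2" using k p k0 by (simp add: field_simps)
  define L where "L = real (card (ball_types D' k 1))"
  define \<epsilon> where "\<epsilon> = ?p / (4 * (L + 1))"
  have \<epsilon>: "\<epsilon> > 0" using p by (simp add: \<epsilon>_def L_def add_nonneg_pos)
  have "L * ?p \<le> (L + 1) * ?p" using p by (intro mult_right_mono) auto
  then have L\<epsilon>: "L * \<epsilon> \<le> ?p / 4" unfolding \<epsilon>_def by (simp add: field_simps L_def add_nonneg_pos)
  have "1 \<le> k" using k0 by simp
  from eventually_hausd[OF this order_refl \<epsilon>] have "\<forall>\<^sub>F n in sequentially. card (V n) \<le> k"
  proof eventually_elim
    fix n
    assume H: "hausd (dist_distr 1) (Q_kr k 1 (as_graphing (V n) (EG n))) (Q_kr k 1 (M, E)) < ereal \<epsilon>"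
    show "card (V n) \<le> k"
    proof (rule ccontr)
      assume "\<not> card (V n) \<le> k"
      then have big: "k < card (V n)" by simp
      let ?M = "uniform_count_measure (V n)"
      have fV: "finite (V n)" using fin[of n] unfolding fin_graph_def by simp
      obtain b where b: "bij_betw b (V n) {..<card (V n)}"
        using ex_bij_betw_finite_nat[OF fV] by (auto simp: atLeast0LessThan)
      define c where "c y = b y mod k" for y
      have c: "borel_coloring ?M k c"
        unfolding borel_coloring_def c_def using k0 by (auto simp: space_as_graphing sets_uniform_count_measure)
      have "P_col (as_graphing (V n) (EG n)) 1 c \<in> Q_kr k 1 (as_graphing (V n) (EG n))"
        unfolding Q_kr_def as_graphing_def using c by auto
      from hausd_lessD(1)[OF H this] obtain c' where c': "borel_coloring M k c'"
        "dist_distr 1 (P_col (as_graphing (V n) (EG n)) 1 c) (P_col (M, E) 1 c') < ereal \<epsilon>"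
        unfolding Q_kr_def by auto
      define i where "i = c' x"
      \<comment> \<open>The colour of the root is a statistic of the coloured ball of any radius;
        radius 1 is the smallest that the notion of convergence covers.\<close>
      have "\<bar>measure ?M {y \<in> space ?M. c y = i} - measure M {y \<in> space M. c' y = i}\<bar> \<le> real (card (ball_types D' k 1)) * \<epsilon>"
      proof (rule statistics_close[where Q="\<lambda>E c x. c x = i" and E="EG n" and E'=E and r=1])
        show "(c y = i) = (c'' y' = i)" if "ball_eqv 1 E c y E' c'' y'" for E c y E' c'' y'
          using that centre_in_ball[of y E 1] unfolding ball_eqv_def by metis
      qed (use graphing_n G D' c c'(1) dist_distr_lessD[OF c'(2)] in \<open>auto simp: space_as_graphing as_graphing_def\<close>)
      then have close: "measure M {y \<in> space M. c' y = i} \<le> measure ?M {y \<in> space ?M. c y = i} + ?p / 4"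
        using L\<epsilon> unfolding L_def by linarith
      have "?p \<le> measure M {y \<in> space M. c' y = i}"
      proof (rule finite_measure_mono)
        have "i < k" using c'(1) x unfolding borel_coloring_def i_def by auto
        then show "{y \<in> space M. c' y = i} \<in> sets M" using c'(1) unfolding borel_coloring_def by auto
      qed (use x in \<open>auto simp: i_def\<close>)
      moreover have "measure ?M {y \<in> space ?M. c y = i} \<le> 2 / real k"
      proof -
        have "card {y \<in> V n. c y = i} = card {j \<in> {..<card (V n)}. j mod k = i}"
        proof (rule bij_betw_same_card[of b], unfold bij_betw_def, intro conjI)
          show "inj_on b {y \<in> V n. c y = i}" using b unfolding bij_betw_def by (auto intro: inj_on_subset)
          have "b ` V n = {..<card (V n)}" using b unfolding bij_betw_def by simp
          then show "b ` {y \<in> V n. c y = i} = {j \<in> {..<card (V n)}. j mod k = i}" unfolding c_def by auto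
        qed
        also have "\<dots> \<le> Suc (card (V n) div k)" by (rule card_mod_class_le[OF k0])
        finally have "real (card {y \<in> V n. c y = i}) \<le> real (card (V n) div k) + 1" by simp
        also have "\<dots> \<le> real (card (V n)) / real k + 1"
        proof -
          have "real (card (V n) div k) * real k \<le> real (card (V n))"
            by (metis div_times_less_eq_dividend of_nat_le_iff of_nat_mult)
          then show ?thesis using k0 by (simp add: field_simps)
        qed
        also have "\<dots> \<le> 2 * (real (card (V n)) / real k)" using big k0 by (simp add: field_simps)
        finally have "real (card {y \<in> V n. c y = i}) / real (card (V n)) \<le> 2 / real k"
          using big k0 by (simp add: field_simps)
        then show ?thesis using measure_uniform_count[OF fV, of "{y \<in> V n. c y = i}"] by (simp add: space_as_graphing)
      qed
      ultimately show False using close kp p by linarith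
    qed
  qed
  then show ?thesis by blast
qed

lemma continuum_or_bounded:
  "(\<exists>\<iota> :: (nat \<Rightarrow> real) \<Rightarrow> 'a. inj_on \<iota> binary_seqs) \<or> (\<exists>N. \<forall>\<^sub>F n in sequentially. card (V n) \<le> N)"
proof (cases "\<exists>x\<in>space M. measure M {x} > 0")
  case True
  then show ?thesis using atom_imp_bounded by blast
next
  case False
  have "standard_borel M" "prob_space M" using G unfolding graphing_def by (auto simp: Let_def)
  moreover have "measure M {x} = 0" if "x \<in> space M" for x using False that measure_nonneg[of M "{x}"] by (metis order_le_less)
  ultimately show ?thesis using atomless_imp_continuum by blast
qed

section \<open>Uniform continuity and the theorem\<close>

lemma loc_continuousD:
  assumes "loc_continuous f" "\<And>n. graphing (Hs n)" "graphing H" "local_conv Hs H"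
  shows "(\<lambda>n. f (Hs n)) \<longlonglongrightarrow> f H"
  using assms unfolding loc_continuous_def by blast

text \<open>By contradiction along pairs that get closer at growing radii. A subsequence of the
  first members has a local limit, the second members share it, and continuity of f there brings
  both values together. The threshold n0 is chosen before \<epsilon>: in the case of bounded sizes
  the bound is available from n0 on.\<close>

lemma uniform_continuity_finite:
  assumes f: "loc_continuous f"
  obtains n0 where "\<And>\<epsilon>. \<epsilon> > 0 \<Longrightarrow> \<exists>r\<ge>1. \<exists>\<delta>>0. \<forall>n\<ge>n0. \<forall>n'\<ge>n0. \<forall>F\<subseteq>EG n. \<forall>F'\<subseteq>EG n'.
     loc_close r \<delta> (as_graphing (V n) F) (as_graphing (V n') F') \<longrightarrow> \<bar>f (as_graphing (V n) F) - f (as_graphing (V n') F')\<bar> < \<epsilon>"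
proof -
  obtain n0 where n0: "(\<exists>\<iota> :: (nat \<Rightarrow> real) \<Rightarrow> 'a. inj_on \<iota> binary_seqs) \<or> (\<exists>N. \<forall>n\<ge>n0. card (V n) \<le> N)"
    using continuum_or_bounded unfolding eventually_sequentially by blast
  have "\<exists>r\<ge>1. \<exists>\<delta>>0. \<forall>n\<ge>n0. \<forall>n'\<ge>n0. \<forall>F\<subseteq>EG n. \<forall>F'\<subseteq>EG n'.
     loc_close r \<delta> (as_graphing (V n) F) (as_graphing (V n') F') \<longrightarrow> \<bar>f (as_graphing (V n) F) - f (as_graphing (V n') F')\<bar> < \<epsilon>"
    if \<epsilon>: "\<epsilon> > 0" for \<epsilon>
  proof (rule ccontr)
    assume neg: "\<not> ?thesis"
    define bad where "bad j t \<longleftrightarrow> (case t of (n, n', F, F') \<Rightarrow> n \<ge> n0 \<and> n' \<ge> n0 \<and> F \<subseteq> EG n \<and> F' \<subseteq> EG n' \<and>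
        loc_close (Suc j) (inverse (real (Suc j))) (as_graphing (V n) F) (as_graphing (V n') F') \<and>
        \<not> \<bar>f (as_graphing (V n) F) - f (as_graphing (V n') F')\<bar> < \<epsilon>)" for j t
    have "\<exists>t. bad j t" for j
    proof (rule ccontr)
      assume nb: "\<nexists>t. bad j t"
      have "\<bar>f (as_graphing (V n) F) - f (as_graphing (V n') F')\<bar> < \<epsilon>"
        if "n \<ge> n0" "n' \<ge> n0" "F \<subseteq> EG n" "F' \<subseteq> EG n'"
          "loc_close (Suc j) (inverse (real (Suc j))) (as_graphing (V n) F) (as_graphing (V n') F')" for n n' F F'
      proof -
        have "\<not> bad j (n, n', F, F')" using nb by (rule contrapos_nn) (rule exI)
        then show ?thesis using that unfolding bad_def prod.case by (simp only: simp_thms)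
      qed
      then have "\<exists>r\<ge>1. \<exists>\<delta>>0. \<forall>n\<ge>n0. \<forall>n'\<ge>n0. \<forall>F\<subseteq>EG n. \<forall>F'\<subseteq>EG n'.
         loc_close r \<delta> (as_graphing (V n) F) (as_graphing (V n') F') \<longrightarrow> \<bar>f (as_graphing (V n) F) - f (as_graphing (V n') F')\<bar> < \<epsilon>"
        by (intro exI[of _ "Suc j"] exI[of _ "inverse (real (Suc j))"] conjI allI impI) simp_all
      then show False using neg by (rule notE[rotated])
    qed
    then obtain t where t: "\<And>j. bad j (t j)" by metis
    define n n' F F' where "n j = fst (t j)" and "n' j = fst (snd (t j))" and "F j = fst (snd (snd (t j)))"
      and "F' j = snd (snd (snd (t j)))" for j
    have b: "n j \<ge> n0" "n' j \<ge> n0" "F j \<subseteq> EG (n j)" "F' j \<subseteq> EG (n' j)"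
        "loc_close (Suc j) (inverse (real (Suc j))) (as_graphing (V (n j)) (F j)) (as_graphing (V (n' j)) (F' j))"
        "\<not> \<bar>f (as_graphing (V (n j)) (F j)) - f (as_graphing (V (n' j)) (F' j))\<bar> < \<epsilon>" for j
      using t[of j] unfolding bad_def n_def n'_def F_def F'_def by (auto split: prod.splits)
    have fg: "fin_graph D (V (n j)) (F j)" "fin_graph D (V (n' j)) (F' j)" for j
      using fin_graph_subset[OF fin b(3)] fin_graph_subset[OF fin b(4)] by auto
    have "(\<exists>\<iota> :: (nat \<Rightarrow> real) \<Rightarrow> 'a. inj_on \<iota> binary_seqs) \<or> (\<exists>N. \<forall>j. card (V (n j)) \<le> N)"
      using n0 b(1) by blast
    from local_compactness[OF fg(1) this] obtain \<rho> and H :: "'a graphing" where \<rho>: "strict_mono \<rho>" and H: "graphing H"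
      and conv: "local_conv (\<lambda>j. as_graphing (V (n (\<rho> j))) (F (\<rho> j))) H" by blast
    \<comment> \<open>At each fixed radius the statistics of the paired graphs differ by at most
      1/(j+1) for large j, so the second members inherit the limit.\<close>
    have "local_conv (\<lambda>j. as_graphing (V (n' (\<rho> j))) (F' (\<rho> j))) H"
      unfolding local_conv_def
    proof (intro allI impI)
      fix r :: nat and \<alpha> assume r: "1 \<le> r" and \<alpha>: "rooted_graph r \<alpha>"
      let ?P = "\<lambda>j. P_loc (as_graphing (V (n (\<rho> j))) (F (\<rho> j))) r \<alpha>" and ?P' = "\<lambda>j. P_loc (as_graphing (V (n' (\<rho> j))) (F' (\<rho> j))) r \<alpha>"
      have lim: "?P \<longlonglongrightarrow> P_loc H r \<alpha>" using conv r \<alpha> unfolding local_conv_def by blast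
      have "\<bar>?P j - ?P' j\<bar> \<le> inverse (real (Suc j))" if "j \<ge> r" for j
      proof -
        have j: "j \<le> \<rho> j" using \<rho> by (rule strict_mono_imp_increasing)
        then have "\<bar>?P j - ?P' j\<bar> \<le> inverse (real (Suc (\<rho> j)))"
          using b(5)[of "\<rho> j", unfolded loc_close_def, rule_format, OF _ \<alpha>] r that by simp
        also have "\<dots> \<le> inverse (real (Suc j))" using j by (simp add: field_simps)
        finally show ?thesis .
      qed
      then have "(\<lambda>j. ?P j - ?P' j) \<longlonglongrightarrow> 0"
        by (intro Lim_null_comparison[OF _ LIMSEQ_inverse_real_of_nat]) (auto simp: eventually_sequentially)
      from tendsto_diff[OF lim this] show "?P' \<longlonglongrightarrow> P_loc H r \<alpha>" by simp
    qed
    from tendsto_diff[OF loc_continuousD[OF f graphing_finite[OF fg(1)] H conv] loc_continuousD[OF f graphing_finite[OF fg(2)] H this]]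
    have "(\<lambda>j. f (as_graphing (V (n (\<rho> j))) (F (\<rho> j))) - f (as_graphing (V (n' (\<rho> j))) (F' (\<rho> j)))) \<longlonglongrightarrow> 0"
      by simp
    then have "\<exists>j. \<bar>f (as_graphing (V (n (\<rho> j))) (F (\<rho> j))) - f (as_graphing (V (n' (\<rho> j))) (F' (\<rho> j)))\<bar> < \<epsilon>"
      using LIMSEQ_D[OF _ \<epsilon>, of _ 0] by fastforce
    then show False using b(6) by blast
  qed
  then show thesis using that by blast
qed

text \<open>The subgraph of the limit is itself a local limit of decoded finite subgraphs, so
  continuity of f at it yields a finite subgraph close to it both in statistics and in
  value.\<close>

lemma limit_subgraph_approximable:
  assumes f: "loc_continuous f" and k: "k \<ge> 1" and F: "graph_edge_coloring k (M, E) F" and \<delta>: "\<delta> > 0" and \<eta>: "\<eta> > 0"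
  obtains n F' where "n \<ge> n0" "F' \<subseteq> EG n" "loc_close r \<delta> (as_graphing (V n) F') (M, {e \<in> E. F e \<in> S})"
    "\<bar>f (as_graphing (V n) F') - f (M, {e \<in> E. F e \<in> S})\<bar> < \<eta>"
proof -
  let ?H = "(M, {e \<in> E. F e \<in> S})"
  have H: "graphing ?H" by (rule graphing_subset[OF G _ borel_edge_subset_preimage[OF F]]) auto
  have ex: "\<exists>t. fst t \<ge> n0 \<and> snd t \<subseteq> EG (fst t) \<and> loc_close (Suc j) (inverse (real (Suc j))) (as_graphing (V (fst t)) (snd t)) ?H" for j
  proof -
    have "inverse (real (Suc j)) > 0" by simp
    have r: "1 \<le> Suc j" by simp
    from eventually_happens'[OF sequentially_bot eventually_conj[OF
        edge_coloring_from_limit[OF k r \<open>inverse (real (Suc j)) > 0\<close>] eventually_ge_at_top[of n0]]]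
    obtain n F' where "n \<ge> n0" "\<forall>S. loc_close (Suc j) (inverse (real (Suc j))) (as_graphing (V n) {e \<in> EG n. F' e \<in> S}) (M, {e \<in> E. F e \<in> S})"
      using F by blast
    then show ?thesis by (intro exI[of _ "(n, {e \<in> EG n. F' e \<in> S})"]) auto
  qed
  from choice[OF allI[OF ex]] obtain t where "\<forall>j. fst (t j) \<ge> n0 \<and> snd (t j) \<subseteq> EG (fst (t j)) \<and>
     loc_close (Suc j) (inverse (real (Suc j))) (as_graphing (V (fst (t j))) (snd (t j))) ?H" ..
  then have t: "\<And>j. fst (t j) \<ge> n0" "\<And>j. snd (t j) \<subseteq> EG (fst (t j))"
    "\<And>j. loc_close (Suc j) (inverse (real (Suc j))) (as_graphing (V (fst (t j))) (snd (t j))) ?H" by (simp_all only: simp_thms)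
  let ?K = "\<lambda>j. as_graphing (V (fst (t j))) (snd (t j))"
  have "local_conv ?K ?H"
    unfolding local_conv_def
  proof (intro allI impI)
    fix r :: nat and \<alpha> assume r: "1 \<le> r" and \<alpha>: "rooted_graph r \<alpha>"
    have "\<bar>P_loc (?K j) r \<alpha> - P_loc ?H r \<alpha>\<bar> \<le> inverse (real (Suc j))" if "j \<ge> r" for j
      using t(3)[of j, unfolded loc_close_def, rule_format, OF _ \<alpha>] r that by simp
    then have "(\<lambda>j. P_loc (?K j) r \<alpha> - P_loc ?H r \<alpha>) \<longlonglongrightarrow> 0"
      by (intro Lim_null_comparison[OF _ LIMSEQ_inverse_real_of_nat]) (auto simp: eventually_sequentially)
    then show "(\<lambda>j. P_loc (?K j) r \<alpha>) \<longlonglongrightarrow> P_loc ?H r \<alpha>" by (rule LIM_zero_cancel)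
  qed
  moreover have "graphing (?K j)" for j by (rule graphing_finite[OF fin_graph_subset[OF fin t(2)]])
  ultimately have "(\<lambda>j. f (?K j)) \<longlonglongrightarrow> f ?H" by (intro loc_continuousD[OF f _ H])
  then obtain J where J: "\<And>j. j \<ge> J \<Longrightarrow> \<bar>f (?K j) - f ?H\<bar> < \<eta>" using LIMSEQ_D[OF _ \<eta>] by fastforce
  obtain j1 where j1: "inverse (real (Suc j1)) < \<delta>" using reals_Archimedean[OF \<delta>] by blast
  let ?j = "max J (max j1 r)"
  have "inverse (real (Suc ?j)) \<le> inverse (real (Suc j1))" by (simp add: field_simps)
  then have "inverse (real (Suc ?j)) \<le> \<delta>" using j1 by linarith
  then have "loc_close r \<delta> (?K ?j) ?H" by (intro loc_close_mono[OF t(3)[of ?j]]) auto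
  then show thesis using that[OF t(1,2)[of ?j]] J[of ?j] by simp
qed

text \<open>The given finite subgraph is compared with a finite approximation of the limit subgraph;
  each is within \<delta> / 2 of the latter. The approximation depends on F' and S, the constants do
  not.\<close>

lemma uniform_continuity_limit:
  assumes f: "loc_continuous f" and k: "k \<ge> 1" and \<epsilon>: "\<epsilon> > 0"
  obtains n0 r \<delta> where "r \<ge> 1" "\<delta> > 0" "\<And>n F F' S. n \<ge> n0 \<Longrightarrow> F \<subseteq> EG n \<Longrightarrow> graph_edge_coloring k (M, E) F' \<Longrightarrow>
     loc_close r \<delta> (as_graphing (V n) F) (M, {e \<in> E. F' e \<in> S}) \<Longrightarrow>
     \<bar>f (as_graphing (V n) F) - f (M, {e \<in> E. F' e \<in> S})\<bar> \<le> \<epsilon>"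
proof -
  obtain n0 where n0: "\<And>\<epsilon>. \<epsilon> > 0 \<Longrightarrow> \<exists>r\<ge>1. \<exists>\<delta>>0. \<forall>n\<ge>n0. \<forall>n'\<ge>n0. \<forall>F\<subseteq>EG n. \<forall>F'\<subseteq>EG n'.
     loc_close r \<delta> (as_graphing (V n) F) (as_graphing (V n') F') \<longrightarrow> \<bar>f (as_graphing (V n) F) - f (as_graphing (V n') F')\<bar> < \<epsilon>"
    by (rule uniform_continuity_finite[OF f]) blast
  have e2: "\<epsilon> / 2 > 0" using \<epsilon> by simp
  obtain r \<delta> where r: "r \<ge> 1" "\<delta> > 0" and uc: "\<And>n n' F F'. n \<ge> n0 \<Longrightarrow> n' \<ge> n0 \<Longrightarrow> F \<subseteq> EG n \<Longrightarrow> F' \<subseteq> EG n' \<Longrightarrow>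
     loc_close r \<delta> (as_graphing (V n) F) (as_graphing (V n') F') \<Longrightarrow> \<bar>f (as_graphing (V n) F) - f (as_graphing (V n') F')\<bar> < \<epsilon> / 2"
    using n0[OF e2] by auto
  have d2: "\<delta> / 2 > 0" using r by simp
  have "\<bar>f (as_graphing (V n) F) - f (M, {e \<in> E. F' e \<in> S})\<bar> \<le> \<epsilon>"
    if n: "n \<ge> n0" "F \<subseteq> EG n" and F': "graph_edge_coloring k (M, E) F'"
      and close: "loc_close r (\<delta> / 2) (as_graphing (V n) F) (M, {e \<in> E. F' e \<in> S})" for n F F' S
  proof -
    obtain n' F2 where F2: "n' \<ge> n0" "F2 \<subseteq> EG n'" "loc_close r (\<delta> / 2) (as_graphing (V n') F2) (M, {e \<in> E. F' e \<in> S})"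
      "\<bar>f (as_graphing (V n') F2) - f (M, {e \<in> E. F' e \<in> S})\<bar> < \<epsilon> / 2"
      by (rule limit_subgraph_approximable[OF f k F' d2 e2])
    have "loc_close r \<delta> (as_graphing (V n) F) (as_graphing (V n') F2)"
      using loc_close_trans[OF close loc_close_sym[OF F2(3)]] by simp
    from uc[OF n(1) F2(1) n(2) F2(2) this] show ?thesis using F2(4) by linarith
  qed
  then show thesis using that[OF r(1) d2] by blast
qed

end

section \<open>Hausdorff distance of quotient sets and conclusion\<close>

lemma hausd_le:
  assumes "\<And>a. a \<in> A \<Longrightarrow> \<exists>b\<in>B. d a b \<le> \<epsilon>" "\<And>b. b \<in> B \<Longrightarrow> \<exists>a\<in>A. d a b \<le> \<epsilon>"
  shows "hausd d A B \<le> \<epsilon>"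
  unfolding hausd_def max.bounded_iff
proof (intro conjI SUP_least)
  fix a assume "a \<in> A"
  then obtain b where "b \<in> B" "d a b \<le> \<epsilon>" using assms(1) by blast
  then show "(INF b\<in>B. d a b) \<le> \<epsilon>" by (rule INF_lower2)
next
  fix b assume "b \<in> B"
  then obtain a where "a \<in> A" "d a b \<le> \<epsilon>" using assms(2) by blast
  then show "(INF a\<in>A. d a b) \<le> \<epsilon>" by (rule INF_lower2)
qed

lemma hausd_nonneg:
  assumes "a \<in> A" "\<And>a b. 0 \<le> d a b"
  shows "0 \<le> hausd d A B"
proof -
  have "0 \<le> (INF b\<in>B. d a b)" using assms(2) by (rule INF_greatest)
  also have "\<dots> \<le> (SUP a\<in>A. INF b\<in>B. d a b)" using assms(1) by (rule SUP_upper)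
  finally show ?thesis unfolding hausd_def by (simp add: max.coboundedI1)
qed

text \<open>Nonnegativity is drawn from a member of A n: over the empty set a supremum in
  \<open>ereal\<close> is minus infinity.\<close>

lemma hausd_tendsto_0:
  assumes "\<And>n. \<exists>a. a \<in> A n" "\<And>a b. 0 \<le> d a b"
    and "\<And>\<epsilon>::real. \<epsilon> > 0 \<Longrightarrow> \<forall>\<^sub>F n in sequentially. hausd d (A n) B \<le> ereal \<epsilon>"
  shows "(\<lambda>n. hausd d (A n) B) \<longlonglongrightarrow> 0"
proof (rule order_tendstoI)
  fix a :: ereal assume "a < 0"
  then have "a < hausd d (A n) B" for n
    using assms(1)[of n] hausd_nonneg[of _ "A n" d B] assms(2) by (meson less_le_trans)
  then show "\<forall>\<^sub>F n in sequentially. a < hausd d (A n) B" by simp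
next
  fix a :: ereal assume "0 < a"
  then obtain \<epsilon> where "0 < ereal \<epsilon>" "ereal \<epsilon> < a" using ereal_dense2 by blast
  then show "\<forall>\<^sub>F n in sequentially. hausd d (A n) B < a"
    using eventually_mono[OF assms(3)[of \<epsilon>]] by (simp add: le_less_trans)
qed

theorem theorem3p2:
  fixes D :: nat
    and V :: "nat \<Rightarrow> 'a set" and EG :: "nat \<Rightarrow> 'a set set"
    and G :: "'a graphing"
    and f :: "'a graphing \<Rightarrow> real"
  assumes "D > 0"
    and "\<And>n. fin_graph D (V n) (EG n)"
    and "graphing G"
    and "local_global_conv (\<lambda>n. as_graphing (V n) (EG n)) G"
    and "loc_continuous f"
  shows "quot_conv EG (\<lambda>n. Pow (EG n)) (\<lambda>n. phi_set (as_graphing (V n) (EG n)) f)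
           (snd G) (borel_edge_subsets G) (phi_set G f)"
  unfolding quot_conv_def
proof (intro allI impI)
  fix k :: nat assume k: "1 \<le> k"
  obtain M E where ME: "G = (M, E)" by (cases G)
  interpret loc_glob_sequence D V EG M E
    using assms(2-4) unfolding ME by unfold_locales
  let ?A = "\<lambda>n. quotients k (EG n) (Pow (EG n)) (phi_set (as_graphing (V n) (EG n)) f)"
  let ?B = "quotients k E (borel_edge_subsets G) (phi_set G f)"
  have A: "p \<in> ?A n \<longleftrightarrow> (\<exists>F. (\<forall>e\<in>EG n. F e < k) \<and>
      p = (\<lambda>S. if S \<subseteq> {..<k} then f (as_graphing (V n) {e \<in> EG n. F e \<in> S}) else 0))" for p n
    unfolding quotients_def phi_set_def as_graphing_def fst_conv mem_Collect_eq by blast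
  have B: "p \<in> ?B \<longleftrightarrow> (\<exists>F. graph_edge_coloring k (M, E) F \<and>
      p = (\<lambda>S. if S \<subseteq> {..<k} then f (M, {e \<in> E. F e \<in> S}) else 0))" for p
    unfolding quotients_def phi_set_def graph_edge_coloring_def ME fst_conv snd_conv mem_Collect_eq by blast
  show "(\<lambda>n. hausd (dist_vec k) (?A n) (quotients k (snd G) (borel_edge_subsets G) (phi_set G f))) \<longlonglongrightarrow> 0"
    unfolding ME snd_conv unfolding ME[symmetric]
  proof (rule hausd_tendsto_0)
    show "\<exists>p. p \<in> ?A n" for n unfolding A using k by (intro exI[of _ "\<lambda>_. 0"] exI conjI) auto
    show "0 \<le> dist_vec k p q" for p q
      unfolding dist_vec_def by (rule SUP_upper2[of "{}"]) auto
    fix \<epsilon> :: real assume \<epsilon>: "\<epsilon> > 0"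
    obtain n0 r \<delta> where r: "r \<ge> 1" "\<delta> > 0" and uc: "\<And>n F F' S. n \<ge> n0 \<Longrightarrow> F \<subseteq> EG n \<Longrightarrow> graph_edge_coloring k (M, E) F' \<Longrightarrow>
       loc_close r \<delta> (as_graphing (V n) F) (M, {e \<in> E. F' e \<in> S}) \<Longrightarrow>
       \<bar>f (as_graphing (V n) F) - f (M, {e \<in> E. F' e \<in> S})\<bar> \<le> \<epsilon>"
      by (rule uniform_continuity_limit[OF assms(5) k \<epsilon>]) blast
    \<comment> \<open>Closeness holds for the same pair F, F' and all S, so the supremum over S
      stays below \<epsilon>.\<close>
    have dist: "dist_vec k (\<lambda>S. if S \<subseteq> {..<k} then f (as_graphing (V n) {e \<in> EG n. F e \<in> S}) else 0)
        (\<lambda>S. if S \<subseteq> {..<k} then f (M, {e \<in> E. F' e \<in> S}) else 0) \<le> ereal \<epsilon>"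
      if "n \<ge> n0" "graph_edge_coloring k (M, E) F'"
        "\<forall>S. loc_close r \<delta> (as_graphing (V n) {e \<in> EG n. F e \<in> S}) (M, {e \<in> E. F' e \<in> S})" for n F F'
      unfolding dist_vec_def
    proof (rule SUP_least)
      fix S assume "S \<in> Pow {..<k}"
      then show "ereal \<bar>(if S \<subseteq> {..<k} then f (as_graphing (V n) {e \<in> EG n. F e \<in> S}) else 0) -
          (if S \<subseteq> {..<k} then f (M, {e \<in> E. F' e \<in> S}) else 0)\<bar> \<le> ereal \<epsilon>"
        using uc[OF that(1) _ that(2), of "{e \<in> EG n. F e \<in> S}" S] that(3) by auto
    qed
    \<comment> \<open>None of the three thresholds depends on the colouring, so one index bounds
      both suprema in the Hausdorff distance.\<close>
    show "\<forall>\<^sub>F n in sequentially. hausd (dist_vec k) (?A n) ?B \<le> ereal \<epsilon>"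
      using edge_coloring_to_limit[OF k r] edge_coloring_from_limit[OF k r] eventually_ge_at_top[of n0]
    proof eventually_elim
      case (elim n)
      show ?case
      proof (rule hausd_le)
        fix p assume "p \<in> ?A n"
        then obtain F where F: "\<forall>e\<in>EG n. F e < k" "p = (\<lambda>S. if S \<subseteq> {..<k} then f (as_graphing (V n) {e \<in> EG n. F e \<in> S}) else 0)"
          unfolding A by blast
        obtain F' where F': "graph_edge_coloring k (M, E) F'"
          "\<forall>S. loc_close r \<delta> (as_graphing (V n) {e \<in> EG n. F e \<in> S}) (M, {e \<in> E. F' e \<in> S})" using elim(1) F(1) by blast
        then show "\<exists>q\<in>?B. dist_vec k p q \<le> ereal \<epsilon>"
          using dist[OF elim(3) F'] unfolding F(2) Bex_def B by blast
      next
        fix q assume "q \<in> ?B"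
        then obtain F' where F': "graph_edge_coloring k (M, E) F'" "q = (\<lambda>S. if S \<subseteq> {..<k} then f (M, {e \<in> E. F' e \<in> S}) else 0)"
          unfolding B by blast
        obtain F where F: "\<forall>e\<in>EG n. F e < k"
          "\<forall>S. loc_close r \<delta> (as_graphing (V n) {e \<in> EG n. F e \<in> S}) (M, {e \<in> E. F' e \<in> S})" using elim(2) F'(1) by blast
        then show "\<exists>p\<in>?A n. dist_vec k p q \<le> ereal \<epsilon>"
          using dist[OF elim(3) F'(1) F(2)] unfolding F'(2) Bex_def A by blast
      qed
    qed
  qed
qed

end
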